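(* Let $d\in\mathbb{N}$, $\alpha,\varepsilon>0$. Suppose that $1\ge \alpha\ge \varepsilon\cdot \log(nd)^{O(1)}$ and that \[ n \ge \tilde{O}\!\left(\frac{\sqrt{d}}{\alpha^2}+\frac{d\varepsilon^3}{\alpha^4}+\min\!\left(\frac{d^{2/3}\varepsilon^{2/3}}{\alpha^{8/3}},\frac{d\varepsilon}{\alpha^2}\right)\right). \] Then there exists an $\varepsilon$-robust mean tester in the oblivious contamination model using $n$ samples: given $n$ obliviously $\varepsilon$-contaminated samples in $\mathbb{R}^d$, it distinguishes (with success probability at least $2/3$ in each case) the null hypothesis that the uncorrupted samples are drawn i.i.d. from $\mathcal{N}(0,I)$ from the alternative that they are drawn i.i.d. from $\mathcal{N}(\mu,I)$ for some $\mu$ with $\|\mu\|_2\ge\alpha$.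
   Context: Oblivious contamination model: an adversary, knowing the algorithm and the distribution $\mathcal{D}$ but not the samples, chooses $\varepsilon n$ indices $i_1,\dots,i_{\varepsilon n}\in[n]$ and values $X''_{i_1},\dots,X''_{i_{\varepsilon n}}$; then $n$ i.i.d. samples $X'_1,\dots,X'_n\sim\mathcal{D}$ are drawn, and the algorithm receives $X_1,\dots,X_n$ with $X_{i_j}=X''_{i_j}$ and $X_i=X'_i$ for the other indices. The notation $\tilde O(\cdot)$ hides polylogarithmic factors (in $n,d,1/\alpha,1/\varepsilon$), and $\log(nd)^{O(1)}$ denotes a fixed polylogarithmic factor. *)

theory Defs
  imports "HOL-Probability.Probability"
begin

text \<open>The hidden constants must not depend on the dimension, so \<open>\<real>\<^sup>d\<close> is the product
  space over \<open>{..<d}\<close> for a natural number \<open>d\<close>, and \<open>n\<close> samples form a product over \<open>{..<n}\<close>.\<close>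

definition vec_space :: "nat \<Rightarrow> (nat \<Rightarrow> real) measure" where
  "vec_space d = PiM {..<d} (\<lambda>_. borel)"

definition sample_space :: "nat \<Rightarrow> nat \<Rightarrow> (nat \<Rightarrow> nat \<Rightarrow> real) measure" where
  "sample_space n d = PiM {..<n} (\<lambda>_. vec_space d)"

definition gaussian :: "nat \<Rightarrow> (nat \<Rightarrow> real) \<Rightarrow> (nat \<Rightarrow> real) measure" where
  "gaussian d \<mu> = PiM {..<d} (\<lambda>j. density lborel (normal_density (\<mu> j) 1))"

definition contaminate ::
  "nat \<Rightarrow> nat set \<Rightarrow> (nat \<Rightarrow> nat \<Rightarrow> real) \<Rightarrow> (nat \<Rightarrow> nat \<Rightarrow> real) \<Rightarrow> (nat \<Rightarrow> nat \<Rightarrow> real)" where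
  "contaminate n S z x = (\<lambda>i\<in>{..<n}. if i \<in> S then z i else x i)"

definition contaminated_samples ::
  "nat \<Rightarrow> nat \<Rightarrow> (nat \<Rightarrow> real) measure \<Rightarrow> nat set \<Rightarrow> (nat \<Rightarrow> nat \<Rightarrow> real)
    \<Rightarrow> (nat \<Rightarrow> nat \<Rightarrow> real) measure" where
  "contaminated_samples n d D S z =
     distr (PiM {..<n} (\<lambda>_. D)) (sample_space n d) (contaminate n S z)"

text \<open>The adversary's choices: at most \<open>\<epsilon> n\<close> indices and the values placed there
  (the entries of \<open>z\<close> outside \<open>S\<close> are never used). Since \<open>S\<close> and \<open>z\<close> are fixed
  independently of the samples, the contamination is oblivious.\<close>

definition adversary :: "nat \<Rightarrow> nat \<Rightarrow> real \<Rightarrow> (nat set \<times> (nat \<Rightarrow> nat \<Rightarrow> real)) set" where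
  "adversary n d \<epsilon> =
     {(S, z). S \<subseteq> {..<n} \<and> real (card S) \<le> \<epsilon> * real n \<and> z \<in> space (sample_space n d)}"

datatype verdict = Null | Alternative

text \<open>A tester may use internal randomness: it is a probability kernel from the samples to the
  verdicts. The adversary may depend on the kernel and on the distribution.\<close>

definition oblivious_robust_mean_tester ::
  "nat \<Rightarrow> nat \<Rightarrow> real \<Rightarrow> real \<Rightarrow> ((nat \<Rightarrow> nat \<Rightarrow> real) \<Rightarrow> verdict measure) \<Rightarrow> bool" where
  "oblivious_robust_mean_tester n d \<alpha> \<epsilon> T \<longleftrightarrow>
     T \<in> sample_space n d \<rightarrow>\<^sub>M prob_algebra (count_space UNIV) \<and>
     (\<forall>(S, z) \<in> adversary n d \<epsilon>.
        measure (bind (contaminated_samples n d (gaussian d (\<lambda>_. 0)) S z) T) {Null} \<ge> 2 / 3) \<and>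
     (\<forall>\<mu>. L2_set \<mu> {..<d} \<ge> \<alpha> \<longrightarrow>
        (\<forall>(S, z) \<in> adversary n d \<epsilon>.
           measure (bind (contaminated_samples n d (gaussian d \<mu>) S z) T) {Alternative} \<ge> 2 / 3))"

text \<open>The factor hidden by the soft-O notation: polylogarithmic in \<open>n, d, 1/\<alpha>, 1/\<epsilon>\<close>. Truncating the
  logarithm below at 1 keeps the factor from vanishing, e.g. for \<open>n = d = \<alpha> = \<epsilon> = 1\<close>.\<close>

definition polylog_factor :: "real \<Rightarrow> nat \<Rightarrow> nat \<Rightarrow> nat \<Rightarrow> real \<Rightarrow> real \<Rightarrow> real" where
  "polylog_factor C k n d \<alpha> \<epsilon> = C * (max 1 (ln (real n * real d / (\<alpha> * \<epsilon>)))) ^ k"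

definition sample_bound :: "nat \<Rightarrow> real \<Rightarrow> real \<Rightarrow> real" where
  "sample_bound d \<alpha> \<epsilon> =
     sqrt (real d) / \<alpha>\<^sup>2 + real d * \<epsilon> ^ 3 / \<alpha> ^ 4 +
     min (real d powr (2/3) * \<epsilon> powr (2/3) / \<alpha> powr (8/3)) (real d * \<epsilon> / \<alpha>\<^sup>2)"

end

theory Submission
  imports Defs
begin

text \<open>
  The tester adds and subtracts fresh Gaussian noise \<open>\<xi>\<close>: for an uncorrupted sample the two clones
  \<open>x + \<xi>\<close> and \<open>x - \<xi>\<close> are independent. The first clones are used to discard at most \<open>\<epsilon> n\<close> rows so that
  all integer combinations of the remaining rows have nearly the squared norm expected of
  Gaussian vectors; under the null hypothesis discarding the corrupted rows achieves this. The
  statistics are then computed from the second clones, so that discarding uncorrupted rows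
  introduces no bias.

  Split the remaining rows into three groups with sums \<open>Y\<^sub>0, Y\<^sub>1, Y\<^sub>2\<close>. A mean \<open>\<mu>\<close> shifts \<open>\<langle>Y\<^sub>a, Y\<^sub>b\<rangle>\<close>
  by order \<open>n\<^sup>2 \<parallel>\<mu>\<parallel>\<^sup>2\<close>, which the surviving corrupted rows can only hide through their correlation
  with \<open>\<mu>\<close>; this is impossible for \<open>n \<ge> d \<epsilon> / \<alpha>\<^sup>2\<close>. Otherwise hiding it in all three pairs forces
  \<open>\<langle>\<mu>, z\<^sub>a\<rangle> \<approx> - n\<^sub>a \<parallel>\<mu>\<parallel>\<^sup>2 / 2\<close>, where \<open>z\<^sub>a\<close> is the sum of the corrupted rows in group \<open>a\<close> and \<open>n\<^sub>a\<close> the number of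
  uncorrupted ones. This makes \<open>\<Sum>\<^sub>i \<langle>q\<^sub>i, Y\<^sub>1\<rangle> \<langle>q\<^sub>i, Y\<^sub>2\<rangle> - 2 \<langle>Y\<^sub>1, Y\<^sub>2\<rangle>\<close> over the rows \<open>q\<^sub>i\<close> of group 0 large,
  of order \<open>n\<^sup>3 \<parallel>\<mu>\<parallel>\<^sup>4 / \<epsilon>\<close>, against noise of order \<open>n\<^bsup>3/2\<^esup> d\<close>.
\<close>

section \<open>Gaussian cloning\<close>

text \<open>Splitting the sample would not serve: the corrupted rows vetted on one half are not
  those used on the other. Cloning vets and uses the same rows, and obliviousness enters because a
  corrupted point is independent of the noise added to it. Integer weights keep the family of
  combinations finite. A support of size \<open>u\<close> costs about \<open>u\<close> times a
  logarithm in the union bound, so squared norms are controlled up to \<open>dev d u\<close>, which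
  is \<open>sqrt (d * u) + u\<close>, relative to the weight. All that is used about the corrupted
  rows follows from this. Each term of the sample bound beats one quantity. Let
  \<open>\<kappa>\<close> be \<open>\<epsilon> * n\<close>. Pairs of uncorrupted sums fluctuate by
  \<open>n * sqrt d\<close> against a signal \<open>n^2 \<alpha>^2\<close>, which gives
  \<open>sqrt d / \<alpha>^2\<close>. Pairs of corrupted sums reach
  \<open>sqrt (d * \<kappa>) * \<kappa>\<close>, which gives
  \<open>d \<epsilon>^3 / \<alpha>^4\<close>. The comparison for the cubic statistic gives the
  fractional powers in the minimum. The gap between \<epsilon> and \<alpha> takes care of terms
  without \<open>d\<close>, such as \<open>\<kappa>^2\<close>.\<close>

abbreviation normal_measure :: "real \<Rightarrow> real \<Rightarrow> real measure" where
  "normal_measure \<mu> \<sigma> \<equiv> density lborel (normal_density \<mu> \<sigma>)"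

text \<open>Sum and difference of independent Gaussians of equal variance are uncorrelated, hence
  independent. The added variable is centred, so both clones keep the mean \<open>\<mu>\<close>. The
  iterated integral is the form that \<open>nn_integral_PiM_pair_map\<close> consumes.\<close>

lemma nn_integral_normal_rotation:
  fixes F :: "real \<times> real \<Rightarrow> ennreal"
  assumes [measurable]: "F \<in> borel_measurable (borel \<Otimes>\<^sub>M borel)"
  shows "(\<integral>\<^sup>+ x. \<integral>\<^sup>+ y. F (x + y, x - y) \<partial>normal_measure 0 1 \<partial>normal_measure \<mu> 1) =
    (\<integral>\<^sup>+ u. \<integral>\<^sup>+ v. F (u, v) \<partial>normal_measure \<mu> (sqrt 2) \<partial>normal_measure \<mu> (sqrt 2))"
proof -
  let ?n = "\<lambda>m s x. ennreal (normal_density m s x)"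
  \<comment> \<open>The parallelogram law in the exponent; 1/2 is the Jacobian of
    \<open>x = (u + v) / 2\<close> at fixed \<open>u\<close>, which appears in the last
    substitution.\<close>
  have dens: "(1/2) * (normal_density \<mu> 1 ((u + v)/2) * normal_density 0 1 ((u - v)/2)) =
      normal_density \<mu> (sqrt 2) u * normal_density \<mu> (sqrt 2) v" for u v
  proof -
    have e: "- (((u + v)/2 - \<mu>)\<^sup>2 / 2) + - (((u - v)/2)\<^sup>2 / 2) = - ((u-\<mu>)\<^sup>2 / 4) + - ((v-\<mu>)\<^sup>2/4)"
      by (simp add: power2_eq_square field_simps)
    have "sqrt (4 * pi) * sqrt (4 * pi) = 2 * (sqrt (2 * pi) * sqrt (2 * pi))" by simp
    then show ?thesis
      unfolding normal_density_def using e
      by (simp add: exp_add[symmetric] field_simps)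
  qed
  have "(\<integral>\<^sup>+ x. \<integral>\<^sup>+ y. F (x + y, x - y) \<partial>normal_measure 0 1 \<partial>normal_measure \<mu> 1) =
     (\<integral>\<^sup>+ x. ?n \<mu> 1 x * (\<integral>\<^sup>+ y. ?n 0 1 y * F (x + y, x - y) \<partial>lborel) \<partial>lborel)"
    by (simp add: nn_integral_density)
  also have "\<dots> = (\<integral>\<^sup>+ x. ?n \<mu> 1 x * (\<integral>\<^sup>+ u. ?n 0 1 (u - x) * F (u, 2 * x - u) \<partial>lborel) \<partial>lborel)"
  proof (rule nn_integral_cong)
    fix x :: real
    have "(\<integral>\<^sup>+ y. ?n 0 1 y * F (x + y, x - y) \<partial>lborel) =
        (\<integral>\<^sup>+ u. ?n 0 1 (-x + 1 * u) * F (x + (-x + 1 * u), x - (-x + 1 * u)) \<partial>lborel)"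
      by (subst nn_integral_real_affine[where c=1 and t="-x"]) simp_all
    then show "?n \<mu> 1 x * (\<integral>\<^sup>+ y. ?n 0 1 y * F (x + y, x - y) \<partial>lborel) =
        ?n \<mu> 1 x * (\<integral>\<^sup>+ u. ?n 0 1 (u - x) * F (u, 2 * x - u) \<partial>lborel)"
      by (simp add: algebra_simps)
  qed
  also have "\<dots> = (\<integral>\<^sup>+ x. \<integral>\<^sup>+ u. ?n \<mu> 1 x * (?n 0 1 (u - x) * F (u, 2 * x - u)) \<partial>lborel \<partial>lborel)"
    by (simp add: nn_integral_cmult)
  also have "\<dots> = (\<integral>\<^sup>+ u. \<integral>\<^sup>+ x. ?n \<mu> 1 x * (?n 0 1 (u - x) * F (u, 2 * x - u)) \<partial>lborel \<partial>lborel)"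
    by (rule lborel_pair.Fubini') simp
  also have "\<dots> = (\<integral>\<^sup>+ u. \<integral>\<^sup>+ v. ?n \<mu> (sqrt 2) u * (?n \<mu> (sqrt 2) v * F (u, v)) \<partial>lborel \<partial>lborel)"
  proof (rule nn_integral_cong)
    fix u :: real
    have "(\<integral>\<^sup>+ x. ?n \<mu> 1 x * (?n 0 1 (u - x) * F (u, 2 * x - u)) \<partial>lborel) =
       ennreal (1/2) * (\<integral>\<^sup>+ v. ?n \<mu> 1 (u/2 + 1/2 * v) * (?n 0 1 (u - (u/2 + 1/2 * v)) * F (u, 2 * (u/2 + 1/2 * v) - u)) \<partial>lborel)"
      by (subst nn_integral_real_affine[where c="1/2" and t="u/2"]) simp_all
    also have "\<dots> = (\<integral>\<^sup>+ v. ennreal (1/2) * (?n \<mu> 1 (u/2 + 1/2 * v) * (?n 0 1 (u - (u/2 + 1/2 * v)) * F (u, 2 * (u/2 + 1/2 * v) - u))) \<partial>lborel)"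
      by (rule nn_integral_cmult[symmetric]) simp
    also have "\<dots> = (\<integral>\<^sup>+ v. ?n \<mu> (sqrt 2) u * (?n \<mu> (sqrt 2) v * F (u, v)) \<partial>lborel)"
    proof (rule nn_integral_cong)
      fix v :: real
      have 1: "u/2 + 1/2 * v = (u+v)/2" "u - (u+v)/2 = (u - v)/2" "2 * ((u+v)/2) - u = v" by (auto simp: field_simps)
      have "ennreal (1/2) * (?n \<mu> 1 ((u+v)/2) * ?n 0 1 ((u-v)/2)) = ?n \<mu> (sqrt 2) u * ?n \<mu> (sqrt 2) v"
        using arg_cong[OF dens[of u v], of ennreal] by (simp only: ennreal_mult normal_density_nonneg
            mult_nonneg_nonneg zero_le_divide_1_iff zero_le_numeral)
      then show "ennreal (1/2) * (?n \<mu> 1 (u/2 + 1/2 * v) * (?n 0 1 (u - (u/2 + 1/2 * v)) * F (u, 2 * (u/2 + 1/2 * v) - u)))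
         = ?n \<mu> (sqrt 2) u * (?n \<mu> (sqrt 2) v * F (u, v))"
        unfolding 1 by (metis (no_types, lifting) mult.assoc)
    qed
    finally show "(\<integral>\<^sup>+ x. ?n \<mu> 1 x * (?n 0 1 (u - x) * F (u, 2 * x - u)) \<partial>lborel) =
      (\<integral>\<^sup>+ v. ?n \<mu> (sqrt 2) u * (?n \<mu> (sqrt 2) v * F (u, v)) \<partial>lborel)" .
  qed
  also have "\<dots> = (\<integral>\<^sup>+ u. ?n \<mu> (sqrt 2) u * (\<integral>\<^sup>+ v. ?n \<mu> (sqrt 2) v * F (u, v) \<partial>lborel) \<partial>lborel)"
    by (simp add: nn_integral_cmult)
  also have "\<dots> = (\<integral>\<^sup>+ u. \<integral>\<^sup>+ v. F (u, v) \<partial>normal_measure \<mu> (sqrt 2) \<partial>normal_measure \<mu> (sqrt 2))"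
    by (simp add: nn_integral_density)
  finally show ?thesis .
qed

text \<open>Tensorization: if each factor pair is carried to an independent pair, so are the
  products. It serves both for the coordinates of a row and for the rows of the sample, hence the
  index-dependent \<open>\<phi>\<close>.\<close>

lemma nn_integral_PiM_pair_map:
  fixes M N M' N' :: "'i \<Rightarrow> 'a measure" and \<phi> :: "'i \<Rightarrow> 'a \<times> 'a \<Rightarrow> 'a \<times> 'a"
  assumes "finite I"
    and prob: "\<And>i. prob_space (M i)" "\<And>i. prob_space (N i)" "\<And>i. prob_space (M' i)" "\<And>i. prob_space (N' i)"
    and \<phi>: "\<And>i. \<phi> i \<in> M i \<Otimes>\<^sub>M N i \<rightarrow>\<^sub>M M' i \<Otimes>\<^sub>M N' i"
    and law: "\<And>i F. F \<in> borel_measurable (M' i \<Otimes>\<^sub>M N' i) \<Longrightarrow>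
      (\<integral>\<^sup>+x. \<integral>\<^sup>+y. F (\<phi> i (x, y)) \<partial>N i \<partial>M i) = (\<integral>\<^sup>+u. \<integral>\<^sup>+v. (F (u, v) :: ennreal) \<partial>N' i \<partial>M' i)"
    and F: "F \<in> borel_measurable (PiM I M' \<Otimes>\<^sub>M PiM I N')"
  shows "(\<integral>\<^sup>+x. \<integral>\<^sup>+y. F (\<lambda>i\<in>I. fst (\<phi> i (x i, y i)), \<lambda>i\<in>I. snd (\<phi> i (x i, y i))) \<partial>PiM I N \<partial>PiM I M) =
    (\<integral>\<^sup>+u. \<integral>\<^sup>+v. F (u, v) \<partial>PiM I N' \<partial>PiM I M')"
  using assms(1) F
proof (induction I arbitrary: F rule: finite_induct)
  case empty
  show ?case by (simp add: PiM_empty nn_integral_count_space_finite)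
next
  case (insert i I)
  note [measurable] = \<phi>
  interpret M: product_prob_space M by (intro product_prob_spaceI prob)
  interpret N: product_prob_space N by (intro product_prob_spaceI prob)
  interpret M': product_prob_space M' by (intro product_prob_spaceI prob)
  interpret N': product_prob_space N' by (intro product_prob_spaceI prob)
  note fin = insert.hyps(1) and notin = insert.hyps(2)
  note F[measurable] = insert.prems
  define U where "U x y = (\<lambda>i\<in>I. fst (\<phi> i (x i, y i)))" for x y
  define V where "V x y = (\<lambda>i\<in>I. snd (\<phi> i (x i, y i)))" for x y
  have PM: "prob_space (PiM I M)" "prob_space (PiM I N)" "prob_space (PiM I M')" "prob_space (PiM I N')"
    by (intro prob_space_PiM prob)+
  let ?G = "\<lambda>(x,y). F (\<lambda>i\<in>insert i I. fst (\<phi> i (x i, y i)), \<lambda>i\<in>insert i I. snd (\<phi> i (x i, y i)))"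
  have mfst: "(\<lambda>(x,y). \<lambda>i\<in>J. fst (\<phi> i (x i, y i))) \<in> PiM J M \<Otimes>\<^sub>M PiM J N \<rightarrow>\<^sub>M PiM J M'" for J
    by measurable
  have msnd: "(\<lambda>(x,y). \<lambda>i\<in>J. snd (\<phi> i (x i, y i))) \<in> PiM J M \<Otimes>\<^sub>M PiM J N \<rightarrow>\<^sub>M PiM J N'" for J
    by measurable
  have G[measurable]: "?G \<in> borel_measurable (PiM (insert i I) M \<Otimes>\<^sub>M PiM (insert i I) N)"
    using measurable_compose[OF measurable_Pair[OF mfst msnd] F] by (simp add: case_prod_unfold)
  have e: "(\<lambda>ia\<in>insert i I. fst (\<phi> ia ((x(i := a)) ia, (y(i := b)) ia))) = (U x y)(i := fst (\<phi> i (a, b)))"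
          "(\<lambda>ia\<in>insert i I. snd (\<phi> ia ((x(i := a)) ia, (y(i := b)) ia))) = (V x y)(i := snd (\<phi> i (a, b)))" for x y a b
    using notin by (auto simp: U_def V_def fun_eq_iff)
  have Gi[measurable]: "(\<lambda>x. \<integral>\<^sup>+y. ?G (x, y) \<partial>PiM (insert i I) N) \<in> borel_measurable (PiM (insert i I) M)"
    by (intro sigma_finite_measure.borel_measurable_nn_integral_fst[OF _ G] prob_space_imp_sigma_finite prob_space_PiM prob)
  have Gx[measurable]: "(\<lambda>y. ?G (x, y)) \<in> borel_measurable (PiM (insert i I) N)" if "x \<in> space (PiM (insert i I) M)" for x
    using measurable_compose[OF measurable_Pair1' G, OF that] by simp
  have "(\<integral>\<^sup>+x. \<integral>\<^sup>+y. ?G (x, y) \<partial>PiM (insert i I) N \<partial>PiM (insert i I) M) =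
     (\<integral>\<^sup>+x. \<integral>\<^sup>+a. \<integral>\<^sup>+y. ?G (x(i := a), y) \<partial>PiM (insert i I) N \<partial>M i \<partial>PiM I M)"
    by (rule M.product_nn_integral_insert[OF fin notin Gi])
  also have "\<dots> = (\<integral>\<^sup>+x. \<integral>\<^sup>+a. \<integral>\<^sup>+y. \<integral>\<^sup>+b. ?G (x(i := a), y(i := b)) \<partial>N i \<partial>PiM I N \<partial>M i \<partial>PiM I M)"
  proof (intro nn_integral_cong)
    fix x a assume "x \<in> space (PiM I M)" "a \<in> space (M i)"
    then have "x(i := a) \<in> space (PiM (insert i I) M)"
      by (auto simp: space_PiM PiE_def extensional_def)
    then show "(\<integral>\<^sup>+y. ?G (x(i := a), y) \<partial>PiM (insert i I) N) = (\<integral>\<^sup>+y. \<integral>\<^sup>+b. ?G (x(i := a), y(i := b)) \<partial>N i \<partial>PiM I N)"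
      by (intro N.product_nn_integral_insert[OF fin notin] Gx)
  qed
  also have "\<dots> = (\<integral>\<^sup>+x. \<integral>\<^sup>+a. \<integral>\<^sup>+y. \<integral>\<^sup>+b. F ((U x y)(i := fst (\<phi> i (a, b))), (V x y)(i := snd (\<phi> i (a, b)))) \<partial>N i \<partial>PiM I N \<partial>M i \<partial>PiM I M)"
    unfolding split_conv e ..
  \<comment> \<open>Fubini moves the two integrals over the new index \<open>i\<close> next to each
    other and innermost, where \<open>law\<close> applies.\<close>
  also have "\<dots> = (\<integral>\<^sup>+x. \<integral>\<^sup>+y. \<integral>\<^sup>+a. \<integral>\<^sup>+b. F ((U x y)(i := fst (\<phi> i (a, b))), (V x y)(i := snd (\<phi> i (a, b)))) \<partial>N i \<partial>M i \<partial>PiM I N \<partial>PiM I M)"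
  proof (intro nn_integral_cong)
    fix x assume x: "x \<in> space (PiM I M)"
    have m3: "(\<lambda>w. (x(i := snd (fst w)), (fst (fst w))(i := snd w))) \<in> (PiM I N \<Otimes>\<^sub>M M i) \<Otimes>\<^sub>M N i \<rightarrow>\<^sub>M PiM (insert i I) M \<Otimes>\<^sub>M PiM (insert i I) N"
      using x by measurable
    have "(\<lambda>w. F ((U x (fst (fst w)))(i := fst (\<phi> i (snd (fst w), snd w))), (V x (fst (fst w)))(i := snd (\<phi> i (snd (fst w), snd w))))) \<in> borel_measurable ((PiM I N \<Otimes>\<^sub>M M i) \<Otimes>\<^sub>M N i)"
      using measurable_compose[OF m3 G] unfolding split_conv e .
    then have "(\<lambda>(y,a). \<integral>\<^sup>+b. F ((U x y)(i := fst (\<phi> i (a, b))), (V x y)(i := snd (\<phi> i (a, b)))) \<partial>N i) \<in> borel_measurable (PiM I N \<Otimes>\<^sub>M M i)"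
      using sigma_finite_measure.borel_measurable_nn_integral_fst[OF prob_space_imp_sigma_finite[OF prob(2)]]
      by (force simp: case_prod_unfold)
    then show "(\<integral>\<^sup>+a. \<integral>\<^sup>+y. \<integral>\<^sup>+b. F ((U x y)(i := fst (\<phi> i (a, b))), (V x y)(i := snd (\<phi> i (a, b)))) \<partial>N i \<partial>PiM I N \<partial>M i) =
      (\<integral>\<^sup>+y. \<integral>\<^sup>+a. \<integral>\<^sup>+b. F ((U x y)(i := fst (\<phi> i (a, b))), (V x y)(i := snd (\<phi> i (a, b)))) \<partial>N i \<partial>M i \<partial>PiM I N)"
      by (intro pair_sigma_finite.Fubini' pair_sigma_finite.intro prob_space_imp_sigma_finite PM prob)
  qed
  also have "\<dots> = (\<integral>\<^sup>+x. \<integral>\<^sup>+y. \<integral>\<^sup>+u. \<integral>\<^sup>+v. F ((U x y)(i := u), (V x y)(i := v)) \<partial>N' i \<partial>M' i \<partial>PiM I N \<partial>PiM I M)"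
  proof (intro nn_integral_cong)
    fix x y assume xy: "x \<in> space (PiM I M)" "y \<in> space (PiM I N)"
    have "(x, y) \<in> space (PiM I M \<Otimes>\<^sub>M PiM I N)" using xy by (simp add: space_pair_measure)
    from measurable_space[OF mfst this] measurable_space[OF msnd this]
    have [measurable]: "U x y \<in> space (PiM I M')" "V x y \<in> space (PiM I N')" by (simp_all add: U_def V_def)
    have "(\<lambda>(u,v). F ((U x y)(i := u), (V x y)(i := v))) \<in> borel_measurable (M' i \<Otimes>\<^sub>M N' i)"
      by measurable
    from law[OF this] show "(\<integral>\<^sup>+a. \<integral>\<^sup>+b. F ((U x y)(i := fst (\<phi> i (a, b))), (V x y)(i := snd (\<phi> i (a, b)))) \<partial>N i \<partial>M i) =
       (\<integral>\<^sup>+u. \<integral>\<^sup>+v. F ((U x y)(i := u), (V x y)(i := v)) \<partial>N' i \<partial>M' i)"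
      by (simp add: case_prod_unfold)
  qed
  also have "\<dots> = (\<integral>\<^sup>+x. \<integral>\<^sup>+y. (\<lambda>(U,V). \<integral>\<^sup>+u. \<integral>\<^sup>+v. F (U(i := u), V(i := v)) \<partial>N' i \<partial>M' i) (\<lambda>i\<in>I. fst (\<phi> i (x i, y i)), \<lambda>i\<in>I. snd (\<phi> i (x i, y i))) \<partial>PiM I N \<partial>PiM I M)"
    by (simp add: U_def V_def)
  also have "\<dots> = (\<integral>\<^sup>+U. \<integral>\<^sup>+V. \<integral>\<^sup>+u. \<integral>\<^sup>+v. F (U(i := u), V(i := v)) \<partial>N' i \<partial>M' i \<partial>PiM I N' \<partial>PiM I M')"
  proof (subst insert.IH)
    show "(\<lambda>(U,V). \<integral>\<^sup>+u. \<integral>\<^sup>+v. F (U(i := u), V(i := v)) \<partial>N' i \<partial>M' i) \<in> borel_measurable (PiM I M' \<Otimes>\<^sub>M PiM I N')"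
      by measurable
  qed simp
  also have "\<dots> = (\<integral>\<^sup>+U. \<integral>\<^sup>+u. \<integral>\<^sup>+V. \<integral>\<^sup>+v. F (U(i := u), V(i := v)) \<partial>N' i \<partial>PiM I N' \<partial>M' i \<partial>PiM I M')"
  proof (intro nn_integral_cong)
    fix U assume [measurable]: "U \<in> space (PiM I M')"
    show "(\<integral>\<^sup>+V. \<integral>\<^sup>+u. \<integral>\<^sup>+v. F (U(i := u), V(i := v)) \<partial>N' i \<partial>M' i \<partial>PiM I N') =
      (\<integral>\<^sup>+u. \<integral>\<^sup>+V. \<integral>\<^sup>+v. F (U(i := u), V(i := v)) \<partial>N' i \<partial>PiM I N' \<partial>M' i)"
      by (intro pair_sigma_finite.Fubini' pair_sigma_finite.intro prob_space_imp_sigma_finite PM prob) measurable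
  qed
  also have "\<dots> = (\<integral>\<^sup>+U. \<integral>\<^sup>+u. \<integral>\<^sup>+V. F (U(i := u), V) \<partial>PiM (insert i I) N' \<partial>M' i \<partial>PiM I M')"
  proof (intro nn_integral_cong)
    fix U u assume [measurable]: "U \<in> space (PiM I M')" "u \<in> space (M' i)"
    show "(\<integral>\<^sup>+V. \<integral>\<^sup>+v. F (U(i := u), V(i := v)) \<partial>N' i \<partial>PiM I N') = (\<integral>\<^sup>+V. F (U(i := u), V) \<partial>PiM (insert i I) N')"
      by (rule N'.product_nn_integral_insert[OF fin notin, symmetric]) measurable
  qed
  also have "\<dots> = (\<integral>\<^sup>+u. \<integral>\<^sup>+v. F (u, v) \<partial>PiM (insert i I) N' \<partial>PiM (insert i I) M')"
  proof (rule M'.product_nn_integral_insert[OF fin notin, symmetric])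
    interpret P: sigma_finite_measure "PiM (insert i I) N'"
      by (intro prob_space_imp_sigma_finite prob_space_PiM prob)
    show "(\<lambda>u. \<integral>\<^sup>+v. F (u, v) \<partial>PiM (insert i I) N') \<in> borel_measurable (PiM (insert i I) M')"
      by measurable
  qed
  finally show ?case unfolding split_conv .
qed

section \<open>Chi-square tails\<close>

text \<open>Tilting a centred Gaussian by the exponential of a square gives a multiple of a Gaussian
  with variance \<open>s^2 / (1 - 2 \<theta>)\<close>, so the moment generating function is
  explicit; the range of \<open>\<theta>\<close> makes its logarithm quadratic.\<close>

lemma nn_integral_normal_exp_square:
  assumes s: "0 < s" and \<theta>: "\<bar>\<theta>\<bar> \<le> 1/4"
  shows "(\<integral>\<^sup>+x. ennreal (normal_density 0 s x) * ennreal (exp (\<theta> * (x\<^sup>2 / s\<^sup>2 - 1))) \<partial>lborel) \<le> ennreal (exp (4 * \<theta>\<^sup>2))"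
proof -
  define r where "r = 1 - 2 * \<theta>"
  have r: "0 < r" using \<theta> by (auto simp: r_def abs_le_iff)
  have eq: "normal_density 0 s x * exp (\<theta> * (x\<^sup>2 / s\<^sup>2 - 1)) = exp (- \<theta>) / sqrt r * normal_density 0 (s / sqrt r) x" for x
  proof -
    have "- x\<^sup>2 / (2 * s\<^sup>2) + \<theta> * (x\<^sup>2 / s\<^sup>2 - 1) = - \<theta> + (- x\<^sup>2 / (2 * (s / sqrt r)\<^sup>2))"
      using s r by (simp add: power_divide r_def field_simps)
    then have "exp (- x\<^sup>2 / (2 * s\<^sup>2)) * exp (\<theta> * (x\<^sup>2 / s\<^sup>2 - 1)) = exp (- \<theta>) * exp (- x\<^sup>2 / (2 * (s / sqrt r)\<^sup>2))"
      by (simp only: exp_add[symmetric])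
    then show ?thesis
      using s r unfolding normal_density_def
      by (simp add: real_sqrt_mult power_divide real_sqrt_divide)
  qed
  have "(\<integral>\<^sup>+x. ennreal (normal_density 0 s x) * ennreal (exp (\<theta> * (x\<^sup>2 / s\<^sup>2 - 1))) \<partial>lborel) =
     (\<integral>\<^sup>+x. ennreal (exp (- \<theta>) / sqrt r) * ennreal (normal_density 0 (s / sqrt r) x) \<partial>lborel)"
    using r by (simp add: ennreal_mult[symmetric] eq)
  also have "\<dots> = ennreal (exp (- \<theta>) / sqrt r) * (\<integral>\<^sup>+x. ennreal (normal_density 0 (s / sqrt r) x) \<partial>lborel)"
    by (rule nn_integral_cmult) simp
  also have "(\<integral>\<^sup>+x. ennreal (normal_density 0 (s / sqrt r) x) \<partial>lborel) = 1"
    using s r by (subst nn_integral_eq_integral) auto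
  also have "ennreal (exp (- \<theta>) / sqrt r) * 1 \<le> ennreal (exp (4 * \<theta>\<^sup>2))"
  proof -
    have "\<bar>ln (1 + (- 2 * \<theta>)) - (- 2 * \<theta>)\<bar> \<le> 2 * (- 2 * \<theta>)\<^sup>2"
      using \<theta> by (intro abs_ln_one_plus_x_minus_x_bound) (auto simp: abs_mult)
    then have "- \<theta> - ln r / 2 \<le> 4 * \<theta>\<^sup>2" by (simp add: r_def power_mult_distrib abs_le_iff)
    moreover have "exp (- \<theta>) / sqrt r = exp (- \<theta> - ln r / 2)"
      using r by (simp add: exp_diff exp_minus ln_sqrt[symmetric])
    ultimately show ?thesis by simp
  qed
  finally show ?thesis .
qed

text \<open>Chernoff bound in Bernstein form. Two parameters are kept because \<open>u\<close> will
  be a support size, to which the entropy in a union bound is proportional, and \<open>t\<close> the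
  logarithmic factor that beats this entropy.\<close>

lemma (in prob_space) chi_square_tail:
  fixes s t u :: real
  assumes A: "finite A" and ind: "indep_vars (\<lambda>_. borel) Z A" and s: "0 < s"
    and dist: "\<And>a. a \<in> A \<Longrightarrow> distributed M lborel (Z a) (normal_density 0 s)"
    and u: "0 < u" and t: "0 \<le> t"
  shows "prob {\<omega>\<in>space M. t * (sqrt (card A * u) + u) * s\<^sup>2 \<le> \<bar>(\<Sum>a\<in>A. (Z a \<omega>)\<^sup>2) - card A * s\<^sup>2\<bar>} \<le> 2 * exp (- ((2 * t - 1) * u / 16))"
proof -
  have Zm[measurable]: "Z a \<in> borel_measurable M" if "a \<in> A" for a
    using ind that by (auto simp: indep_vars_def)
  define k where "k = real (card A)"
  \<comment> \<open>The tilt is of the optimal order \<open>sqrt (u / k)\<close>, capped so that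
    \<open>mgf\<close> applies. For \<open>k = 0\<close> the quotient would be 0 and
    \<open>h1\<close> would fail, hence the separate value.\<close>
  define h where "h = (if k = 0 then 1 else min 1 (sqrt (u / k))) / 8"
  have k: "0 \<le> k" by (simp add: k_def)
  have h: "0 \<le> h" "h \<le> 1/8" using u k by (auto simp: h_def)
  have h1: "u / 8 \<le> h * (sqrt (k * u) + u)"
  proof (cases "h = 1/8")
    case True show ?thesis unfolding True using u k by simp
  next
    case False
    then have "h = sqrt (u / k) / 8" "k \<noteq> 0" by (auto simp: h_def min_def split: if_splits)
    then have "h * sqrt (k * u) = u / 8" using u k
      by (simp add: real_sqrt_mult real_sqrt_divide)
    then show ?thesis using u h by (simp add: algebra_simps)
  qed
  have h2: "4 * k * h\<^sup>2 \<le> u / 16"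
  proof -
    have "h\<^sup>2 \<le> u / k / 64" if "k \<noteq> 0"
    proof -
      have "h \<le> sqrt (u / k) / 8" using that by (simp add: h_def)
      then have "h\<^sup>2 \<le> (sqrt (u / k) / 8)\<^sup>2" using h by (intro power_mono) auto
      then show ?thesis using u k by (simp add: power_divide)
    qed
    then show ?thesis using u k by (cases "k = 0") (auto simp: field_simps)
  qed
  have mgf: "(\<integral>\<^sup>+\<omega>. ennreal (exp (\<theta> * ((\<Sum>a\<in>A. (Z a \<omega>)\<^sup>2) / s\<^sup>2 - k))) \<partial>M) \<le> ennreal (exp (4 * k * \<theta>\<^sup>2))" if \<theta>: "\<bar>\<theta>\<bar> \<le> 1/4" for \<theta>
  proof -
    have "exp (\<theta> * ((\<Sum>a\<in>A. (Z a \<omega>)\<^sup>2) / s\<^sup>2 - k)) = (\<Prod>a\<in>A. exp (\<theta> * ((Z a \<omega>)\<^sup>2 / s\<^sup>2 - 1)))" for \<omega>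
      by (simp add: k_def exp_sum[OF A, symmetric] sum_distrib_left[symmetric] sum_subtractf sum_divide_distrib[symmetric])
    then have "(\<integral>\<^sup>+\<omega>. ennreal (exp (\<theta> * ((\<Sum>a\<in>A. (Z a \<omega>)\<^sup>2) / s\<^sup>2 - k))) \<partial>M) =
       (\<integral>\<^sup>+\<omega>. (\<Prod>a\<in>A. ennreal (exp (\<theta> * ((Z a \<omega>)\<^sup>2 / s\<^sup>2 - 1)))) \<partial>M)"
      by (simp add: prod_ennreal)
    also have "\<dots> = (\<Prod>a\<in>A. \<integral>\<^sup>+\<omega>. ennreal (exp (\<theta> * ((Z a \<omega>)\<^sup>2 / s\<^sup>2 - 1))) \<partial>M)"
      by (intro indep_vars_nn_integral A indep_vars_compose2[OF ind]) auto
    also have "\<dots> \<le> (\<Prod>a\<in>A. ennreal (exp (4 * \<theta>\<^sup>2)))"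
    proof (rule prod_mono_ennreal)
      fix a assume a: "a \<in> A"
      have "(\<integral>\<^sup>+\<omega>. ennreal (exp (\<theta> * ((Z a \<omega>)\<^sup>2 / s\<^sup>2 - 1))) \<partial>M) = (\<integral>\<^sup>+x. ennreal (normal_density 0 s x) * ennreal (exp (\<theta> * (x\<^sup>2 / s\<^sup>2 - 1))) \<partial>lborel)"
        by (subst distributed_nn_integral[OF dist[OF a], symmetric]) auto
      also have "\<dots> \<le> ennreal (exp (4 * \<theta>\<^sup>2))" by (rule nn_integral_normal_exp_square[OF s \<theta>])
      finally show "(\<integral>\<^sup>+\<omega>. ennreal (exp (\<theta> * ((Z a \<omega>)\<^sup>2 / s\<^sup>2 - 1))) \<partial>M) \<le> ennreal (exp (4 * \<theta>\<^sup>2))" .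
    qed
    also have "\<dots> = ennreal (exp (4 * k * \<theta>\<^sup>2))"
      by (simp add: ennreal_power exp_of_nat_mult[symmetric] k_def algebra_simps)
    finally show ?thesis .
  qed
  define T where "T = t * (sqrt (k * u) + u)"
  have T: "t * (u/8) \<le> h * T"
    using mult_left_mono[OF h1 t] by (simp add: T_def algebra_simps)
  have tail: "prob {\<omega>\<in>space M. T \<le> \<sigma> * ((\<Sum>a\<in>A. (Z a \<omega>)\<^sup>2) / s\<^sup>2 - k)} \<le> exp (- ((2 * t - 1) * u / 16))" if \<sigma>: "\<sigma> = 1 \<or> \<sigma> = -1" for \<sigma> :: real
  proof -
    have ab: "\<bar>h * \<sigma>\<bar> \<le> 1/4" using h \<sigma> by auto
    let ?f = "\<lambda>\<omega>. ennreal (exp ((h * \<sigma>) * ((\<Sum>a\<in>A. (Z a \<omega>)\<^sup>2) / s\<^sup>2 - k)))"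
    have "{\<omega>\<in>space M. T \<le> \<sigma> * ((\<Sum>a\<in>A. (Z a \<omega>)\<^sup>2) / s\<^sup>2 - k)} \<subseteq> {\<omega>\<in>space M. 1 \<le> ennreal (exp (- (h * T))) * ?f \<omega>}"
    proof safe
      fix \<omega> assume "T \<le> \<sigma> * ((\<Sum>a\<in>A. (Z a \<omega>)\<^sup>2) / s\<^sup>2 - k)"
      from mult_left_mono[OF this h(1)]
      have "1 \<le> exp (- (h * T) + (h * \<sigma>) * ((\<Sum>a\<in>A. (Z a \<omega>)\<^sup>2) / s\<^sup>2 - k))" by (simp add: mult.assoc)
      then show "1 \<le> ennreal (exp (- (h * T))) * ?f \<omega>"
        unfolding exp_add by (simp add: ennreal_mult[symmetric])
    qed
    then have "emeasure M {\<omega>\<in>space M. T \<le> \<sigma> * ((\<Sum>a\<in>A. (Z a \<omega>)\<^sup>2) / s\<^sup>2 - k)} \<le> emeasure M {\<omega>\<in>space M. 1 \<le> ennreal (exp (- (h * T))) * ?f \<omega>}"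
      by (intro emeasure_mono) auto
    also have "\<dots> \<le> ennreal (exp (- (h * T))) * (\<integral>\<^sup>+\<omega>. ?f \<omega> * indicator (space M) \<omega> \<partial>M)"
      by (intro nn_integral_Markov_inequality) auto
    also have "(\<integral>\<^sup>+\<omega>. ?f \<omega> * indicator (space M) \<omega> \<partial>M) = (\<integral>\<^sup>+\<omega>. ?f \<omega> \<partial>M)"
      by (intro nn_integral_cong) auto
    also have "ennreal (exp (- (h * T))) * \<dots> \<le> ennreal (exp (- (h * T))) * ennreal (exp (4 * k * (h * \<sigma>)\<^sup>2))"
      by (intro mult_left_mono mgf ab) auto
    also have "\<dots> = ennreal (exp (- (h * T) + 4 * k * h\<^sup>2))"
      using \<sigma> by (auto simp: ennreal_mult[symmetric] exp_add[symmetric] power_mult_distrib)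
    also have "\<dots> \<le> ennreal (exp (- ((2 * t - 1) * u / 16)))"
      using T h2 by (intro ennreal_leI) (simp add: field_simps)
    finally show ?thesis by (simp add: emeasure_eq_measure)
  qed
  have "{\<omega>\<in>space M. t * (sqrt (card A * u) + u) * s\<^sup>2 \<le> \<bar>(\<Sum>a\<in>A. (Z a \<omega>)\<^sup>2) - card A * s\<^sup>2\<bar>} \<subseteq>
     {\<omega>\<in>space M. T \<le> 1 * ((\<Sum>a\<in>A. (Z a \<omega>)\<^sup>2) / s\<^sup>2 - k)} \<union> {\<omega>\<in>space M. T \<le> (-1) * ((\<Sum>a\<in>A. (Z a \<omega>)\<^sup>2) / s\<^sup>2 - k)}"
  proof
    fix \<omega> assume "\<omega> \<in> {\<omega>\<in>space M. t * (sqrt (card A * u) + u) * s\<^sup>2 \<le> \<bar>(\<Sum>a\<in>A. (Z a \<omega>)\<^sup>2) - card A * s\<^sup>2\<bar>}"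
    then have "\<omega> \<in> space M" "T * s\<^sup>2 \<le> \<bar>(\<Sum>a\<in>A. (Z a \<omega>)\<^sup>2) - k * s\<^sup>2\<bar>" by (auto simp: T_def k_def)
    moreover have "(\<Sum>a\<in>A. (Z a \<omega>)\<^sup>2) - k * s\<^sup>2 = ((\<Sum>a\<in>A. (Z a \<omega>)\<^sup>2) / s\<^sup>2 - k) * s\<^sup>2" using s by (simp add: field_simps)
    ultimately have "T \<le> \<bar>(\<Sum>a\<in>A. (Z a \<omega>)\<^sup>2) / s\<^sup>2 - k\<bar>" using s by (simp add: abs_mult)
    with \<open>\<omega> \<in> space M\<close> show "\<omega> \<in> {\<omega>\<in>space M. T \<le> 1 * ((\<Sum>a\<in>A. (Z a \<omega>)\<^sup>2) / s\<^sup>2 - k)} \<union> {\<omega>\<in>space M. T \<le> (-1) * ((\<Sum>a\<in>A. (Z a \<omega>)\<^sup>2) / s\<^sup>2 - k)}"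
      by (auto simp: abs_le_iff)
  qed
  then have "prob {\<omega>\<in>space M. t * (sqrt (card A * u) + u) * s\<^sup>2 \<le> \<bar>(\<Sum>a\<in>A. (Z a \<omega>)\<^sup>2) - card A * s\<^sup>2\<bar>} \<le>
     prob ({\<omega>\<in>space M. T \<le> 1 * ((\<Sum>a\<in>A. (Z a \<omega>)\<^sup>2) / s\<^sup>2 - k)} \<union> {\<omega>\<in>space M. T \<le> (-1) * ((\<Sum>a\<in>A. (Z a \<omega>)\<^sup>2) / s\<^sup>2 - k)})"
    by (intro finite_measure_mono) auto
  also have "\<dots> \<le> prob {\<omega>\<in>space M. T \<le> 1 * ((\<Sum>a\<in>A. (Z a \<omega>)\<^sup>2) / s\<^sup>2 - k)} + prob {\<omega>\<in>space M. T \<le> (-1) * ((\<Sum>a\<in>A. (Z a \<omega>)\<^sup>2) / s\<^sup>2 - k)}"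
    by (intro measure_Un_le) auto
  also have "\<dots> \<le> 2 * exp (- ((2 * t - 1) * u / 16))" using tail[of 1] tail[of "-1"] by simp
  finally show ?thesis .
qed

section \<open>Gaussian fields\<close>

definition gauss_field :: "nat set \<Rightarrow> nat \<Rightarrow> (nat \<Rightarrow> nat \<Rightarrow> real) \<Rightarrow> (nat \<Rightarrow> real) \<Rightarrow> (nat \<Rightarrow> nat \<Rightarrow> real) measure" where
  "gauss_field I d \<nu> \<sigma> = PiM I (\<lambda>i. PiM {..<d} (\<lambda>j. normal_measure (\<nu> i j) (\<sigma> i)))"

lemma sets_gauss_field: "sets (gauss_field I d \<nu> \<sigma>) = sets (PiM I (\<lambda>_. vec_space d))"
  unfolding gauss_field_def vec_space_def by (intro sets_PiM_cong refl) simp_all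

lemma measurable_vec_component:
  assumes "i \<in> I" "j < d" "f \<in> N \<rightarrow>\<^sub>M PiM I (\<lambda>_. vec_space d)"
  shows "(\<lambda>x. f x i j) \<in> borel_measurable N"
proof -
  have "(\<lambda>x. f x i) \<in> N \<rightarrow>\<^sub>M vec_space d"
    using measurable_compose[OF assms(3) measurable_component_singleton[OF assms(1)]] .
  then have "(\<lambda>x. f x i) \<in> N \<rightarrow>\<^sub>M PiM {..<d} (\<lambda>_. borel)" by (simp add: vec_space_def)
  from measurable_compose[OF this measurable_component_singleton[of j]] assms(2)
  show ?thesis by simp
qed

lemma measurable_field_component[measurable]:
  assumes "i \<in> I" "j < d"
  shows "(\<lambda>x. x i j) \<in> borel_measurable (gauss_field I d \<nu> \<sigma>)"
  by (rule measurable_vec_component[OF assms]) (simp add: measurable_ident_sets sets_gauss_field)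

locale field_sd =
  fixes \<sigma> :: "nat \<Rightarrow> real"
  assumes \<sigma>: "\<And>i. 0 < \<sigma> i"
begin

lemma prob_normal: "prob_space (normal_measure m (\<sigma> i))"
  using \<sigma> by (rule prob_space_normal_density)

lemma prob_row: "prob_space (PiM {..<d} (\<lambda>j. normal_measure (\<nu> i j) (\<sigma> i)))"
  by (intro prob_space_PiM prob_normal)

lemma prob_field: "prob_space (gauss_field I d \<nu> \<sigma>)"
  unfolding gauss_field_def by (intro prob_space_PiM prob_row)

text \<open>A product of products is a product over index pairs, since both agree on boxes.
  Independence of all scalar coordinates follows from this.\<close>

lemma distr_field_coordinates:
  assumes I: "finite I"
  shows "distr (gauss_field I d \<nu> \<sigma>) (PiM (I \<times> {..<d}) (\<lambda>_. borel)) (\<lambda>\<omega>. \<lambda>t\<in>I \<times> {..<d}. \<omega> (fst t) (snd t)) =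
     PiM (I \<times> {..<d}) (\<lambda>t. normal_measure (\<nu> (fst t) (snd t)) (\<sigma> (fst t)))" (is "?D = ?P")
proof -
  interpret F: product_prob_space "\<lambda>t. normal_measure (\<nu> (fst t) (snd t)) (\<sigma> (fst t))" "I \<times> {..<d}"
    by (intro product_prob_spaceI prob_normal)
  interpret R: product_prob_space "\<lambda>i. PiM {..<d} (\<lambda>j. normal_measure (\<nu> i j) (\<sigma> i))"
    by (intro product_prob_spaceI prob_row)
  have m: "(\<lambda>\<omega>. \<lambda>t\<in>I \<times> {..<d}. \<omega> (fst t) (snd t)) \<in> gauss_field I d \<nu> \<sigma> \<rightarrow>\<^sub>M PiM (I \<times> {..<d}) (\<lambda>_. borel)"
    by (rule measurable_restrict) auto
  show ?thesis
  proof (rule F.PiM_eqI)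
    show "finite (I \<times> {..<d})" using I by simp
    show "sets ?D = sets ?P" by (simp, intro sets_PiM_cong) auto
    fix A :: "nat \<times> nat \<Rightarrow> real set"
    assume A: "\<And>t. t \<in> I \<times> {..<d} \<Longrightarrow> A t \<in> sets (normal_measure (\<nu> (fst t) (snd t)) (\<sigma> (fst t)))"
    have pre: "(\<lambda>\<omega>. \<lambda>t\<in>I \<times> {..<d}. \<omega> (fst t) (snd t)) -` (Pi\<^sub>E (I \<times> {..<d}) A) \<inter> space (gauss_field I d \<nu> \<sigma>) =
       Pi\<^sub>E I (\<lambda>i. Pi\<^sub>E {..<d} (\<lambda>j. A (i, j)))"
      by (auto simp: gauss_field_def space_PiM PiE_iff extensional_def fun_eq_iff)
    have bx: "Pi\<^sub>E {..<d} (\<lambda>j. A (i, j)) \<in> sets (PiM {..<d} (\<lambda>j. normal_measure (\<nu> i j) (\<sigma> i)))" if "i \<in> I" for i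
      using that A by (intro sets_PiM_I_finite) auto
    have row: "emeasure (PiM {..<d} (\<lambda>j. normal_measure (\<nu> i j) (\<sigma> i))) (Pi\<^sub>E {..<d} (\<lambda>j. A (i, j))) =
        (\<Prod>j<d. emeasure (normal_measure (\<nu> i j) (\<sigma> i)) (A (i, j)))" if "i \<in> I" for i
    proof -
      interpret S: product_prob_space "\<lambda>j. normal_measure (\<nu> i j) (\<sigma> i)"
        by (intro product_prob_spaceI prob_normal)
      show ?thesis using that A by (intro S.emeasure_PiM) auto
    qed
    have "emeasure ?D (Pi\<^sub>E (I \<times> {..<d}) A) = emeasure (gauss_field I d \<nu> \<sigma>) (Pi\<^sub>E I (\<lambda>i. Pi\<^sub>E {..<d} (\<lambda>j. A (i, j))))"
      unfolding pre[symmetric] using A I by (intro emeasure_distr m sets_PiM_I_finite) auto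
    also have "\<dots> = (\<Prod>i\<in>I. \<Prod>j<d. emeasure (normal_measure (\<nu> i j) (\<sigma> i)) (A (i, j)))"
      unfolding gauss_field_def using bx I by (simp add: R.emeasure_PiM row)
    also have "\<dots> = (\<Prod>t\<in>I \<times> {..<d}. emeasure (normal_measure (\<nu> (fst t) (snd t)) (\<sigma> (fst t))) (A t))"
      by (simp add: prod.cartesian_product case_prod_unfold)
    finally show "emeasure ?D (Pi\<^sub>E (I \<times> {..<d}) A) = \<dots>" .
  qed
qed

lemma distr_field_coordinate:
  assumes I: "finite I" and t: "t \<in> I \<times> {..<d}"
  shows "distr (gauss_field I d \<nu> \<sigma>) borel (\<lambda>\<omega>. \<omega> (fst t) (snd t)) = normal_measure (\<nu> (fst t) (snd t)) (\<sigma> (fst t))"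
proof -
  let ?M = "\<lambda>t. normal_measure (\<nu> (fst t) (snd t)) (\<sigma> (fst t))"
  interpret F: product_prob_space ?M "I \<times> {..<d}"
    by (intro product_prob_spaceI prob_normal)
  have m: "(\<lambda>\<omega>. \<lambda>t\<in>I \<times> {..<d}. \<omega> (fst t) (snd t)) \<in> gauss_field I d \<nu> \<sigma> \<rightarrow>\<^sub>M PiM (I \<times> {..<d}) (\<lambda>_. borel)"
    by (rule measurable_restrict) auto
  have "distr (gauss_field I d \<nu> \<sigma>) borel (\<lambda>\<omega>. \<omega> (fst t) (snd t)) =
    distr (distr (gauss_field I d \<nu> \<sigma>) (PiM (I \<times> {..<d}) (\<lambda>_. borel)) (\<lambda>\<omega>. \<lambda>t\<in>I \<times> {..<d}. \<omega> (fst t) (snd t))) borel (\<lambda>x. x t)"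
    using t m by (subst distr_distr) (auto simp: comp_def)
  also have "\<dots> = distr (PiM (I \<times> {..<d}) ?M) (?M t) (\<lambda>x. x t)"
    unfolding distr_field_coordinates[OF I] by (rule distr_cong) auto
  also have "\<dots> = ?M t" using t I by (intro F.PiM_component[OF t] )
  finally show ?thesis .
qed

lemma indep_field_coordinates:
  assumes I: "finite I"
  shows "prob_space.indep_vars (gauss_field I d \<nu> \<sigma>) (\<lambda>_. borel) (\<lambda>t \<omega>. \<omega> (fst t) (snd t)) (I \<times> {..<d})"
proof -
  interpret prob_space "gauss_field I d \<nu> \<sigma>" by (rule prob_field)
  show ?thesis
  proof (cases "I \<times> {..<d} = {}")
    case True
    have "indep_vars (\<lambda>_. borel) (\<lambda>t \<omega>. \<omega> (fst t) (snd t) :: real) {}" unfolding indep_vars_def indep_sets_def by blast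
    then show ?thesis by (simp only: True)
  next
    case False
    have rv: "random_variable borel (\<lambda>\<omega>. \<omega> (fst t) (snd t))" if "t \<in> I \<times> {..<d}" for t
      using that by (intro measurable_field_component) auto
    have "distr (gauss_field I d \<nu> \<sigma>) (PiM (I \<times> {..<d}) (\<lambda>_. borel)) (\<lambda>\<omega>. \<lambda>t\<in>I \<times> {..<d}. \<omega> (fst t) (snd t)) =
       PiM (I \<times> {..<d}) (\<lambda>t. distr (gauss_field I d \<nu> \<sigma>) borel (\<lambda>\<omega>. \<omega> (fst t) (snd t)))"
      unfolding distr_field_coordinates[OF I]
      by (rule PiM_cong[OF refl], rule distr_field_coordinate[OF I, symmetric])
    then show ?thesis by (subst indep_vars_iff_distr_eq_PiM'[OF False rv]) auto
  qed
qed

lemma distributed_field_coordinate: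
  assumes I: "finite I" and t: "t \<in> I \<times> {..<d}"
  shows "distributed (gauss_field I d \<nu> \<sigma>) lborel (\<lambda>\<omega>. \<omega> (fst t) (snd t)) (normal_density (\<nu> (fst t) (snd t)) (\<sigma> (fst t)))"
  unfolding distributed_def using distr_field_coordinate[OF I t, of \<nu>] t
  by (auto cong: distr_cong)

text \<open>Centred linear forms. The coordinate set \<open>T\<close> is explicit because forms over
  disjoint sets are independent.\<close>

definition lin :: "(nat \<times> nat) set \<Rightarrow> (nat \<Rightarrow> nat \<Rightarrow> real) \<Rightarrow> (nat \<times> nat \<Rightarrow> real) \<Rightarrow> (nat \<Rightarrow> nat \<Rightarrow> real) \<Rightarrow> real" where
  "lin T \<nu> c \<omega> = (\<Sum>t\<in>T. c t * (\<omega> (fst t) (snd t) - \<nu> (fst t) (snd t)))"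

definition linvar :: "(nat \<times> nat) set \<Rightarrow> (nat \<times> nat \<Rightarrow> real) \<Rightarrow> real" where
  "linvar T c = (\<Sum>t\<in>T. (c t)\<^sup>2 * (\<sigma> (fst t))\<^sup>2)"

lemma distributed_lin:
  assumes I: "finite I" and T: "T \<subseteq> I \<times> {..<d}" and v: "0 < linvar T c"
  shows "distributed (gauss_field I d \<nu> \<sigma>) lborel (lin T \<nu> c) (normal_density 0 (sqrt (linvar T c)))"
proof -
  interpret prob_space "gauss_field I d \<nu> \<sigma>" by (rule prob_field)
  have finT: "finite T" using I T by (meson finite_SigmaI finite_lessThan finite_subset)
  \<comment> \<open>The sum of independent normals requires positive deviations, so zero
    coefficients are dropped; \<open>v\<close> guarantees that some coordinate remains.\<close>
  define T' where "T' = {t\<in>T. c t \<noteq> 0}"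
  have T': "T' \<subseteq> I \<times> {..<d}" "finite T'" using T finT by (auto simp: T'_def)
  have ne: "T' \<noteq> {}"
  proof
    assume "T' = {}"
    then have "linvar T c = 0" unfolding linvar_def T'_def by (intro sum.neutral) auto
    with v show False by simp
  qed
  have lin': "lin T \<nu> c \<omega> = (\<Sum>t\<in>T'. - c t * \<nu> (fst t) (snd t) + c t * \<omega> (fst t) (snd t))" for \<omega>
    unfolding lin_def T'_def by (rule sum.mono_neutral_cong_right[OF finT]) (auto simp: algebra_simps)
  have var': "linvar T c = (\<Sum>t\<in>T'. (\<bar>c t\<bar> * \<sigma> (fst t))\<^sup>2)"
    unfolding linvar_def T'_def by (rule sum.mono_neutral_cong_right[OF finT]) (auto simp: power_mult_distrib)
  have ind: "indep_vars (\<lambda>_. borel) (\<lambda>t \<omega>. - c t * \<nu> (fst t) (snd t) + c t * \<omega> (fst t) (snd t)) T'"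
    by (rule indep_vars_compose2[OF indep_vars_subset[OF indep_field_coordinates[OF I] T'(1)], where Y="\<lambda>t x. - c t * \<nu> (fst t) (snd t) + c t * x"]) simp
  have "distributed (gauss_field I d \<nu> \<sigma>) lborel (\<lambda>\<omega>. \<Sum>t\<in>T'. - c t * \<nu> (fst t) (snd t) + c t * \<omega> (fst t) (snd t))
    (normal_density (\<Sum>t\<in>T'. - c t * \<nu> (fst t) (snd t) + c t * \<nu> (fst t) (snd t)) (sqrt (\<Sum>t\<in>T'. (\<bar>c t\<bar> * \<sigma> (fst t))\<^sup>2)))"
  proof (rule sum_indep_normal[OF T'(2) ne ind])
    fix t assume t: "t \<in> T'"
    then show "0 < \<bar>c t\<bar> * \<sigma> (fst t)" using \<sigma> by (auto simp: T'_def)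
    show "distributed (gauss_field I d \<nu> \<sigma>) lborel (\<lambda>\<omega>. - c t * \<nu> (fst t) (snd t) + c t * \<omega> (fst t) (snd t))
       (normal_density (- c t * \<nu> (fst t) (snd t) + c t * \<nu> (fst t) (snd t)) (\<bar>c t\<bar> * \<sigma> (fst t)))"
      using t T' \<sigma> by (intro normal_density_affine distributed_field_coordinate[OF I]) (auto simp: T'_def)
  qed
  then show ?thesis by (simp add: lin'[abs_def] var')
qed

lemma measurable_lin:
  assumes T: "T \<subseteq> I \<times> {..<d}"
  shows "lin T \<nu> c \<in> borel_measurable (gauss_field I d \<nu>' \<sigma>)"
  unfolding lin_def[abs_def] using T by (intro borel_measurable_sum borel_measurable_times borel_measurable_diff measurable_field_component) auto

lemma indep_lin:
  assumes I: "finite I" and K: "\<And>r. r \<in> R \<Longrightarrow> K r \<subseteq> I \<times> {..<d}" and disj: "disjoint_family_on K R"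
  shows "prob_space.indep_vars (gauss_field I d \<nu> \<sigma>) (\<lambda>_. borel) (\<lambda>r. lin (K r) \<nu> (c r)) R"
proof -
  interpret prob_space "gauss_field I d \<nu> \<sigma>" by (rule prob_field)
  have "indep_vars (\<lambda>r. PiM (K r) (\<lambda>_. borel)) (\<lambda>r \<omega>. restrict (\<lambda>t. \<omega> (fst t) (snd t)) (K r)) R"
    by (rule indep_vars_restrict[OF indep_field_coordinates[OF I] K disj])
  then have "indep_vars (\<lambda>_. borel) (\<lambda>r \<omega>. (\<lambda>y. \<Sum>t\<in>K r. c r t * (y t - \<nu> (fst t) (snd t))) (restrict (\<lambda>t. \<omega> (fst t) (snd t)) (K r))) R"
    by (rule indep_vars_compose2) measurable
  then show ?thesis unfolding lin_def by (simp cong: sum.cong)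
qed

lemma nn_integral_lin_square:
  assumes I: "finite I" and T: "T \<subseteq> I \<times> {..<d}"
  shows "(\<integral>\<^sup>+\<omega>. ennreal ((lin T \<nu> c \<omega>)\<^sup>2) \<partial>gauss_field I d \<nu> \<sigma>) = ennreal (linvar T c)"
proof -
  have finT: "finite T" using I T by (meson finite_SigmaI finite_lessThan finite_subset)
  have "0 \<le> linvar T c" unfolding linvar_def by (intro sum_nonneg) auto
  then consider "linvar T c = 0" | "0 < linvar T c" by linarith
  then show ?thesis
  proof cases
    case 1
    then have "c t = 0" if "t \<in> T" for t
      using that \<sigma>[of "fst t"] finT unfolding linvar_def by (subst (asm) sum_nonneg_eq_0_iff) auto
    then have "lin T \<nu> c \<omega> = 0" for \<omega> by (simp add: lin_def)
    then show ?thesis by (simp add: 1)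
  next
    case 2
    define s where "s = sqrt (linvar T c)"
    have s: "0 < s" "s\<^sup>2 = linvar T c" using 2 by (auto simp: s_def)
    have "(\<integral>\<^sup>+\<omega>. ennreal ((lin T \<nu> c \<omega>)\<^sup>2) \<partial>gauss_field I d \<nu> \<sigma>) = (\<integral>\<^sup>+x. ennreal (normal_density 0 s x) * ennreal (x\<^sup>2) \<partial>lborel)"
      by (rule distributed_nn_integral[OF distributed_lin[OF I T 2, folded s_def], symmetric]) simp
    also have "\<dots> = (\<integral>\<^sup>+x. ennreal (normal_density 0 s x * (x - 0) ^ (2 * 1)) \<partial>lborel)"
      by (simp add: ennreal_mult)
    also have "\<dots> = ennreal (s\<^sup>2)"
      using normal_moment_even[OF s(1), of 0 1]
      by (subst nn_integral_eq_integral) (auto simp: has_bochner_integral_iff numeral_eq_Suc[symmetric] fact_numeral)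
    finally show ?thesis by (simp add: s)
  qed
qed

text \<open>Markov's inequality for the sum of second moments, so the forms may share
  coordinates.\<close>

lemma sum_lin_square_tail:
  assumes I: "finite I" and K: "\<And>r. r \<in> R \<Longrightarrow> K r \<subseteq> I \<times> {..<d}" and R: "finite R"
    and l: "0 < l" and v: "(\<Sum>r\<in>R. linvar (K r) (c r)) \<le> v" "0 \<le> v"
  shows "measure (gauss_field I d \<nu> \<sigma>) {\<omega>\<in>space (gauss_field I d \<nu> \<sigma>). l * v < (\<Sum>r\<in>R. (lin (K r) \<nu> (c r) \<omega>)\<^sup>2)} \<le> 1 / l"
proof -
  interpret prob_space "gauss_field I d \<nu> \<sigma>" by (rule prob_field)
  let ?X = "\<lambda>\<omega>. \<Sum>r\<in>R. (lin (K r) \<nu> (c r) \<omega>)\<^sup>2"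
  have [measurable]: "lin (K r) \<nu> (c r) \<in> borel_measurable (gauss_field I d \<nu> \<sigma>)" if "r \<in> R" for r
    by (rule measurable_lin[OF K[OF that]])
  have [measurable]: "?X \<in> borel_measurable (gauss_field I d \<nu> \<sigma>)" by measurable
  have v0: "linvar (K r) (c r) \<ge> 0" for r unfolding linvar_def by (intro sum_nonneg) auto
  have E: "(\<integral>\<^sup>+\<omega>. ennreal (?X \<omega>) \<partial>gauss_field I d \<nu> \<sigma>) \<le> ennreal v"
  proof -
    have "(\<integral>\<^sup>+\<omega>. ennreal (?X \<omega>) \<partial>gauss_field I d \<nu> \<sigma>) = (\<Sum>r\<in>R. \<integral>\<^sup>+\<omega>. ennreal ((lin (K r) \<nu> (c r) \<omega>)\<^sup>2) \<partial>gauss_field I d \<nu> \<sigma>)"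
      by (subst nn_integral_sum[symmetric]) (auto simp: sum_ennreal)
    also have "\<dots> = ennreal (\<Sum>r\<in>R. linvar (K r) (c r))"
      using v0 by (simp add: nn_integral_lin_square[OF I K] sum_ennreal)
    finally show ?thesis using v by (simp add: ennreal_leI)
  qed
  show ?thesis
  proof (cases "v = 0")
    \<comment> \<open>The factor \<open>1 / (l * v)\<close> degenerates here; instead, a nonnegative
      variable with expectation zero vanishes almost everywhere.\<close>
    case True
    then have "(\<integral>\<^sup>+\<omega>. ennreal (?X \<omega>) \<partial>gauss_field I d \<nu> \<sigma>) = 0" using E by simp
    then have "AE \<omega> in gauss_field I d \<nu> \<sigma>. ennreal (?X \<omega>) = 0" by (subst (asm) nn_integral_0_iff_AE) auto
    then have "AE \<omega> in gauss_field I d \<nu> \<sigma>. \<not> l * v < ?X \<omega>" by eventually_elim (auto simp: True ennreal_eq_0_iff)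
    then have "prob {\<omega>\<in>space (gauss_field I d \<nu> \<sigma>). l * v < ?X \<omega>} = 0"
      by (subst prob_eq_0) auto
    then show ?thesis using l by simp
  next
    case False
    then have v: "0 < v" using v by simp
    have "emeasure (gauss_field I d \<nu> \<sigma>) {\<omega>\<in>space (gauss_field I d \<nu> \<sigma>). l * v < ?X \<omega>} \<le>
      emeasure (gauss_field I d \<nu> \<sigma>) {\<omega>\<in>space (gauss_field I d \<nu> \<sigma>). 1 \<le> ennreal (1 / (l * v)) * ennreal (?X \<omega>)}"
      using l v by (intro emeasure_mono) (auto simp: ennreal_mult[symmetric] sum_nonneg field_simps)
    also have "\<dots> \<le> ennreal (1 / (l * v)) * (\<integral>\<^sup>+\<omega>. ennreal (?X \<omega>) * indicator (space (gauss_field I d \<nu> \<sigma>)) \<omega> \<partial>gauss_field I d \<nu> \<sigma>)"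
      by (intro nn_integral_Markov_inequality) auto
    also have "(\<integral>\<^sup>+\<omega>. ennreal (?X \<omega>) * indicator (space (gauss_field I d \<nu> \<sigma>)) \<omega> \<partial>gauss_field I d \<nu> \<sigma>) = (\<integral>\<^sup>+\<omega>. ennreal (?X \<omega>) \<partial>gauss_field I d \<nu> \<sigma>)"
      by (intro nn_integral_cong) auto
    also have "ennreal (1 / (l * v)) * \<dots> \<le> ennreal (1 / (l * v)) * ennreal v"
      by (intro mult_left_mono E) auto
    also have "\<dots> = ennreal (1 / l)" using l v by (simp add: ennreal_mult[symmetric])
    finally show ?thesis using l by (simp add: emeasure_eq_measure)
  qed
qed

end

section \<open>Inner products and row combinations of vectors given as functions on the
  naturals\<close>

definition ip :: "nat \<Rightarrow> (nat \<Rightarrow> real) \<Rightarrow> (nat \<Rightarrow> real) \<Rightarrow> real" where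
  "ip d x y = (\<Sum>j<d. x j * y j)"

abbreviation nsq :: "nat \<Rightarrow> (nat \<Rightarrow> real) \<Rightarrow> real" where
  "nsq d x \<equiv> ip d x x"

definition comb :: "nat set \<Rightarrow> (nat \<Rightarrow> real) \<Rightarrow> (nat \<Rightarrow> nat \<Rightarrow> real) \<Rightarrow> nat \<Rightarrow> real" where
  "comb J w X j = (\<Sum>i\<in>J. w i * X i j)"

abbreviation vsum :: "nat set \<Rightarrow> (nat \<Rightarrow> nat \<Rightarrow> real) \<Rightarrow> nat \<Rightarrow> real" where
  "vsum J X \<equiv> comb J (\<lambda>_. 1) X"

lemma nsq_nonneg[simp]: "0 \<le> nsq d x"
  unfolding ip_def by (intro sum_nonneg) auto

lemma nsq_eq_sum: "nsq d x = (\<Sum>j<d. (x j)\<^sup>2)"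
  by (simp add: ip_def power2_eq_square)

lemma nsq_eq_0D: "nsq d x = 0 \<Longrightarrow> j < d \<Longrightarrow> x j = 0"
  unfolding nsq_eq_sum by (subst (asm) sum_nonneg_eq_0_iff) auto

lemma ip_commute: "ip d x y = ip d y x"
  by (simp add: ip_def mult.commute)

lemma ip_add_left: "ip d (\<lambda>j. x j + x' j) y = ip d x y + ip d x' y"
  and ip_add_right: "ip d y (\<lambda>j. x j + x' j) = ip d y x + ip d y x'"
  and ip_diff_left: "ip d (\<lambda>j. x j - x' j) y = ip d x y - ip d x' y"
  and ip_diff_right: "ip d y (\<lambda>j. x j - x' j) = ip d y x - ip d y x'"
  and ip_scale_left: "ip d (\<lambda>j. a * x j) y = a * ip d x y"
  and ip_scale_right: "ip d y (\<lambda>j. a * x j) = a * ip d y x"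
  by (simp_all add: ip_def algebra_simps sum.distrib sum_subtractf sum_distrib_left)

lemmas ip_bilinear = ip_add_left ip_add_right ip_diff_left ip_diff_right ip_scale_left ip_scale_right

lemma ip_comb_left: "ip d (comb J w X) y = (\<Sum>i\<in>J. w i * ip d (X i) y)"
  unfolding ip_def comb_def
  by (simp add: sum_distrib_left sum_distrib_right mult.assoc) (rule sum.swap)

lemma ip_comb_right: "ip d y (comb J w X) = (\<Sum>i\<in>J. w i * ip d y (X i))"
  by (simp add: ip_commute[of d y] ip_comb_left)

lemma ip_Cauchy_Schwarz: "(ip d x y)\<^sup>2 \<le> nsq d x * nsq d y"
  unfolding nsq_eq_sum unfolding ip_def by (rule Cauchy_Schwarz_ineq_sum)

lemma ip_cong: "(\<And>j. j < d \<Longrightarrow> x j = x' j) \<Longrightarrow> (\<And>j. j < d \<Longrightarrow> y j = y' j) \<Longrightarrow> ip d x y = ip d x' y'"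
  by (auto simp: ip_def intro!: sum.cong)

lemma measurable_ip[measurable (raw)]:
  assumes "\<And>j. j < d \<Longrightarrow> (\<lambda>\<omega>. x \<omega> j) \<in> borel_measurable M" "\<And>j. j < d \<Longrightarrow> (\<lambda>\<omega>. y \<omega> j) \<in> borel_measurable M"
  shows "(\<lambda>\<omega>. ip d (x \<omega>) (y \<omega>)) \<in> borel_measurable M"
  unfolding ip_def using assms by (intro borel_measurable_sum borel_measurable_times) auto

lemma measurable_comb[measurable (raw)]:
  assumes "\<And>i. i \<in> J \<Longrightarrow> (\<lambda>\<omega>. x \<omega> i j) \<in> borel_measurable M"
  shows "(\<lambda>\<omega>. comb J w (x \<omega>) j) \<in> borel_measurable M"
  unfolding comb_def using assms by (intro borel_measurable_sum borel_measurable_times) auto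

section \<open>Tail bounds for weighted sums and empirical moments of Gaussian rows\<close>

context field_sd begin

text \<open>The \<open>d\<close> coordinates of the centred combination are independent Gaussians of
  the same variance: a scaled chi-square with \<open>d\<close> degrees of freedom.\<close>

lemma comb_norm_tail:
  assumes I: "finite I" and J: "J \<subseteq> I" and s: "\<And>i. i \<in> J \<Longrightarrow> \<sigma> i = s" "0 < s"
    and W: "0 < (\<Sum>i\<in>J. (w i)\<^sup>2)" and u: "0 < u" and t: "0 \<le> t"
  shows "measure (gauss_field I d \<nu> \<sigma>) {\<omega>\<in>space (gauss_field I d \<nu> \<sigma>).
     t * (sqrt (real d * u) + u) * (s\<^sup>2 * (\<Sum>i\<in>J. (w i)\<^sup>2)) \<le>
       \<bar>nsq d (comb J w (\<lambda>i j. \<omega> i j - \<nu> i j)) - real d * (s\<^sup>2 * (\<Sum>i\<in>J. (w i)\<^sup>2))\<bar>} \<le> 2 * exp (- ((2 * t - 1) * u / 16))"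
proof -
  interpret prob_space "gauss_field I d \<nu> \<sigma>" by (rule prob_field)
  define v where "v = s\<^sup>2 * (\<Sum>i\<in>J. (w i)\<^sup>2)"
  have v: "0 < v" using s W by (simp add: v_def)
  let ?Z = "\<lambda>j. lin (J \<times> {j}) \<nu> (\<lambda>t. w (fst t))"
  have var: "linvar (J \<times> {j}) (\<lambda>t. w (fst t)) = v" for j
  proof -
    have "linvar (J \<times> {j}) (\<lambda>t. w (fst t)) = (\<Sum>i\<in>J. (w i)\<^sup>2 * (\<sigma> i)\<^sup>2)"
      unfolding linvar_def by (subst sum.cartesian_product') simp
    then show ?thesis by (simp add: v_def s sum_distrib_left mult.commute)
  qed
  have Z: "?Z j \<omega> = comb J w (\<lambda>i j. \<omega> i j - \<nu> i j) j" for j \<omega>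
    unfolding lin_def comb_def by (subst sum.cartesian_product') simp
  have "prob {\<omega>\<in>space (gauss_field I d \<nu> \<sigma>). t * (sqrt (card {..<d} * u) + u) * (sqrt v)\<^sup>2 \<le>
      \<bar>(\<Sum>j\<in>{..<d}. (?Z j \<omega>)\<^sup>2) - card {..<d} * (sqrt v)\<^sup>2\<bar>} \<le> 2 * exp (- ((2 * t - 1) * u / 16))"
  proof (rule chi_square_tail)
    show "indep_vars (\<lambda>_. borel) ?Z {..<d}"
      by (rule indep_lin[OF I]) (use J in \<open>auto simp: disjoint_family_on_def\<close>)
    fix j assume "j \<in> {..<d}"
    then show "distributed (gauss_field I d \<nu> \<sigma>) lborel (?Z j) (normal_density 0 (sqrt v))"
      using distributed_lin[OF I, of "J \<times> {j}" d "\<lambda>t. w (fst t)" \<nu>] J v by (auto simp: var)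
  qed (use v u t in auto)
  then show ?thesis using v by (simp add: Z nsq_eq_sum v_def[symmetric])
qed

text \<open>A chi-square with one degree of freedom, hence the index set \<open>{()}\<close>. The
  factor 4 absorbs the mean together with the deviation. A vanishing variance is treated apart
  because \<open>chi_square_tail\<close> needs a density.\<close>

lemma weighted_ip_tail:
  assumes I: "finite I" and J: "J \<subseteq> I" and s: "\<And>i. i \<in> J \<Longrightarrow> \<sigma> i = s" "0 < s"
    and u: "1 \<le> u" and t: "1 \<le> t"
  shows "measure (gauss_field I d \<nu> \<sigma>) {\<omega>\<in>space (gauss_field I d \<nu> \<sigma>).
     4 * t * u * (s\<^sup>2 * (\<Sum>i\<in>J. (w i)\<^sup>2) * nsq d y) < (ip d y (comb J w (\<lambda>i j. \<omega> i j - \<nu> i j)))\<^sup>2} \<le> 2 * exp (- ((2 * t - 1) * u / 16))"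
proof -
  interpret prob_space "gauss_field I d \<nu> \<sigma>" by (rule prob_field)
  define v where "v = s\<^sup>2 * (\<Sum>i\<in>J. (w i)\<^sup>2) * nsq d y"
  have v0: "0 \<le> v" by (auto simp: v_def intro!: mult_nonneg_nonneg sum_nonneg)
  let ?T = "J \<times> {..<d}" and ?c = "\<lambda>t. w (fst t) * y (snd t)"
  have var: "linvar ?T ?c = v"
  proof -
    have "linvar ?T ?c = (\<Sum>i\<in>J. \<Sum>j<d. (w i * y j)\<^sup>2 * (\<sigma> i)\<^sup>2)"
      unfolding linvar_def by (subst sum.cartesian_product') simp
    also have "\<dots> = (\<Sum>i\<in>J. \<Sum>j<d. s\<^sup>2 * (w i)\<^sup>2 * (y j)\<^sup>2)"
      by (intro sum.cong refl) (simp add: s power_mult_distrib)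
    finally show ?thesis
      by (simp add: v_def nsq_eq_sum sum_distrib_left sum_distrib_right mult.assoc sum.swap[of _ "{..<d}"])
  qed
  have Z: "lin ?T \<nu> ?c \<omega> = ip d y (comb J w (\<lambda>i j. \<omega> i j - \<nu> i j))" for \<omega>
  proof -
    have "lin ?T \<nu> ?c \<omega> = (\<Sum>i\<in>J. \<Sum>j<d. w i * y j * (\<omega> i j - \<nu> i j))"
      unfolding lin_def by (subst sum.cartesian_product') simp
    then show ?thesis by (simp add: ip_comb_right) (simp add: ip_def sum_distrib_left mult.assoc)
  qed
  have T: "?T \<subseteq> I \<times> {..<d}" using J by auto
  have [measurable]: "lin ?T \<nu> ?c \<in> borel_measurable (gauss_field I d \<nu> \<sigma>)" by (rule measurable_lin[OF T])
  show ?thesis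
  proof (cases "v = 0")
    case True
    have fT: "finite ?T" using I J finite_subset by auto
    have "?c t = 0" if "t \<in> ?T" for t
    proof -
      have "(\<Sum>t\<in>?T. (?c t)\<^sup>2 * (\<sigma> (fst t))\<^sup>2) = 0" using var True by (simp add: linvar_def)
      then have "(?c t)\<^sup>2 * (\<sigma> (fst t))\<^sup>2 = 0" using fT that by (subst (asm) sum_nonneg_eq_0_iff) auto
      then show ?thesis using \<sigma>[of "fst t"] by auto
    qed
    then have "lin ?T \<nu> ?c \<omega> = 0" for \<omega> unfolding lin_def by (intro sum.neutral) auto
    then show ?thesis using True by (simp add: Z[symmetric] v_def[symmetric])
  next
    case False
    then have v: "0 < v" using v0 by simp
    have "prob {\<omega>\<in>space (gauss_field I d \<nu> \<sigma>). t * (sqrt (card {()} * u) + u) * (sqrt v)\<^sup>2 \<le>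
        \<bar>(\<Sum>j\<in>{()}. (lin ?T \<nu> ?c \<omega>)\<^sup>2) - card {()} * (sqrt v)\<^sup>2\<bar>} \<le> 2 * exp (- ((2 * t - 1) * u / 16))"
    proof (rule chi_square_tail)
      show "indep_vars (\<lambda>_. borel) (\<lambda>_. lin ?T \<nu> ?c) {()}"
        by (rule indep_lin[OF I]) (use J in \<open>auto simp: disjoint_family_on_def\<close>)
      show "distributed (gauss_field I d \<nu> \<sigma>) lborel (lin ?T \<nu> ?c) (normal_density 0 (sqrt v))"
        using distributed_lin[OF I T, of ?c \<nu>] v by (simp add: var)
    qed (use v u t in auto)
    moreover have "prob {\<omega>\<in>space (gauss_field I d \<nu> \<sigma>). 4 * t * u * v < (lin ?T \<nu> ?c \<omega>)\<^sup>2} \<le>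
       prob {\<omega>\<in>space (gauss_field I d \<nu> \<sigma>). t * (sqrt (card {()} * u) + u) * (sqrt v)\<^sup>2 \<le>
        \<bar>(\<Sum>j\<in>{()}. (lin ?T \<nu> ?c \<omega>)\<^sup>2) - card {()} * (sqrt v)\<^sup>2\<bar>}"
    proof (intro finite_measure_mono)
      have "sqrt u \<le> u" using u by (simp add: real_le_lsqrt power2_eq_square)
      then have "t * (sqrt u + u) \<le> t * (2 * u)" using t by (intro mult_left_mono) auto
      moreover have "1 \<le> t * u" using mult_mono[of 1 t 1 u] t u by simp
      ultimately have "t * (sqrt u + u) + 1 \<le> 4 * t * u" by (simp add: algebra_simps)
      from mult_right_mono[OF this v0]
      have "t * (sqrt u + u) * v + v \<le> 4 * t * u * v" by (simp add: algebra_simps)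
      then show "{\<omega>\<in>space (gauss_field I d \<nu> \<sigma>). 4 * t * u * v < (lin ?T \<nu> ?c \<omega>)\<^sup>2} \<subseteq>
       {\<omega>\<in>space (gauss_field I d \<nu> \<sigma>). t * (sqrt (card {()} * u) + u) * (sqrt v)\<^sup>2 \<le>
        \<bar>(\<Sum>j\<in>{()}. (lin ?T \<nu> ?c \<omega>)\<^sup>2) - card {()} * (sqrt v)\<^sup>2\<bar>}"
        using v by auto
    qed simp
    ultimately show ?thesis by (simp add: Z v_def)
  qed
qed

text \<open>Here the rows, not the coordinates, are the degrees of freedom: the projections onto a
  fixed \<open>y\<close> are \<open>card I\<close> independent Gaussians.\<close>

lemma sample_quadratic_tail:
  assumes I: "finite I" and s: "\<And>i. i \<in> I \<Longrightarrow> \<sigma> i = s" "0 < s" and t: "0 \<le> t"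
  shows "measure (gauss_field I d \<nu> \<sigma>) {\<omega>\<in>space (gauss_field I d \<nu> \<sigma>).
     t * (sqrt (card I) + 1) * (s\<^sup>2 * nsq d y) < \<bar>(\<Sum>i\<in>I. (ip d (\<lambda>j. \<omega> i j - \<nu> i j) y)\<^sup>2) - card I * (s\<^sup>2 * nsq d y)\<bar>} \<le> 2 * exp (- ((2 * t - 1) / 16))"
proof -
  interpret prob_space "gauss_field I d \<nu> \<sigma>" by (rule prob_field)
  define v where "v = s\<^sup>2 * nsq d y"
  have v0: "0 \<le> v" by (auto simp: v_def)
  let ?Z = "\<lambda>i. lin ({i} \<times> {..<d}) \<nu> (\<lambda>t. y (snd t))"
  have var: "linvar ({i} \<times> {..<d}) (\<lambda>t. y (snd t)) = v" if "i \<in> I" for i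
  proof -
    have "linvar ({i} \<times> {..<d}) (\<lambda>t. y (snd t)) = (\<Sum>j<d. (y j)\<^sup>2 * (\<sigma> i)\<^sup>2)"
      unfolding linvar_def by (subst sum.cartesian_product') simp
    then show ?thesis by (simp add: v_def nsq_eq_sum s that sum_distrib_left mult.commute)
  qed
  have Z: "?Z i \<omega> = ip d (\<lambda>j. \<omega> i j - \<nu> i j) y" for i \<omega>
    unfolding lin_def ip_def by (subst sum.cartesian_product') (simp add: mult.commute)
  show ?thesis
  proof (cases "v = 0")
    case True
    then have "nsq d y = 0" using s by (simp add: v_def)
    then have "ip d x y = 0" for x unfolding ip_def[of d x] by (intro sum.neutral) (auto dest: nsq_eq_0D)
    then show ?thesis using \<open>nsq d y = 0\<close> by simp
  next
    case False
    then have v: "0 < v" using v0 by simp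
    have "prob {\<omega>\<in>space (gauss_field I d \<nu> \<sigma>). t * (sqrt (real (card I) * 1) + 1) * (sqrt v)\<^sup>2 \<le>
        \<bar>(\<Sum>i\<in>I. (?Z i \<omega>)\<^sup>2) - card I * (sqrt v)\<^sup>2\<bar>} \<le> 2 * exp (- ((2 * t - 1) * 1 / 16))"
    proof (rule chi_square_tail[OF I])
      show "indep_vars (\<lambda>_. borel) ?Z I"
        by (rule indep_lin[OF I]) (auto simp: disjoint_family_on_def)
      fix i assume "i \<in> I"
      then show "distributed (gauss_field I d \<nu> \<sigma>) lborel (?Z i) (normal_density 0 (sqrt v))"
        using distributed_lin[OF I, of "{i} \<times> {..<d}" d "\<lambda>t. y (snd t)" \<nu>] v by (auto simp: var)
    qed (use v t in auto)
    then have 1: "prob {\<omega>\<in>space (gauss_field I d \<nu> \<sigma>). t * (sqrt (card I) + 1) * v \<le>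
        \<bar>(\<Sum>i\<in>I. (ip d (\<lambda>j. \<omega> i j - \<nu> i j) y)\<^sup>2) - card I * v\<bar>} \<le> 2 * exp (- ((2 * t - 1) / 16))"
      using v by (simp add: Z)
    have "prob {\<omega>\<in>space (gauss_field I d \<nu> \<sigma>). t * (sqrt (card I) + 1) * v <
        \<bar>(\<Sum>i\<in>I. (ip d (\<lambda>j. \<omega> i j - \<nu> i j) y)\<^sup>2) - card I * v\<bar>} \<le> prob {\<omega>\<in>space (gauss_field I d \<nu> \<sigma>). t * (sqrt (card I) + 1) * v \<le>
        \<bar>(\<Sum>i\<in>I. (ip d (\<lambda>j. \<omega> i j - \<nu> i j) y)\<^sup>2) - card I * v\<bar>}"
    proof (intro finite_measure_mono)
      show "{\<omega>\<in>space (gauss_field I d \<nu> \<sigma>). t * (sqrt (card I) + 1) * v \<le>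
        \<bar>(\<Sum>i\<in>I. (ip d (\<lambda>j. \<omega> i j - \<nu> i j) y)\<^sup>2) - card I * v\<bar>} \<in> events"
        by (intro borel_measurable_le borel_measurable_sum borel_measurable_power borel_measurable_diff borel_measurable_times
          borel_measurable_const borel_measurable_abs measurable_ip measurable_field_component)
    qed auto
    then show ?thesis using 1 by (simp add: v_def)
  qed
qed

text \<open>Polarization of \<open>sample_quadratic_tail\<close>; the two quadratic events account
  for the doubled probability.\<close>

lemma sample_bilinear_tail:
  assumes I: "finite I" and s: "\<And>i. i \<in> I \<Longrightarrow> \<sigma> i = s" "0 < s" and t: "0 \<le> t"
  shows "measure (gauss_field I d \<nu> \<sigma>) {\<omega>\<in>space (gauss_field I d \<nu> \<sigma>).
     t * (sqrt (card I) + 1) * s\<^sup>2 * sqrt (nsq d y * nsq d y') <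
       \<bar>(\<Sum>i\<in>I. ip d (\<lambda>j. \<omega> i j - \<nu> i j) y * ip d (\<lambda>j. \<omega> i j - \<nu> i j) y') - card I * (s\<^sup>2 * ip d y y')\<bar>} \<le> 4 * exp (- ((2 * t - 1) / 16))"
    (is "measure ?M ?B \<le> _")
proof -
  interpret prob_space "gauss_field I d \<nu> \<sigma>" by (rule prob_field)
  define a where "a = sqrt (nsq d y)"
  define b where "b = sqrt (nsq d y')"
  have a2: "a\<^sup>2 = nsq d y" and b2: "b\<^sup>2 = nsq d y'" by (simp_all add: a_def b_def)
  have ab0: "0 \<le> a" "0 \<le> b" by (simp_all add: a_def b_def)
  let ?h = "\<lambda>\<omega> i j. \<omega> i j - \<nu> i j :: real"
  show ?thesis
  proof (cases "a = 0 \<or> b = 0")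
    case True
    then have z: "nsq d y = 0 \<or> nsq d y' = 0" using a2 b2 by auto
    then have "ip d x y = 0 \<or> ip d x y' = 0" "ip d y y' = 0" for x
      unfolding ip_def[of d x] ip_def[of d y y'] by (auto intro!: sum.neutral dest: nsq_eq_0D)
    then have "(\<Sum>i\<in>I. ip d (?h \<omega> i) y * ip d (?h \<omega> i) y') = 0" "ip d y y' = 0" for \<omega>
      by (auto intro!: sum.neutral)
    then show ?thesis using z by auto
  next
    case False
    then have ab: "0 < a" "0 < b" using ab0 by auto
    \<comment> \<open>Weighting each vector by the norm of the other balances the two, so the error
      is a product of norms and not a sum of their squares.\<close>
    define p where "p = (\<lambda>j. b * y j + a * y' j)"
    define q where "q = (\<lambda>j. b * y j - a * y' j)"
    define E where "E v \<omega> = (\<Sum>i\<in>I. (ip d (?h \<omega> i) v)\<^sup>2) - card I * (s\<^sup>2 * nsq d v)" for v \<omega>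
    have pq: "nsq d p + nsq d q = 4 * a\<^sup>2 * b\<^sup>2"
      unfolding p_def q_def by (simp add: ip_bilinear a2[symmetric] b2[symmetric] ip_commute[of d y' y]) (simp add: power2_eq_square algebra_simps)
    have pq': "nsq d p - nsq d q = 4 * a * b * ip d y y'"
      unfolding p_def q_def by (simp add: ip_bilinear ip_commute[of d y' y] algebra_simps)
    have Epq: "E p \<omega> - E q \<omega> = 4 * a * b * ((\<Sum>i\<in>I. ip d (?h \<omega> i) y * ip d (?h \<omega> i) y') - card I * (s\<^sup>2 * ip d y y'))" for \<omega>
    proof -
      have 1: "(ip d x p)\<^sup>2 - (ip d x q)\<^sup>2 = 4 * a * b * (ip d x y * ip d x y')" for x
        unfolding p_def q_def by (simp add: ip_bilinear) (simp add: power2_eq_square algebra_simps)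
      have "E p \<omega> - E q \<omega> = (\<Sum>i\<in>I. (ip d (?h \<omega> i) p)\<^sup>2 - (ip d (?h \<omega> i) q)\<^sup>2) - card I * (s\<^sup>2 * (nsq d p - nsq d q))"
        unfolding E_def by (simp add: sum_subtractf algebra_simps)
      also have "\<dots> = 4 * a * b * ((\<Sum>i\<in>I. ip d (?h \<omega> i) y * ip d (?h \<omega> i) y') - card I * (s\<^sup>2 * ip d y y'))"
        unfolding pq' 1 by (simp add: sum_distrib_left algebra_simps)
      finally show ?thesis .
    qed
    let ?S = "\<lambda>v. {\<omega>\<in>space ?M. t * (sqrt (card I) + 1) * (s\<^sup>2 * nsq d v) < \<bar>E v \<omega>\<bar>}"
    have sub: "?B \<subseteq> ?S p \<union> ?S q"
    proof
      fix \<omega> assume \<omega>: "\<omega> \<in> ?B"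
      show "\<omega> \<in> ?S p \<union> ?S q"
      proof (rule ccontr)
        assume "\<not> ?thesis"
        with \<omega> have "\<bar>E p \<omega>\<bar> \<le> t * (sqrt (card I) + 1) * (s\<^sup>2 * nsq d p)" "\<bar>E q \<omega>\<bar> \<le> t * (sqrt (card I) + 1) * (s\<^sup>2 * nsq d q)" by auto
        then have "\<bar>E p \<omega> - E q \<omega>\<bar> \<le> t * (sqrt (card I) + 1) * (s\<^sup>2 * (nsq d p + nsq d q))"
          by (simp add: algebra_simps abs_le_iff)
        also have "\<dots> = 4 * a * b * (t * (sqrt (card I) + 1) * s\<^sup>2 * (a * b))"
          unfolding pq by (simp add: power2_eq_square algebra_simps)
        finally have "4 * a * b * \<bar>(\<Sum>i\<in>I. ip d (?h \<omega> i) y * ip d (?h \<omega> i) y') - card I * (s\<^sup>2 * ip d y y')\<bar> \<le> 4 * a * b * (t * (sqrt (card I) + 1) * s\<^sup>2 * (a * b))"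
          unfolding Epq using ab by (simp add: abs_mult)
        then have "\<bar>(\<Sum>i\<in>I. ip d (?h \<omega> i) y * ip d (?h \<omega> i) y') - card I * (s\<^sup>2 * ip d y y')\<bar> \<le> t * (sqrt (card I) + 1) * s\<^sup>2 * (a * b)"
          using ab by (simp only: mult_le_cancel_left_pos[of "4 * a * b"] mult_pos_pos zero_less_numeral)
        with \<omega> show False by (simp add: a_def b_def real_sqrt_mult)
      qed
    qed
    have [measurable]: "E v \<in> borel_measurable ?M" for v unfolding E_def[abs_def] by measurable
    have "prob ?B \<le> prob (?S p \<union> ?S q)"
      by (rule finite_measure_mono[OF sub]) measurable
    also have "\<dots> \<le> prob (?S p) + prob (?S q)" by (intro measure_Un_le) auto
    also have "\<dots> \<le> 4 * exp (- ((2 * t - 1) / 16))"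
      using sample_quadratic_tail[OF assms, of d \<nu> p] sample_quadratic_tail[OF assms, of d \<nu> q]
      unfolding E_def by simp
    finally show ?thesis .
  qed
qed

text \<open>Testing one sum against a whole family of vectors costs a single event; a family of
  coordinate vectors gives bounds on norms.\<close>

lemma vsum_ip_tail:
  assumes I: "finite I" and s: "\<And>i. i \<in> I \<Longrightarrow> \<sigma> i = s" and R: "finite R" and l: "0 < l"
  shows "measure (gauss_field I d \<nu> \<sigma>) {\<omega>\<in>space (gauss_field I d \<nu> \<sigma>).
     l * (s\<^sup>2 * card I * (\<Sum>r\<in>R. nsq d (y r))) < (\<Sum>r\<in>R. (ip d (vsum I (\<lambda>i j. \<omega> i j - \<nu> i j)) (y r))\<^sup>2)} \<le> 1 / l"
proof -
  let ?T = "I \<times> {..<d}" and ?c = "\<lambda>r t. y r (snd t)"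
  have var: "linvar ?T (?c r) = s\<^sup>2 * card I * nsq d (y r)" for r
  proof -
    have "linvar ?T (?c r) = (\<Sum>i\<in>I. \<Sum>j<d. (y r j)\<^sup>2 * (\<sigma> i)\<^sup>2)"
      unfolding linvar_def by (subst sum.cartesian_product') simp
    also have "\<dots> = (\<Sum>i\<in>I. s\<^sup>2 * nsq d (y r))"
      by (intro sum.cong refl) (simp add: s nsq_eq_sum sum_distrib_left mult.commute)
    finally show ?thesis by simp
  qed
  have Z: "lin ?T \<nu> (?c r) \<omega> = ip d (vsum I (\<lambda>i j. \<omega> i j - \<nu> i j)) (y r)" for r \<omega>
  proof -
    have "lin ?T \<nu> (?c r) \<omega> = (\<Sum>i\<in>I. \<Sum>j<d. y r j * (\<omega> i j - \<nu> i j))"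
      unfolding lin_def by (subst sum.cartesian_product') simp
    then show ?thesis by (simp add: ip_comb_left) (simp add: ip_def mult.commute)
  qed
  have "measure (gauss_field I d \<nu> \<sigma>) {\<omega>\<in>space (gauss_field I d \<nu> \<sigma>).
     l * (s\<^sup>2 * card I * (\<Sum>r\<in>R. nsq d (y r))) < (\<Sum>r\<in>R. (lin ?T \<nu> (?c r) \<omega>)\<^sup>2)} \<le> 1 / l"
    by (rule sum_lin_square_tail[OF I _ R l]) (auto simp: var sum_distrib_left intro!: mult_nonneg_nonneg sum_nonneg)
  then show ?thesis by (simp add: Z)
qed

text \<open>Fubini over the rows in \<open>A\<close> and the remaining ones. It allows test vectors
  that are random through the other rows.\<close>

lemma measure_field_conditional:
  assumes I: "finite I" and A: "A \<subseteq> I"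
    and Q: "{\<omega>\<in>space (gauss_field I d \<nu> \<sigma>). Q \<omega>} \<in> sets (gauss_field I d \<nu> \<sigma>)"
    and cond: "\<And>y. y \<in> space (gauss_field (I - A) d \<nu> \<sigma>) \<Longrightarrow>
       measure (gauss_field A d \<nu> \<sigma>) {x\<in>space (gauss_field A d \<nu> \<sigma>). Q (merge A (I - A) (x, y))} \<le> c"
  shows "measure (gauss_field I d \<nu> \<sigma>) {\<omega>\<in>space (gauss_field I d \<nu> \<sigma>). Q \<omega>} \<le> c"
proof -
  interpret R: product_prob_space "\<lambda>i. PiM {..<d} (\<lambda>j. normal_measure (\<nu> i j) (\<sigma> i))" I
    by (intro product_prob_spaceI prob_row)
  let ?A = "gauss_field A d \<nu> \<sigma>" and ?B = "gauss_field (I - A) d \<nu> \<sigma>" and ?I = "gauss_field I d \<nu> \<sigma>"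
  interpret PA: prob_space ?A by (rule prob_field)
  interpret PB: prob_space ?B by (rule prob_field)
  interpret PI: prob_space ?I by (rule prob_field)
  interpret AB: pair_sigma_finite ?A ?B ..
  have IA: "A \<union> (I - A) = I" using A by auto
  have fin: "finite A" "finite (I - A)" using I A finite_subset by auto
  have mg: "merge A (I - A) \<in> ?A \<Otimes>\<^sub>M ?B \<rightarrow>\<^sub>M ?I"
    using measurable_merge[of A "I - A" "\<lambda>i. PiM {..<d} (\<lambda>j. normal_measure (\<nu> i j) (\<sigma> i))"]
    unfolding gauss_field_def IA .
  have dm: "distr (?A \<Otimes>\<^sub>M ?B) ?I (merge A (I - A)) = ?I"
    using R.distr_merge[of A "I - A"] fin unfolding gauss_field_def IA by auto
  define W where "W = {\<omega>\<in>space ?I. Q \<omega>}"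
  let ?P = "merge A (I - A) -` W \<inter> space (?A \<Otimes>\<^sub>M ?B)"
  have P: "?P \<in> sets (?A \<Otimes>\<^sub>M ?B)" using mg Q by (auto simp: W_def)
  \<comment> \<open>A probability space is nonempty, so \<open>cond\<close> has an instance, and a
    measure is nonnegative.\<close>
  have c: "0 \<le> c"
    using cond[OF some_in_eq[THEN iffD2, OF PB.not_empty]] measure_nonneg order_trans by blast
  have "emeasure ?I W = emeasure (?A \<Otimes>\<^sub>M ?B) ?P"
    by (subst dm[symmetric], subst emeasure_distr[OF mg]) (use Q in \<open>auto simp: W_def\<close>)
  also have "\<dots> = (\<integral>\<^sup>+y. emeasure ?A ((\<lambda>x. (x, y)) -` ?P) \<partial>?B)"
    by (rule AB.emeasure_pair_measure_alt2[OF P])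
  also have "\<dots> \<le> (\<integral>\<^sup>+y. ennreal c \<partial>?B)"
  proof (rule nn_integral_mono)
    fix y assume y: "y \<in> space ?B"
    have "(\<lambda>x. (x, y)) -` ?P = {x\<in>space ?A. Q (merge A (I - A) (x, y))}"
      using y measurable_space[OF mg] by (auto simp: W_def space_pair_measure)
    then show "emeasure ?A ((\<lambda>x. (x, y)) -` ?P) \<le> ennreal c"
      using cond[OF y] by (simp add: PA.emeasure_eq_measure ennreal_leI)
  qed
  also have "\<dots> = ennreal c" by (simp add: PB.emeasure_space_1)
  finally show ?thesis using c by (simp add: PI.emeasure_eq_measure W_def)
qed

text \<open>Freezing the rows outside \<open>A\<close> turns the vectors \<open>y r\<close> into
  constants, while the rows in \<open>A\<close> keep their law.\<close>

lemma vsum_ip_tail_conditional: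
  assumes I: "finite I" and A: "A \<subseteq> I" and s: "\<And>i. i \<in> A \<Longrightarrow> \<sigma> i = s" and R: "finite R" and l: "0 < l"
    and dep: "\<And>r \<omega> \<omega>'. (\<And>i. i \<in> I - A \<Longrightarrow> \<omega> i = \<omega>' i) \<Longrightarrow> y r \<omega> = y r \<omega>'"
    and ym: "\<And>r j. j < d \<Longrightarrow> (\<lambda>\<omega>. y r \<omega> j) \<in> borel_measurable (gauss_field I d \<nu> \<sigma>)"
  shows "measure (gauss_field I d \<nu> \<sigma>) {\<omega>\<in>space (gauss_field I d \<nu> \<sigma>).
     l * (s\<^sup>2 * card A * (\<Sum>r\<in>R. nsq d (y r \<omega>))) < (\<Sum>r\<in>R. (ip d (vsum A (\<lambda>i j. \<omega> i j - \<nu> i j)) (y r \<omega>))\<^sup>2)} \<le> 1 / l"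
proof (rule measure_field_conditional[OF I A])
  have comp: "(\<lambda>x. x i j) \<in> borel_measurable (gauss_field I d \<nu> \<sigma>)" if "i \<in> A" "j < d" for i j
    using that A by (intro measurable_field_component) auto
  show "{\<omega>\<in>space (gauss_field I d \<nu> \<sigma>).
     l * (s\<^sup>2 * card A * (\<Sum>r\<in>R. nsq d (y r \<omega>))) < (\<Sum>r\<in>R. (ip d (vsum A (\<lambda>i j. \<omega> i j - \<nu> i j)) (y r \<omega>))\<^sup>2)} \<in> sets (gauss_field I d \<nu> \<sigma>)"
    by (intro borel_measurable_less borel_measurable_times borel_measurable_sum borel_measurable_power borel_measurable_diff
        borel_measurable_const borel_measurable_abs measurable_compose[OF _ borel_measurable_sqrt] measurable_ip measurable_comb ym comp)
  fix \<eta> assume "\<eta> \<in> space (gauss_field (I - A) d \<nu> \<sigma>)"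
  have y: "y r (merge A (I - A) (x, \<eta>)) = y r \<eta>" for r x
    by (rule dep) (auto simp: merge_def)
  have g: "vsum A (\<lambda>i j. merge A (I - A) (x, \<eta>) i j - \<nu> i j) = vsum A (\<lambda>i j. x i j - \<nu> i j)" for x
    by (auto simp: comb_def fun_eq_iff merge_def intro!: sum.cong)
  have "finite A" using I A finite_subset by auto
  from vsum_ip_tail[OF this s R l, where y="\<lambda>r. y r \<eta>"]
  show "measure (gauss_field A d \<nu> \<sigma>) {x\<in>space (gauss_field A d \<nu> \<sigma>).
     l * (s\<^sup>2 * card A * (\<Sum>r\<in>R. nsq d (y r (merge A (I - A) (x, \<eta>))))) <
       (\<Sum>r\<in>R. (ip d (vsum A (\<lambda>i j. merge A (I - A) (x, \<eta>) i j - \<nu> i j)) (y r (merge A (I - A) (x, \<eta>))))\<^sup>2)} \<le> 1 / l"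
    unfolding y g .
qed

lemma sample_bilinear_tail_conditional:
  assumes I: "finite I" and A: "A \<subseteq> I" and s: "\<And>i. i \<in> A \<Longrightarrow> \<sigma> i = s" "0 < s" and t: "0 \<le> t"
    and dep: "\<And>\<omega> \<omega>'. (\<And>i. i \<in> I - A \<Longrightarrow> \<omega> i = \<omega>' i) \<Longrightarrow> y \<omega> = y \<omega>'"
       "\<And>\<omega> \<omega>'. (\<And>i. i \<in> I - A \<Longrightarrow> \<omega> i = \<omega>' i) \<Longrightarrow> y' \<omega> = y' \<omega>'"
    and ym: "\<And>j. j < d \<Longrightarrow> (\<lambda>\<omega>. y \<omega> j) \<in> borel_measurable (gauss_field I d \<nu> \<sigma>)"
      "\<And>j. j < d \<Longrightarrow> (\<lambda>\<omega>. y' \<omega> j) \<in> borel_measurable (gauss_field I d \<nu> \<sigma>)"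
  shows "measure (gauss_field I d \<nu> \<sigma>) {\<omega>\<in>space (gauss_field I d \<nu> \<sigma>).
     t * (sqrt (card A) + 1) * s\<^sup>2 * sqrt (nsq d (y \<omega>) * nsq d (y' \<omega>)) <
       \<bar>(\<Sum>i\<in>A. ip d (\<lambda>j. \<omega> i j - \<nu> i j) (y \<omega>) * ip d (\<lambda>j. \<omega> i j - \<nu> i j) (y' \<omega>)) - card A * (s\<^sup>2 * ip d (y \<omega>) (y' \<omega>))\<bar>} \<le> 4 * exp (- ((2 * t - 1) / 16))"
proof (rule measure_field_conditional[OF I A])
  have comp: "(\<lambda>x. x i j) \<in> borel_measurable (gauss_field I d \<nu> \<sigma>)" if "i \<in> A" "j < d" for i j
    using that A by (intro measurable_field_component) auto
  show "{\<omega>\<in>space (gauss_field I d \<nu> \<sigma>).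
     t * (sqrt (card A) + 1) * s\<^sup>2 * sqrt (nsq d (y \<omega>) * nsq d (y' \<omega>)) <
       \<bar>(\<Sum>i\<in>A. ip d (\<lambda>j. \<omega> i j - \<nu> i j) (y \<omega>) * ip d (\<lambda>j. \<omega> i j - \<nu> i j) (y' \<omega>)) - card A * (s\<^sup>2 * ip d (y \<omega>) (y' \<omega>))\<bar>} \<in> sets (gauss_field I d \<nu> \<sigma>)"
    by (intro borel_measurable_less borel_measurable_times borel_measurable_sum borel_measurable_power borel_measurable_diff
        borel_measurable_const borel_measurable_abs measurable_compose[OF _ borel_measurable_sqrt] measurable_ip measurable_comb ym comp)
  fix \<eta> assume "\<eta> \<in> space (gauss_field (I - A) d \<nu> \<sigma>)"
  have y: "y (merge A (I - A) (x, \<eta>)) = y \<eta>" "y' (merge A (I - A) (x, \<eta>)) = y' \<eta>" for x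
    by (rule dep, auto simp: merge_def)+
  have g: "(\<Sum>i\<in>A. ip d (\<lambda>j. merge A (I - A) (x, \<eta>) i j - \<nu> i j) (y \<eta>) * ip d (\<lambda>j. merge A (I - A) (x, \<eta>) i j - \<nu> i j) (y' \<eta>)) =
     (\<Sum>i\<in>A. ip d (\<lambda>j. x i j - \<nu> i j) (y \<eta>) * ip d (\<lambda>j. x i j - \<nu> i j) (y' \<eta>))" for x
    by (intro sum.cong) (auto simp: merge_def)
  have "finite A" using I A finite_subset by auto
  from sample_bilinear_tail[OF this s t, where y="y \<eta>" and y'="y' \<eta>"]
  show "measure (gauss_field A d \<nu> \<sigma>) {x\<in>space (gauss_field A d \<nu> \<sigma>).
     t * (sqrt (card A) + 1) * s\<^sup>2 * sqrt (nsq d (y (merge A (I - A) (x, \<eta>))) * nsq d (y' (merge A (I - A) (x, \<eta>)))) <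
       \<bar>(\<Sum>i\<in>A. ip d (\<lambda>j. merge A (I - A) (x, \<eta>) i j - \<nu> i j) (y (merge A (I - A) (x, \<eta>))) * ip d (\<lambda>j. merge A (I - A) (x, \<eta>) i j - \<nu> i j) (y' (merge A (I - A) (x, \<eta>)))) - card A * (s\<^sup>2 * ip d (y (merge A (I - A) (x, \<eta>))) (y' (merge A (I - A) (x, \<eta>))))\<bar>} \<le> 4 * exp (- ((2 * t - 1) / 16))"
    unfolding y g .
qed

end

section \<open>Near-isometry over integer weights\<close>

text \<open>Finite, for the union bound, yet wide enough for \<open>sum_ip_square_le\<close>, where
  rounded weights reach \<open>2 * sqrt \<kappa>\<close>, at most \<open>2 * n\<close>.\<close>

definition weights :: "nat \<Rightarrow> (nat \<Rightarrow> int) set" where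
  "weights n = PiE {..<n} (\<lambda>_. {- (2 * int n)..2 * int n})"

definition support :: "nat \<Rightarrow> (nat \<Rightarrow> int) \<Rightarrow> nat set" where
  "support n w = {i. i < n \<and> w i \<noteq> 0}"

definition sqsum :: "nat \<Rightarrow> (nat \<Rightarrow> int) \<Rightarrow> real" where
  "sqsum n w = (\<Sum>i<n. (real_of_int (w i))\<^sup>2)"

abbreviation wcomb :: "nat \<Rightarrow> (nat \<Rightarrow> int) \<Rightarrow> (nat \<Rightarrow> nat \<Rightarrow> real) \<Rightarrow> nat \<Rightarrow> real" where
  "wcomb n w X \<equiv> comb {..<n} (\<lambda>i. real_of_int (w i)) X"

text \<open>The Bernstein deviation of a chi-square with \<open>d\<close> degrees of freedom at tail
  exponent \<open>u\<close>.\<close>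

definition dev :: "nat \<Rightarrow> real \<Rightarrow> real" where
  "dev d u = sqrt (real d * u) + u"

text \<open>A restricted isometry property. The factor 2 is the variance of a clone. The tolerance
  grows with the support because a support of size \<open>u\<close> has about
  \<open>(4 n^2)^u\<close> competitors.\<close>

definition rip :: "nat \<Rightarrow> nat \<Rightarrow> nat set \<Rightarrow> real \<Rightarrow> (nat \<Rightarrow> nat \<Rightarrow> real) \<Rightarrow> bool" where
  "rip n d J l X \<longleftrightarrow> (\<forall>w\<in>weights n. support n w \<subseteq> J \<longrightarrow>
     \<bar>nsq d (wcomb n w X) - 2 * real d * sqsum n w\<bar> \<le> l * dev d (card (support n w)) * sqsum n w)"

lemma finite_weights[simp]: "finite (weights n)"
  unfolding weights_def by (intro finite_PiE) auto

lemma finite_support[simp]: "finite (support n w)"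
  by (simp add: support_def)

lemma dev_nonneg[simp]: "0 \<le> u \<Longrightarrow> 0 \<le> dev d u"
  by (simp add: dev_def)

lemma dev_mono: "0 \<le> u \<Longrightarrow> u \<le> v \<Longrightarrow> dev d u \<le> dev d v"
  unfolding dev_def by (intro add_mono real_sqrt_le_mono mult_left_mono) auto

lemma sqsum_nonneg[simp]: "0 \<le> sqsum n w"
  by (simp add: sqsum_def sum_nonneg)

lemma sqsum_support: "sqsum n w = (\<Sum>i\<in>support n w. (real_of_int (w i))\<^sup>2)"
  unfolding sqsum_def support_def by (rule sum.mono_neutral_cong_right) auto

lemma wcomb_support: "wcomb n w X = comb (support n w) (\<lambda>i. real_of_int (w i)) X"
  unfolding comb_def fun_eq_iff support_def by (intro allI sum.mono_neutral_cong_right) auto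

lemma sqsum_pos: "support n w \<noteq> {} \<Longrightarrow> 0 < sqsum n w"
  unfolding sqsum_support by (intro sum_pos) (auto simp: support_def)

text \<open>The generating function of the support size factorizes over the coordinates, each of
  which has the value 0 and \<open>4 * n\<close> other values.\<close>

lemma sum_weights_exp:
  fixes c :: real
  shows "(\<Sum>w\<in>weights n. exp (- c * card (support n w))) = (1 + 4 * real n * exp (- c)) ^ n"
proof -
  have "exp (- c * card (support n w)) = (\<Prod>i<n. if w i = 0 then 1 else exp (- c))" for w
  proof -
    have "(\<Prod>i<n. if w i = 0 then 1 else exp (- c)) = (\<Prod>i\<in>support n w. exp (- c))"
      unfolding support_def by (rule prod.mono_neutral_cong_right) auto
    then show ?thesis by (simp add: exp_of_nat_mult[symmetric] mult.commute)
  qed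
  then have "(\<Sum>w\<in>weights n. exp (- c * card (support n w))) =
     (\<Sum>w\<in>weights n. \<Prod>i<n. if w i = 0 then 1 else exp (- c))" by simp
  also have "\<dots> = (\<Prod>i<n. \<Sum>v\<in>{- (2 * int n)..2 * int n}. if v = 0 then 1 else exp (- c))"
    unfolding weights_def by (rule prod_sum_PiE[symmetric]) auto
  also have "(\<Sum>v\<in>{- (2 * int n)..2 * int n}. if v = 0 then 1 else exp (- c)) = 1 + 4 * real n * exp (- c)"
  proof -
    have "(\<Sum>v\<in>{- (2 * int n)..2 * int n}. if v = 0 then 1 else exp (- c)) =
      1 + (\<Sum>v\<in>{- (2 * int n)..2 * int n} - {0}. if v = 0 then 1 else exp (- c))"
      by (subst sum.remove[of _ 0]) auto
    also have "(\<Sum>v\<in>{- (2 * int n)..2 * int n} - {0}. if v = 0 then 1 else exp (- c)) =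
       (\<Sum>v\<in>{- (2 * int n)..2 * int n} - {0}. exp (- c))" by (intro sum.cong) auto
    also have "\<dots> = 4 * real n * exp (- c)" by simp
    finally show ?thesis .
  qed
  finally show ?thesis by simp
qed

text \<open>Each nonzero coordinate gains a factor \<open>exp (- c)\<close> against its
  \<open>4 * n\<close> values and \<open>n\<close> positions. With
  \<open>x = 4 n^2 exp (- c)\<close> at most 1, the total is below \<open>2 (exp x - 1)\<close>,
  hence below \<open>4 x\<close>.\<close>

lemma (in prob_space) weights_union_bound:
  fixes c :: real
  assumes B: "\<And>w. w \<in> weights n \<Longrightarrow> support n w \<noteq> {} \<Longrightarrow> B w \<in> events"
    and p: "\<And>w. w \<in> weights n \<Longrightarrow> support n w \<noteq> {} \<Longrightarrow> P w \<Longrightarrow> prob (B w) \<le> 2 * exp (- c * card (support n w))"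
    and c: "4 * (real n)\<^sup>2 * exp (- c) \<le> 1"
  shows "prob (\<Union>w\<in>{w\<in>weights n. support n w \<noteq> {} \<and> P w}. B w) \<le> 16 * (real n)\<^sup>2 * exp (- c)"
proof -
  let ?W = "{w\<in>weights n. support n w \<noteq> {} \<and> P w}"
  \<comment> \<open>The zero weight contributes the term 1 to the generating function and has to be
    subtracted.\<close>
  let ?z = "\<lambda>i\<in>{..<n}. 0 :: int"
  have z: "?z \<in> weights n" "support n ?z = {}" by (auto simp: weights_def support_def)
  have "prob (\<Union>w\<in>?W. B w) \<le> (\<Sum>w\<in>?W. prob (B w))"
    using B by (intro finite_measure_subadditive_finite) auto
  also have "\<dots> \<le> (\<Sum>w\<in>?W. 2 * exp (- c * card (support n w)))" using p by (intro sum_mono) auto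
  also have "\<dots> \<le> (\<Sum>w\<in>weights n - {?z}. 2 * exp (- c * card (support n w)))"
    using z by (intro sum_mono2) auto
  also have "\<dots> = 2 * ((1 + 4 * real n * exp (- c)) ^ n - 1)"
    using sum.remove[OF finite_weights z(1), of "\<lambda>w. exp (- c * card (support n w))"] z sum_weights_exp[of c n]
    by (simp add: sum_distrib_left[symmetric])
  also have "(1 + 4 * real n * exp (- c)) ^ n \<le> exp (4 * real n * exp (- c)) ^ n"
    by (intro power_mono) (auto intro: exp_ge_add_one_self[THEN order_trans[rotated]])
  also have "\<dots> = exp (4 * (real n)\<^sup>2 * exp (- c))"
    by (simp add: exp_of_nat_mult[symmetric] power2_eq_square algebra_simps)
  also have "\<dots> \<le> 1 + 4 * (real n)\<^sup>2 * exp (- c) + (4 * (real n)\<^sup>2 * exp (- c))\<^sup>2"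
    using c by (intro exp_bound) auto
  also have "(4 * (real n)\<^sup>2 * exp (- c))\<^sup>2 \<le> 4 * (real n)\<^sup>2 * exp (- c)"
    unfolding power2_eq_square[of "4 * (real n)\<^sup>2 * exp (- c)"] using c by (intro mult_left_le) auto
  finally show ?thesis by (simp add: algebra_simps)
qed

text \<open>On a corrupted row both clones of a point \<open>z\<close> share the noise \<open>\<xi>\<close>, and
  \<open>\<parallel>z - \<xi>\<parallel>\<^sup>2 = \<parallel>z + \<xi>\<parallel>\<^sup>2 - 4 \<langle>z, \<xi>\<rangle>\<close>; since \<open>z\<close> is oblivious to \<open>\<xi>\<close>, near-isometry passes
  from one clone to the other.\<close>

lemma rip_other_clone:
  assumes p: "rip n d B l (\<lambda>i j. z i j + \<xi> i j)" and l: "2 \<le> l"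
    and noise: "\<And>w. w \<in> weights n \<Longrightarrow> support n w \<noteq> {} \<Longrightarrow> support n w \<subseteq> B \<Longrightarrow>
       \<bar>nsq d (wcomb n w \<xi>) - real d * sqsum n w\<bar> \<le> l / 2 * dev d (card (support n w)) * sqsum n w"
    and cross: "\<And>w. w \<in> weights n \<Longrightarrow> support n w \<noteq> {} \<Longrightarrow> support n w \<subseteq> B \<Longrightarrow>
       (ip d (wcomb n w z) (wcomb n w \<xi>))\<^sup>2 \<le> 2 * l * card (support n w) * (sqsum n w * nsq d (wcomb n w z))"
  shows "rip n d B (17 * l) (\<lambda>i j. z i j - \<xi> i j)"
  unfolding rip_def
proof (intro ballI impI)
  fix w assume w: "w \<in> weights n" "support n w \<subseteq> B"
  define u where "u = real (card (support n w))"
  define s where "s = sqsum n w"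
  have s0: "0 \<le> s" and u0: "0 \<le> u" by (auto simp: s_def u_def)
  define Z where "Z = wcomb n w z"
  define N where "N = wcomb n w \<xi>"
  have P: "wcomb n w (\<lambda>i j. z i j + \<xi> i j) = (\<lambda>j. Z j + N j)" and Q: "wcomb n w (\<lambda>i j. z i j - \<xi> i j) = (\<lambda>j. Z j - N j)"
    by (auto simp: Z_def N_def comb_def fun_eq_iff algebra_simps sum.distrib sum_subtractf)
  have p': "\<bar>nsq d (\<lambda>j. Z j + N j) - 2 * real d * s\<bar> \<le> l * dev d u * s"
    using p w unfolding rip_def P[symmetric] by (simp add: u_def s_def)
  show "\<bar>nsq d (wcomb n w (\<lambda>i j. z i j - \<xi> i j)) - 2 * real d * sqsum n w\<bar> \<le> 17 * l * dev d (card (support n w)) * sqsum n w"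
  proof (cases "support n w = {}")
    case True
    then have "sqsum n w = 0" "wcomb n w (\<lambda>i j. z i j - \<xi> i j) = (\<lambda>_. 0)"
      unfolding sqsum_support wcomb_support by (auto simp: comb_def)
    then show ?thesis by (simp add: ip_def)
  next
    case False
    have n': "\<bar>nsq d N - real d * s\<bar> \<le> l / 2 * dev d u * s"
      using noise[OF w(1) False w(2)] by (simp add: N_def s_def u_def)
    have c': "(ip d Z N)\<^sup>2 \<le> 2 * l * u * (s * nsq d Z)"
      using cross[OF w(1) False w(2)] by (simp add: Z_def N_def s_def u_def)
    have dev1: "dev d u \<le> 3/2 * (d + u)"
    proof -
      have "sqrt (real d * u) \<le> (d + u) / 2" using u0 by (intro arith_geo_mean_sqrt) auto
      then show ?thesis unfolding dev_def by (simp add: field_simps)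
    qed
    \<comment> \<open>The tolerance in \<open>cross\<close> scales with the norm of
      \<open>Z\<close>, which is not controlled in advance; since \<open>Z\<close> is the first
      clone minus the noise, near-isometry of the clone bounds it.\<close>
    have "nsq d Z \<le> 2 * nsq d (\<lambda>j. Z j + N j) + 2 * nsq d N"
    proof -
      have "0 \<le> nsq d (\<lambda>j. Z j + 2 * N j)" by simp
      then show ?thesis by (simp add: ip_bilinear ip_commute[of d N Z])
    qed
    also have "\<dots> \<le> 6 * d * s + 3 * l * dev d u * s" using p' n' unfolding abs_le_iff by linarith
    also have "\<dots> = (6 * d + 3 * l * dev d u) * s" by (simp add: algebra_simps)
    also have "\<dots> \<le> (8 * l * (d + u)) * s"
    proof (rule mult_right_mono[OF _ s0])
      have "3 * l * dev d u \<le> 3 * l * (3/2 * (d + u))" using l by (intro mult_left_mono dev1) auto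
      moreover have "6 * d \<le> 3 * l * (d + u)" using l u0 mult_mono[of 2 l "real d" "d + u"] by simp
      moreover have "0 \<le> l * (d + u)" using l u0 by simp
      ultimately show "6 * d + 3 * l * dev d u \<le> 8 * l * (d + u)" by (simp add: algebra_simps)
    qed
    finally have Zb: "nsq d Z \<le> 8 * l * (d + u) * s" .
    have "(ip d Z N)\<^sup>2 \<le> 2 * l * u * (s * (8 * l * (d + u) * s))"
    proof -
      have "2 * l * u * s * nsq d Z \<le> 2 * l * u * s * (8 * l * (d + u) * s)"
        using l u0 s0 by (intro mult_left_mono[OF Zb]) auto
      then show ?thesis using c' by (simp only: mult.assoc)
    qed
    also have "\<dots> \<le> (4 * l * dev d u * s)\<^sup>2"
    proof -
      have "u * (d + u) \<le> (dev d u)\<^sup>2" using u0 by (simp add: dev_def power2_eq_square algebra_simps)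
      moreover have "0 \<le> 16 * l\<^sup>2 * s\<^sup>2" by simp
      ultimately have "16 * l\<^sup>2 * s\<^sup>2 * (u * (d + u)) \<le> 16 * l\<^sup>2 * s\<^sup>2 * (dev d u)\<^sup>2" by (rule mult_left_mono)
      then show ?thesis by (simp add: power2_eq_square algebra_simps)
    qed
    \<comment> \<open>Four times this cross term plus the tolerance \<open>l\<close> of the first
      clone makes the constant 17.\<close>
    finally have "\<bar>ip d Z N\<bar> \<le> 4 * l * dev d u * s" using l u0 s0 by (simp add: abs_le_square_iff[symmetric])
    moreover have "nsq d (\<lambda>j. Z j - N j) = nsq d (\<lambda>j. Z j + N j) - 4 * ip d Z N"
      by (simp add: ip_bilinear ip_commute[of d N Z])
    ultimately show ?thesis using p' unfolding Q s_def[symmetric] u_def[symmetric] by (simp add: abs_le_iff)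
  qed
qed

section \<open>Deterministic consequences of near-isometry for the surviving corrupted rows\<close>

locale near_isometry =
  fixes n d :: nat and B :: "nat set" and \<Lambda> \<kappa> :: real and q :: "nat \<Rightarrow> nat \<Rightarrow> real"
  assumes rip: "rip n d B \<Lambda> q" and B: "B \<subseteq> {..<n}" and card_B: "real (card B) \<le> \<kappa>" and \<Lambda>: "1 \<le> \<Lambda>" and d: "1 \<le> d" and \<kappa>_le: "\<kappa> \<le> n"
begin

text \<open>The tolerance at the largest support size, hence valid for every subset of
  \<open>B\<close>.\<close>

definition \<beta> :: real where "\<beta> = \<Lambda> * dev d \<kappa>"

lemma finite_B: "finite B" using B finite_subset by blast

lemma \<kappa>_nonneg: "0 \<le> \<kappa>" using card_B by linarith

lemma \<beta>_nonneg: "0 \<le> \<beta>" using \<Lambda> \<kappa>_nonneg by (simp add: \<beta>_def)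

text \<open>Extending the weights by zero gives an element of \<open>weights n\<close>; its support
  may be smaller than \<open>V\<close>, which \<open>dev_mono\<close> permits.\<close>

lemma comb_near_isometry:
  assumes V: "V \<subseteq> B" and v: "\<And>i. i \<in> V \<Longrightarrow> \<bar>v i\<bar> \<le> 2 * int n"
  shows "\<bar>nsq d (comb V (\<lambda>i. real_of_int (v i)) q) - 2 * real d * (\<Sum>i\<in>V. (real_of_int (v i))\<^sup>2)\<bar> \<le> \<Lambda> * dev d (card V) * (\<Sum>i\<in>V. (real_of_int (v i))\<^sup>2)"
proof -
  define w where "w = (\<lambda>i\<in>{..<n}. if i \<in> V then v i else 0)"
  have Vn: "V \<subseteq> {..<n}" "finite V" using V B finite_B finite_subset by auto
  have w: "w \<in> weights n" using v by (force simp: w_def weights_def abs_le_iff)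
  have sV: "support n w \<subseteq> V" by (auto simp: w_def support_def)
  have 1: "wcomb n w q = comb V (\<lambda>i. real_of_int (v i)) q"
    unfolding comb_def fun_eq_iff using Vn by (intro allI sum.mono_neutral_cong_right) (auto simp: w_def)
  have 2: "sqsum n w = (\<Sum>i\<in>V. (real_of_int (v i))\<^sup>2)"
    unfolding sqsum_def using Vn by (intro sum.mono_neutral_cong_right) (auto simp: w_def)
  have "\<bar>nsq d (wcomb n w q) - 2 * real d * sqsum n w\<bar> \<le> \<Lambda> * dev d (card (support n w)) * sqsum n w"
    using rip w sV V unfolding rip_def by blast
  also have "\<dots> \<le> \<Lambda> * dev d (card V) * sqsum n w"
    using \<Lambda> sV Vn by (intro mult_right_mono mult_left_mono dev_mono) (auto intro: card_mono)
  finally show ?thesis unfolding 1 2 .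
qed

lemma card_V: "V \<subseteq> B \<Longrightarrow> real (card V) \<le> \<kappa>"
  using card_mono[OF finite_B, of V] card_B by simp

lemma dev_\<beta>: "V \<subseteq> B \<Longrightarrow> \<Lambda> * dev d (card V) \<le> \<beta>"
  unfolding \<beta>_def using \<Lambda> by (intro mult_left_mono dev_mono card_V) auto

lemma nsq_vsum_le:
  assumes V: "V \<subseteq> B" and n: "1 \<le> n"
  shows "nsq d (vsum V q) \<le> (2 * d + \<beta>) * \<kappa>"
proof -
  have "\<bar>nsq d (vsum V q) - 2 * real d * card V\<bar> \<le> \<Lambda> * dev d (card V) * card V"
    using comb_near_isometry[OF V, of "\<lambda>_. 1"] n by simp
  moreover have "\<Lambda> * dev d (card V) * card V \<le> \<beta> * card V" using dev_\<beta>[OF V] by (intro mult_right_mono) auto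
  ultimately have "nsq d (vsum V q) \<le> (2 * d + \<beta>) * card V" by (simp add: algebra_simps)
  also have "\<dots> \<le> (2 * d + \<beta>) * \<kappa>" using card_V[OF V] \<beta>_nonneg by (intro mult_left_mono) auto
  finally show ?thesis .
qed

text \<open>Polarization with the signs \<open>1\<close> and \<open>-1\<close>, which keep the
  weights integral. As \<open>U\<close> and \<open>V\<close> are disjoint, both signs have the same
  weight \<open>W\<close>, so the main terms \<open>2 * d * W\<close> cancel and only the tolerance
  is left.\<close>

lemma ip_comb_vsum_le:
  assumes U: "U \<subseteq> B" and V: "V \<subseteq> B" and disj: "U \<inter> V = {}" and v: "\<And>i. i \<in> U \<Longrightarrow> \<bar>v i\<bar> \<le> 2 * int n" and n: "1 \<le> n"
  shows "2 * \<bar>ip d (comb U (\<lambda>i. real_of_int (v i)) q) (vsum V q)\<bar> \<le> \<Lambda> * dev d (card (U \<union> V)) * ((\<Sum>i\<in>U. (real_of_int (v i))\<^sup>2) + card V)"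
proof -
  have fin: "finite U" "finite V" using U V finite_B finite_subset by auto
  define x where "x = comb U (\<lambda>i. real_of_int (v i)) q"
  define y where "y = vsum V q"
  define W where "W = (\<Sum>i\<in>U. (real_of_int (v i))\<^sup>2) + card V"
  have key: "\<bar>nsq d (\<lambda>j. x j + real_of_int e * y j) - 2 * real d * W\<bar> \<le> \<Lambda> * dev d (card (U \<union> V)) * W" if e: "e = 1 \<or> e = -1" for e :: int
  proof -
    let ?v = "\<lambda>i. if i \<in> U then v i else e"
    have 1: "comb (U \<union> V) (\<lambda>i. real_of_int (?v i)) q = (\<lambda>j. x j + real_of_int e * y j)"
    proof
      fix j
      have "comb (U \<union> V) (\<lambda>i. real_of_int (?v i)) q j = (\<Sum>i\<in>U. real_of_int (?v i) * q i j) + (\<Sum>i\<in>V. real_of_int (?v i) * q i j)"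
        unfolding comb_def by (rule sum.union_disjoint[OF fin disj])
      also have "(\<Sum>i\<in>V. real_of_int (?v i) * q i j) = (\<Sum>i\<in>V. real_of_int e * q i j)"
        using disj by (intro sum.cong) auto
      finally show "comb (U \<union> V) (\<lambda>i. real_of_int (?v i)) q j = x j + real_of_int e * y j"
        by (simp add: x_def y_def comb_def sum_distrib_left)
    qed
    have 2: "(\<Sum>i\<in>U \<union> V. (real_of_int (?v i))\<^sup>2) = W"
    proof -
      have "(\<Sum>i\<in>U \<union> V. (real_of_int (?v i))\<^sup>2) = (\<Sum>i\<in>U. (real_of_int (?v i))\<^sup>2) + (\<Sum>i\<in>V. (real_of_int (?v i))\<^sup>2)"
        by (rule sum.union_disjoint[OF fin disj])
      also have "(\<Sum>i\<in>V. (real_of_int (?v i))\<^sup>2) = (\<Sum>i\<in>V. 1)"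
        using disj e by (intro sum.cong) auto
      finally show ?thesis by (simp add: W_def)
    qed
    show ?thesis using comb_near_isometry[of "U \<union> V" ?v] U V v e n unfolding 1 2 by auto
  qed
  have "4 * ip d x y = nsq d (\<lambda>j. x j + real_of_int 1 * y j) - nsq d (\<lambda>j. x j + real_of_int (-1) * y j)"
    by (simp add: ip_bilinear ip_commute[of d y x])
  then have "\<bar>4 * ip d x y\<bar> \<le> 2 * (\<Lambda> * dev d (card (U \<union> V)) * W)" using key[of 1] key[of "-1"] by linarith
  then show ?thesis by (simp add: x_def y_def W_def)
qed

lemma ip_vsum_vsum_le:
  assumes U: "U \<subseteq> B" and V: "V \<subseteq> B" and disj: "U \<inter> V = {}" and n: "1 \<le> n"
  shows "\<bar>ip d (vsum U q) (vsum V q)\<bar> \<le> \<beta> * \<kappa>"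
proof -
  have "2 * \<bar>ip d (vsum U q) (vsum V q)\<bar> \<le> \<Lambda> * dev d (card (U \<union> V)) * (card U + card V)"
    using ip_comb_vsum_le[OF U V disj, of "\<lambda>_. 1"] n by simp
  also have "\<dots> \<le> \<beta> * (\<kappa> + \<kappa>)"
    using U V card_V[OF U] card_V[OF V] by (intro mult_mono dev_\<beta> \<beta>_nonneg) auto
  finally show ?thesis by (simp add: algebra_simps)
qed

lemma nsq_le:
  assumes i: "i \<in> B" and n: "1 \<le> n"
  shows "nsq d (q i) \<le> 4 * \<Lambda> * d"
proof -
  have "vsum {i} q = q i" by (simp add: comb_def fun_eq_iff)
  then have "\<bar>nsq d (q i) - 2 * real d\<bar> \<le> \<Lambda> * (sqrt d + 1)"
    using comb_near_isometry[of "{i}" "\<lambda>_. 1"] i n by (simp add: dev_def)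
  moreover have "sqrt d \<le> d" using d by (simp add: real_le_lsqrt power2_eq_square)
  then have "\<Lambda> * (sqrt d + 1) \<le> \<Lambda> * (2 * d)" using \<Lambda> d by (intro mult_left_mono) auto
  moreover have "d \<le> \<Lambda> * d" using \<Lambda> by (simp add: mult_le_cancel_right1)
  ultimately show ?thesis by (simp add: abs_le_iff algebra_simps)
qed

lemma ip_le:
  assumes i: "i \<in> B" "k \<in> B" "i \<noteq> k" and n: "1 \<le> n"
  shows "\<bar>ip d (q i) (q k)\<bar> \<le> 4 * \<Lambda> * sqrt d"
proof -
  have e: "comb {i} (\<lambda>_. real_of_int 1) q = q i" "vsum {k} q = q k" by (simp_all add: comb_def fun_eq_iff)
  have "2 * \<bar>ip d (q i) (q k)\<bar> \<le> \<Lambda> * (sqrt (real d * 2) + 2) * 2"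
    using ip_comb_vsum_le[of "{i}" "{k}" "\<lambda>_. 1", unfolded e] i n by (simp add: dev_def)
  moreover have "sqrt (real d * 2) + 2 \<le> 4 * sqrt d"
  proof -
    have "sqrt (real d * 2) \<le> sqrt (real d * 4)" by simp
    also have "\<dots> = 2 * sqrt d" by (simp add: real_sqrt_mult)
    finally have "sqrt (real d * 2) \<le> 2 * sqrt d" .
    moreover have "1 \<le> sqrt d" using d by simp
    ultimately show ?thesis by linarith
  qed
  then have "\<Lambda> * (sqrt (real d * 2) + 2) \<le> \<Lambda> * (4 * sqrt d)" using \<Lambda> by (intro mult_left_mono) auto
  ultimately show ?thesis by simp
qed

text \<open>At most \<open>\<kappa>\<close> diagonal entries of order \<open>d\<close> and
  \<open>\<kappa>^2\<close> off-diagonal entries of order \<open>sqrt d\<close>.\<close>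

lemma gram_frobenius_le:
  assumes U: "U \<subseteq> B" and n: "1 \<le> n"
  shows "(\<Sum>i\<in>U. \<Sum>k\<in>U. (ip d (q i) (q k))\<^sup>2) \<le> 16 * \<Lambda>\<^sup>2 * (\<kappa> * (real d)\<^sup>2 + \<kappa>\<^sup>2 * d)"
proof -
  have fin: "finite U" using U finite_B finite_subset by auto
  have "(\<Sum>k\<in>U. (ip d (q i) (q k))\<^sup>2) \<le> 16 * \<Lambda>\<^sup>2 * (real d)\<^sup>2 + card U * (16 * \<Lambda>\<^sup>2 * d)" if "i \<in> U" for i
  proof -
    have "(\<Sum>k\<in>U. (ip d (q i) (q k))\<^sup>2) = (nsq d (q i))\<^sup>2 + (\<Sum>k\<in>U - {i}. (ip d (q i) (q k))\<^sup>2)"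
      by (rule sum.remove[OF fin that])
    also have "(nsq d (q i))\<^sup>2 \<le> (4 * \<Lambda> * d)\<^sup>2" using that U n by (intro power_mono nsq_le) auto
    also have "(\<Sum>k\<in>U - {i}. (ip d (q i) (q k))\<^sup>2) \<le> (\<Sum>k\<in>U - {i}. (4 * \<Lambda> * sqrt d)\<^sup>2)"
    proof (rule sum_mono)
      fix k assume "k \<in> U - {i}"
      then have "\<bar>ip d (q i) (q k)\<bar> \<le> 4 * \<Lambda> * sqrt d" using that U n by (intro ip_le) auto
      then show "(ip d (q i) (q k))\<^sup>2 \<le> (4 * \<Lambda> * sqrt d)\<^sup>2" using power_mono[of "\<bar>ip d (q i) (q k)\<bar>" _ 2] by simp
    qed
    also have "\<dots> \<le> card U * (16 * \<Lambda>\<^sup>2 * d)" using card_mono[OF fin, of "U - {i}"] by (simp add: power_mult_distrib mult_right_mono)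
    finally show ?thesis by (simp add: power_mult_distrib)
  qed
  then have "(\<Sum>i\<in>U. \<Sum>k\<in>U. (ip d (q i) (q k))\<^sup>2) \<le> (\<Sum>i\<in>U. 16 * \<Lambda>\<^sup>2 * (real d)\<^sup>2 + card U * (16 * \<Lambda>\<^sup>2 * d))" by (rule sum_mono)
  also have "\<dots> = 16 * \<Lambda>\<^sup>2 * (card U * (real d)\<^sup>2 + (real (card U))\<^sup>2 * d)" by (simp add: algebra_simps power2_eq_square)
  also have "\<dots> \<le> 16 * \<Lambda>\<^sup>2 * (\<kappa> * (real d)\<^sup>2 + \<kappa>\<^sup>2 * d)"
    using card_V[OF U] by (intro mult_left_mono add_mono mult_right_mono power_mono) auto
  finally show ?thesis .
qed

text \<open>The worst real weight vector for \<open>c\<close> is \<open>c\<close> itself; rescaled to squared norm \<open>4 \<kappa>\<close> it may be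
  rounded to integers at the cost of a factor 2.\<close>

lemma sum_ip_square_le:
  assumes U: "U \<subseteq> B" and V: "V \<subseteq> B" and disj: "U \<inter> V = {}" and n: "1 \<le> n"
  shows "(\<Sum>i\<in>U. (ip d (q i) (vsum V q))\<^sup>2) \<le> 9 * \<beta>\<^sup>2 * \<kappa>"
proof -
  define c where "c i = ip d (q i) (vsum V q)" for i
  define C where "C = sqrt (\<Sum>i\<in>U. (c i)\<^sup>2)"
  have C2: "C\<^sup>2 = (\<Sum>i\<in>U. (c i)\<^sup>2)" unfolding C_def by (simp add: sum_nonneg)
  have C0: "0 \<le> C" by (simp add: C_def sum_nonneg)
  have fin: "finite U" "finite V" using U V finite_B finite_subset by auto
  show ?thesis
  proof (cases "C = 0")
    case True
    then have "(\<Sum>i\<in>U. (ip d (q i) (vsum V q))\<^sup>2) = 0" using C2 by (simp add: c_def)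
    then show ?thesis using \<kappa>_nonneg by simp
  next
    case False
    then have C: "0 < C" using C0 by simp
    have "U \<noteq> {}" using False by (auto simp: C_def)
    then have "1 \<le> card U" using fin by (simp add: card_gt_0_iff Suc_le_eq)
    then have k: "1 \<le> \<kappa>" using card_V[OF U] by linarith
    define s where "s = C / (2 * sqrt \<kappa>)"
    have s: "0 < s" using C k by (simp add: s_def)
    have ci: "\<bar>c i\<bar> \<le> C" if "i \<in> U" for i
    proof -
      have "(c i)\<^sup>2 \<le> (\<Sum>i\<in>U. (c i)\<^sup>2)" using fin that by (intro member_le_sum) auto
      then show ?thesis using C0 by (simp add: C2[symmetric] abs_le_square_iff[symmetric])
    qed
    \<comment> \<open>Rounding towards zero does not increase absolute values, so the bounds
      \<open>vn\<close> and \<open>W\<close> survive the rounding.\<close>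
    define v where "v i = (if c i \<ge> 0 then \<lfloor>c i / s\<rfloor> else \<lceil>c i / s\<rceil>)" for i
    have v1: "\<bar>real_of_int (v i)\<bar> \<le> \<bar>c i / s\<bar>" and v2: "\<bar>c i / s - real_of_int (v i)\<bar> \<le> 1" for i
    proof -
      show "\<bar>c i / s - real_of_int (v i)\<bar> \<le> 1" unfolding v_def by (auto simp: abs_le_iff) linarith+
      show "\<bar>real_of_int (v i)\<bar> \<le> \<bar>c i / s\<bar>"
      proof (cases "0 \<le> c i")
        case True
        then have x: "0 \<le> c i / s" using s by simp
        then have "0 \<le> real_of_int \<lfloor>c i / s\<rfloor>" by simp
        then show ?thesis using True x of_int_floor_le[of "c i / s"] by (simp only: v_def abs_of_nonneg if_True)
      next
        case False
        then have x: "c i / s \<le> 0" using s by (simp add: divide_nonpos_pos)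
        then have "real_of_int \<lceil>c i / s\<rceil> \<le> 0" by (simp add: ceiling_le_iff)
        then show ?thesis using False x le_of_int_ceiling[of "c i / s"] by (simp only: v_def abs_of_nonpos if_False neg_le_iff_le)
      qed
    qed
    have sk: "sqrt \<kappa> \<le> n"
    proof -
      have "sqrt \<kappa> \<le> \<kappa>" using k by (simp add: real_le_lsqrt power2_eq_square)
      then show ?thesis using \<kappa>_le by simp
    qed
    have vn: "\<bar>v i\<bar> \<le> 2 * int n" if "i \<in> U" for i
    proof -
      have "\<bar>c i / s\<bar> \<le> C / s" using ci[OF that] s by (simp add: abs_divide divide_right_mono)
      also have "\<dots> = 2 * sqrt \<kappa>" using C k by (simp add: s_def)
      finally have "\<bar>real_of_int (v i)\<bar> \<le> 2 * real n" using v1[of i] sk by simp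
      then have "real_of_int \<bar>v i\<bar> \<le> real_of_int (2 * int n)" by simp
      then show ?thesis by (simp only: of_int_le_iff)
    qed
    have W: "(\<Sum>i\<in>U. (real_of_int (v i))\<^sup>2) \<le> 4 * \<kappa>"
    proof -
      have "(\<Sum>i\<in>U. (real_of_int (v i))\<^sup>2) \<le> (\<Sum>i\<in>U. (c i / s)\<^sup>2)"
        by (intro sum_mono) (rule abs_le_square_iff[THEN iffD1, OF v1])
      also have "\<dots> = C\<^sup>2 / s\<^sup>2" unfolding C2 by (simp add: power_divide sum_divide_distrib)
      also have "\<dots> = 4 * \<kappa>" using C k by (simp add: s_def power_divide power_mult_distrib)
      finally show ?thesis .
    qed
    have "2 * \<bar>ip d (comb U (\<lambda>i. real_of_int (v i)) q) (vsum V q)\<bar> \<le> \<Lambda> * dev d (card (U \<union> V)) * ((\<Sum>i\<in>U. (real_of_int (v i))\<^sup>2) + card V)"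
      by (rule ip_comb_vsum_le[OF U V disj vn n])
    also have "\<dots> \<le> \<beta> * (4 * \<kappa> + \<kappa>)"
      using U V W by (intro mult_mono dev_\<beta> add_mono card_V \<beta>_nonneg) (auto intro!: add_nonneg_nonneg sum_nonneg)
    finally have X: "(\<Sum>i\<in>U. real_of_int (v i) * c i) \<le> 5/2 * \<beta> * \<kappa>"
      unfolding ip_comb_left c_def by (simp add: abs_le_iff)
    have "C\<^sup>2 = (\<Sum>i\<in>U. s * (real_of_int (v i) * c i) + s * ((c i / s - real_of_int (v i)) * c i))"
      unfolding C2 using s by (intro sum.cong refl) (simp add: power2_eq_square field_simps)
    also have "\<dots> = s * (\<Sum>i\<in>U. real_of_int (v i) * c i) + s * (\<Sum>i\<in>U. (c i / s - real_of_int (v i)) * c i)"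
      by (simp add: sum.distrib sum_distrib_left)
    also have "(\<Sum>i\<in>U. (c i / s - real_of_int (v i)) * c i) \<le> sqrt \<kappa> * C"
    proof -
      have "(\<Sum>i\<in>U. (c i / s - real_of_int (v i)) * c i) \<le> (\<Sum>i\<in>U. \<bar>c i\<bar>)"
      proof (rule sum_mono)
        fix i
        have "(c i / s - real_of_int (v i)) * c i \<le> \<bar>c i / s - real_of_int (v i)\<bar> * \<bar>c i\<bar>"
          by (simp only: abs_mult[symmetric] abs_ge_self)
        also have "\<dots> \<le> 1 * \<bar>c i\<bar>" by (intro mult_right_mono v2) auto
        finally show "(c i / s - real_of_int (v i)) * c i \<le> \<bar>c i\<bar>" by simp
      qed
      also have "\<dots> \<le> L2_set (\<lambda>_. 1) U * L2_set c U"
        using L2_set_mult_ineq[of "\<lambda>_. 1" c U] by simp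
      also have "\<dots> = sqrt (card U) * C" by (simp add: L2_set_def C_def)
      also have "\<dots> \<le> sqrt \<kappa> * C" using card_V[OF U] C0 by (intro mult_right_mono) auto
      finally show ?thesis .
    qed
    also have "(\<Sum>i\<in>U. real_of_int (v i) * c i) \<le> 5/2 * \<beta> * \<kappa>" by (rule X)
    finally have "C\<^sup>2 \<le> s * (5/2 * \<beta> * \<kappa>) + s * (sqrt \<kappa> * C)" using s by simp
    \<comment> \<open>The scale \<open>s\<close> was chosen to make the rounding error exactly half
      of the left-hand side, into which it is absorbed.\<close>
    also have "s * (sqrt \<kappa> * C) = C\<^sup>2 / 2" using k by (simp add: s_def power2_eq_square)
    also have "s * (5/2 * \<beta> * \<kappa>) = C * (5/4 * \<beta> * sqrt \<kappa>)"
    proof -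
      have "C / (2 * r) * (5/2 * \<beta> * (r * r)) = C * (5/4 * \<beta> * r)" if "0 < r" for r
        using that by (simp add: field_simps)
      from this[of "sqrt \<kappa>"] k show ?thesis by (simp add: s_def)
    qed
    finally have "C * C \<le> C * (5/2 * \<beta> * sqrt \<kappa>)" by (simp add: power2_eq_square algebra_simps)
    then have "C \<le> 5/2 * \<beta> * sqrt \<kappa>" using C by simp
    then have "C\<^sup>2 \<le> (5/2 * \<beta> * sqrt \<kappa>)\<^sup>2" using C0 by (intro power_mono) auto
    also have "\<dots> = 25/4 * \<beta>\<^sup>2 * \<kappa>" using k by (simp add: power_mult_distrib power_divide)
    also have "\<dots> \<le> 9 * \<beta>\<^sup>2 * \<kappa>" using k by (intro mult_right_mono) auto
    finally show ?thesis unfolding C2 c_def .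
  qed
qed

end

section \<open>The two statistics\<close>

lemma abs_le_of_square: "(x::real)\<^sup>2 \<le> y\<^sup>2 \<Longrightarrow> 0 \<le> y \<Longrightarrow> \<bar>x\<bar> \<le> y"
  by (simp add: power2_le_iff_abs_le)

lemma nsq_add3_le: "nsq d (\<lambda>j. x j + y j + z j) \<le> 3 * (nsq d x + nsq d y + nsq d z)"
proof -
  have "(a + b + c)\<^sup>2 \<le> 3 * (a\<^sup>2 + b\<^sup>2 + c\<^sup>2)" for a b c :: real
  proof -
    have "0 \<le> (a - b)\<^sup>2 + (b - c)\<^sup>2 + (a - c)\<^sup>2" by simp
    then show ?thesis by (simp add: power2_eq_square algebra_simps)
  qed
  then have "(\<Sum>j<d. (x j + y j + z j)\<^sup>2) \<le> (\<Sum>j<d. 3 * ((x j)\<^sup>2 + (y j)\<^sup>2 + (z j)\<^sup>2))" by (intro sum_mono)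
  also have "\<dots> = 3 * (nsq d x + nsq d y + nsq d z)"
    by (simp add: nsq_eq_sum sum_distrib_left[symmetric] sum.distrib)
  finally show ?thesis by (simp add: nsq_eq_sum)
qed

text \<open>The situation once the first clones are frozen: \<open>A a\<close> and
  \<open>Bp a\<close> are the kept uncorrupted and corrupted rows of group \<open>a\<close>, and
  \<open>q\<close> holds the second clones of the corrupted ones. The argument \<open>h\<close> of
  the definitions below is the centred second clone of the uncorrupted rows.\<close>

locale split_setting = near_isometry n d B \<Lambda> \<kappa> q
  for n d :: nat and B :: "nat set" and \<Lambda> \<kappa> :: real and q :: "nat \<Rightarrow> nat \<Rightarrow> real" +
  fixes A Bp :: "nat \<Rightarrow> nat set" and \<mu> :: "nat \<Rightarrow> real"
  assumes Bp: "\<And>a. Bp a \<subseteq> B" and Bp_disj: "\<And>a b. a \<noteq> b \<Longrightarrow> Bp a \<inter> Bp b = {}"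
    and card_A: "\<And>a. a < 3 \<Longrightarrow> n / 4 \<le> card (A a)" "\<And>a. a < 3 \<Longrightarrow> card (A a) \<le> n"
    and n: "1 \<le> n"
begin

definition na :: "nat \<Rightarrow> real" where "na a = real (card (A a))"
definition z :: "nat \<Rightarrow> nat \<Rightarrow> real" where "z a = vsum (Bp a) q"
definition g :: "(nat \<Rightarrow> nat \<Rightarrow> real) \<Rightarrow> nat \<Rightarrow> nat \<Rightarrow> real" where "g h a = vsum (A a) h"
definition Y :: "(nat \<Rightarrow> nat \<Rightarrow> real) \<Rightarrow> nat \<Rightarrow> nat \<Rightarrow> real" where "Y h a j = na a * \<mu> j + g h a j + z a j"
text \<open>The operator \<open>sum of q_i q_i^T\<close> over the corrupted rows of group 0. Its
  squared Frobenius norm equals that of the Gram matrix, which is \<open>Fro\<close>.\<close>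

definition K :: "(nat \<Rightarrow> real) \<Rightarrow> nat \<Rightarrow> real" where "K x = comb (Bp 0) (\<lambda>i. ip d (q i) x) q"
definition Fro :: real where "Fro = (\<Sum>i\<in>Bp 0. \<Sum>k\<in>Bp 0. (ip d (q i) (q k))\<^sup>2)"
definition f :: "(nat \<Rightarrow> nat \<Rightarrow> real) \<Rightarrow> nat \<Rightarrow> nat \<Rightarrow> real" where "f h a b = ip d (Y h a) (Y h b)"
text \<open>Second clones have covariance twice the identity, so \<open>2 * f h 1 2\<close> per row
  is what centres the uncorrupted part.\<close>

definition Q :: "(nat \<Rightarrow> nat \<Rightarrow> real) \<Rightarrow> real" where
  "Q h = (\<Sum>i\<in>A 0. ip d (\<lambda>j. \<mu> j + h i j) (Y h 1) * ip d (\<lambda>j. \<mu> j + h i j) (Y h 2))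
     + (\<Sum>i\<in>Bp 0. ip d (q i) (Y h 1) * ip d (q i) (Y h 2)) - 2 * (na 0 + card (Bp 0)) * f h 1 2"
definition M2 :: real where "M2 = nsq d \<mu>"
definition \<zeta>2 :: real where "\<zeta>2 = (2 * d + \<beta>) * \<kappa>"
text \<open>The energy of the mean along the corrupted rows of group 0, the source of the signal in
  \<open>Q\<close>.\<close>

definition P02 :: real where "P02 = (\<Sum>i\<in>Bp 0. (ip d (q i) \<mu>)\<^sup>2)"

lemma Fro_nonneg[simp]: "0 \<le> Fro" unfolding Fro_def by (intro sum_nonneg) auto
lemma P02_nonneg[simp]: "0 \<le> P02" unfolding P02_def by (intro sum_nonneg) auto
lemma M2_nonneg[simp]: "0 \<le> M2" by (simp add: M2_def)

lemma nsq_z: "nsq d (z a) \<le> \<zeta>2"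
  unfolding z_def \<zeta>2_def by (rule nsq_vsum_le[OF Bp n])

lemma ip_z: "a \<noteq> b \<Longrightarrow> \<bar>ip d (z a) (z b)\<bar> \<le> \<beta> * \<kappa>"
  unfolding z_def by (rule ip_vsum_vsum_le[OF Bp Bp Bp_disj n])

lemma ip_K_commute: "ip d x (K y) = (\<Sum>i\<in>Bp 0. ip d (q i) x * ip d (q i) y)"
  unfolding K_def ip_comb_right by (simp add: ip_commute[of d x] mult.commute)

text \<open>The operator norm of the Gram matrix is at most its Frobenius norm.\<close>

lemma nsq_K_le: "nsq d (K x) \<le> sqrt Fro * (\<Sum>i\<in>Bp 0. (ip d (q i) x)\<^sup>2)"
proof -
  define c where "c i = ip d (q i) x" for i
  have "nsq d (K x) = (\<Sum>i\<in>Bp 0. \<Sum>k\<in>Bp 0. (c i * c k) * ip d (q k) (q i))"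
    unfolding K_def ip_comb_left ip_comb_right c_def by (simp add: sum_distrib_left mult.assoc)
  also have "\<dots> = (\<Sum>t\<in>Bp 0 \<times> Bp 0. (c (fst t) * c (snd t)) * ip d (q (snd t)) (q (fst t)))"
    by (simp add: sum.cartesian_product')
  finally have e: "nsq d (K x) = \<dots>" .
  have "(nsq d (K x))\<^sup>2 \<le> (\<Sum>t\<in>Bp 0 \<times> Bp 0. (c (fst t) * c (snd t))\<^sup>2) * (\<Sum>t\<in>Bp 0 \<times> Bp 0. (ip d (q (snd t)) (q (fst t)))\<^sup>2)"
    unfolding e by (rule Cauchy_Schwarz_ineq_sum)
  also have "(\<Sum>t\<in>Bp 0 \<times> Bp 0. (c (fst t) * c (snd t))\<^sup>2) = (\<Sum>i\<in>Bp 0. (c i)\<^sup>2)\<^sup>2"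
    unfolding power2_eq_square[of "\<Sum>i\<in>Bp 0. (c i)\<^sup>2"] sum_product
    by (simp only: sum.cartesian_product' power_mult_distrib fst_conv snd_conv)
  also have "(\<Sum>t\<in>Bp 0 \<times> Bp 0. (ip d (q (snd t)) (q (fst t)))\<^sup>2) = (sqrt Fro)\<^sup>2"
    by (simp only: sum.cartesian_product' fst_conv snd_conv real_sqrt_pow2 Fro_nonneg) (unfold Fro_def, rule sum.swap)
  also have "(\<Sum>i\<in>Bp 0. (c i)\<^sup>2)\<^sup>2 * (sqrt Fro)\<^sup>2 = (sqrt Fro * (\<Sum>i\<in>Bp 0. (c i)\<^sup>2))\<^sup>2"
    unfolding power_mult_distrib by (rule mult.commute)
  finally have "(nsq d (K x))\<^sup>2 \<le> (sqrt Fro * (\<Sum>i\<in>Bp 0. (c i)\<^sup>2))\<^sup>2" .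
  then show ?thesis unfolding c_def by (rule power2_le_imp_le) (auto intro!: mult_nonneg_nonneg sum_nonneg)
qed

lemma sum_ip_z_le: "a \<noteq> 0 \<Longrightarrow> (\<Sum>i\<in>Bp 0. (ip d (q i) (z a))\<^sup>2) \<le> 9 * \<beta>\<^sup>2 * \<kappa>"
  unfolding z_def by (rule sum_ip_square_le[OF Bp Bp Bp_disj n]) auto

lemma f_expand:
  "f h a b = na a * na b * M2 + na a * ip d \<mu> (z b) + na b * ip d \<mu> (z a)
     + (na a * ip d (g h b) \<mu> + na b * ip d (g h a) \<mu> + ip d (g h a) (g h b) + ip d (g h a) (z b) + ip d (g h b) (z a) + ip d (z a) (z b))"
proof -
  have "ip d \<mu> (g h b) = ip d (g h b) \<mu>" "ip d (z a) \<mu> = ip d \<mu> (z a)" "ip d (z a) (g h b) = ip d (g h b) (z a)"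
    by (rule ip_commute)+
  then show ?thesis unfolding f_def Y_def M2_def ip_bilinear by (simp add: algebra_simps)
qed

text \<open>Grouped as the terms will be estimated: the uncorrupted rows with their mean, their
  centred part, the surplus centring of the corrupted rows, and the corrupted part led by
  \<open>na 1 * na 2 * P02\<close>.\<close>

lemma Q_expand:
  "Q h = na 0 * (ip d \<mu> (Y h 1) * ip d \<mu> (Y h 2)) + ip d \<mu> (Y h 1) * ip d (g h 0) (Y h 2) + ip d \<mu> (Y h 2) * ip d (g h 0) (Y h 1)
     + ((\<Sum>i\<in>A 0. ip d (h i) (Y h 1) * ip d (h i) (Y h 2)) - 2 * na 0 * f h 1 2) - 2 * card (Bp 0) * f h 1 2
     + (na 1 * na 2 * P02 + na 1 * (ip d (g h 2) (K \<mu>) + (\<Sum>i\<in>Bp 0. ip d (q i) \<mu> * ip d (q i) (z 2)))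
        + na 2 * (ip d (g h 1) (K \<mu>) + (\<Sum>i\<in>Bp 0. ip d (q i) \<mu> * ip d (q i) (z 1)))
        + (ip d (g h 2) (K (g h 1)) + ip d (g h 2) (K (z 1)) + ip d (g h 1) (K (z 2)) + (\<Sum>i\<in>Bp 0. ip d (q i) (z 1) * ip d (q i) (z 2))))"
proof -
  have 1: "(\<Sum>i\<in>A 0. ip d (\<lambda>j. \<mu> j + h i j) (Y h 1) * ip d (\<lambda>j. \<mu> j + h i j) (Y h 2)) =
     na 0 * (ip d \<mu> (Y h 1) * ip d \<mu> (Y h 2)) + ip d \<mu> (Y h 1) * ip d (g h 0) (Y h 2) + ip d \<mu> (Y h 2) * ip d (g h 0) (Y h 1)
     + (\<Sum>i\<in>A 0. ip d (h i) (Y h 1) * ip d (h i) (Y h 2))"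
    unfolding g_def ip_comb_left by (simp add: ip_bilinear na_def algebra_simps sum.distrib sum_distrib_left)
  have 2: "ip d (q i) (Y h a) = na a * ip d (q i) \<mu> + ip d (q i) (g h a) + ip d (q i) (z a)" for i a
    unfolding Y_def by (simp add: ip_bilinear)
  have 3: "(\<Sum>i\<in>Bp 0. ip d (q i) (Y h 1) * ip d (q i) (Y h 2)) = na 1 * na 2 * P02 + na 1 * (ip d (g h 2) (K \<mu>) + (\<Sum>i\<in>Bp 0. ip d (q i) \<mu> * ip d (q i) (z 2)))
        + na 2 * (ip d (g h 1) (K \<mu>) + (\<Sum>i\<in>Bp 0. ip d (q i) \<mu> * ip d (q i) (z 1)))
        + (ip d (g h 2) (K (g h 1)) + ip d (g h 2) (K (z 1)) + ip d (g h 1) (K (z 2)) + (\<Sum>i\<in>Bp 0. ip d (q i) (z 1) * ip d (q i) (z 2)))"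
    unfolding 2 ip_K_commute P02_def
    by (simp add: algebra_simps sum.distrib sum_distrib_left power2_eq_square)
  show ?thesis unfolding Q_def 1 3 by (simp add: algebra_simps)
qed

text \<open>Each right-hand side may be random through other groups, and is constant once these are
  frozen. The factor 2000 is the variance 2 times the 1000 of Markov's inequality, or the choice
  \<open>t = 1000\<close> in the last clause.\<close>

definition good :: "(nat \<Rightarrow> nat \<Rightarrow> real) \<Rightarrow> bool" where
  "good h \<longleftrightarrow>
    (\<forall>a<3. (ip d (g h a) \<mu>)\<^sup>2 \<le> 2000 * real n * M2) \<and>
    (\<forall>a<3. \<forall>b<3. a \<noteq> b \<longrightarrow> (ip d (g h a) (z b))\<^sup>2 \<le> 2000 * real n * nsq d (z b)) \<and>
    (\<forall>a<3. nsq d (g h a) \<le> 2000 * real n * real d) \<and>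
    (\<forall>a<3. \<forall>b<3. a \<noteq> b \<longrightarrow> (ip d (g h a) (g h b))\<^sup>2 \<le> 2000 * real n * nsq d (g h b)) \<and>
    (\<forall>a<3. (ip d (g h a) (K \<mu>))\<^sup>2 \<le> 2000 * real n * nsq d (K \<mu>)) \<and>
    (\<forall>a<3. \<forall>b<3. (ip d (g h a) (K (z b)))\<^sup>2 \<le> 2000 * real n * nsq d (K (z b))) \<and>
    nsq d (K (g h 1)) \<le> 2000 * real n * Fro \<and>
    (ip d (g h 2) (K (g h 1)))\<^sup>2 \<le> 2000 * real n * nsq d (K (g h 1)) \<and>
    (\<forall>a\<in>{1,2}. (ip d (g h 0) (Y h a))\<^sup>2 \<le> 2000 * real n * nsq d (Y h a)) \<and>
    \<bar>(\<Sum>i\<in>A 0. ip d (h i) (Y h 1) * ip d (h i) (Y h 2)) - 2 * na 0 * f h 1 2\<bar>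
      \<le> 2000 * (sqrt n + 1) * sqrt (nsq d (Y h 1) * nsq d (Y h 2))"

end

text \<open>Here \<open>X\<close> is the order of \<open>\<langle>Y\<^sub>a, Y\<^sub>b\<rangle>\<close> and \<open>V\<close> the order of \<open>Q\<close> when \<open>\<parallel>\<mu>\<parallel> = \<alpha>\<close>.\<close>

locale split_sizes = split_setting +
  fixes \<alpha> \<epsilon> \<delta> X V :: real
  assumes \<kappa>_def: "\<kappa> = \<epsilon> * n" and \<epsilon>: "0 < \<epsilon>" "\<epsilon> \<le> 1" and \<alpha>: "0 < \<alpha>"
    and X: "X = (real n)\<^sup>2 * \<alpha>\<^sup>2" and V: "V = real n ^ 3 * \<alpha> ^ 4 / \<epsilon>"
    and \<delta>: "\<delta> = 1 / 10 ^ 15"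
    and n_sqrt_d: "n * sqrt d \<le> \<delta> * X" and \<beta>\<kappa>: "\<beta> * \<kappa> \<le> \<delta> * X"
begin

lemma \<delta>_pos: "0 < \<delta>" by (simp add: \<delta>)

lemma X_pos: "0 < X" using \<alpha> n by (simp add: X)

lemma n_le: "n \<le> \<delta> * X"
proof -
  have "real n * 1 \<le> n * sqrt d" using d by (intro mult_left_mono) auto
  then show ?thesis using n_sqrt_d by linarith
qed

lemma \<kappa>_le_n: "\<kappa> \<le> n" using \<epsilon> by (simp add: \<kappa>_def mult_left_le_one_le)

lemma nn_d_le: "(real n)\<^sup>2 * d \<le> (\<delta> * X)\<^sup>2"
proof -
  have "(n * sqrt d)\<^sup>2 \<le> (\<delta> * X)\<^sup>2" using n_sqrt_d by (intro power_mono) auto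
  then show ?thesis by (simp add: power_mult_distrib)
qed

text \<open>Uncorrupted against uncorrupted is governed by \<open>n_sqrt_d\<close>, corrupted
  against corrupted by \<open>\<beta>\<kappa>\<close>, the mixed terms by both. The shares 2000,
  100, 100 and 1 fit into 2300.\<close>

lemma noise_terms:
  assumes h: "good h" and ab: "a < 3" "b < 3" "a \<noteq> b"
  shows "\<bar>ip d (g h a) (g h b) + ip d (g h a) (z b) + ip d (g h b) (z a) + ip d (z a) (z b)\<bar> \<le> 2300 * \<delta> * X"
proof -
  have dX: "0 \<le> \<delta> * X" using \<delta>_pos X_pos by simp
  have "\<bar>ip d (g h a) (g h b)\<bar> \<le> 2000 * (\<delta> * X)"
  proof (rule abs_le_of_square)
    have "(ip d (g h a) (g h b))\<^sup>2 \<le> 2000 * real n * nsq d (g h b)" using h ab unfolding good_def by blast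
    also have "\<dots> \<le> 2000 * real n * (2000 * real n * real d)" using h ab unfolding good_def by (intro mult_left_mono) auto
    also have "\<dots> = 2000\<^sup>2 * ((real n)\<^sup>2 * d)" by (simp add: power2_eq_square)
    also have "\<dots> \<le> 2000\<^sup>2 * (\<delta> * X)\<^sup>2" by (intro mult_left_mono nn_d_le) auto
    finally show "(ip d (g h a) (g h b))\<^sup>2 \<le> (2000 * (\<delta> * X))\<^sup>2" by (simp add: power_mult_distrib)
  qed (use dX in auto)
  moreover have gz: "\<bar>ip d (g h a) (z b)\<bar> \<le> 100 * (\<delta> * X)" if ab: "a < 3" "b < 3" "a \<noteq> b" for a b
  proof (rule abs_le_of_square)
    have "(ip d (g h a) (z b))\<^sup>2 \<le> 2000 * real n * nsq d (z b)" using h ab unfolding good_def by blast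
    also have "\<dots> \<le> 2000 * real n * \<zeta>2" using nsq_z by (intro mult_left_mono) auto
    also have "\<dots> = 4000 * (real n * real d * \<kappa>) + 2000 * (n * (\<beta> * \<kappa>))" by (simp add: \<zeta>2_def algebra_simps)
    also have "n * (\<beta> * \<kappa>) \<le> (\<delta> * X) * (\<delta> * X)" using \<beta>_nonneg \<kappa>_nonneg by (intro mult_mono[OF n_le \<beta>\<kappa> dX]) auto
    also have "real n * real d * \<kappa> \<le> real n * real d * n" using \<kappa>_le_n by (intro mult_left_mono) auto
    also have "\<dots> = (real n)\<^sup>2 * d" by (simp add: power2_eq_square)
    also have "\<dots> \<le> (\<delta> * X)\<^sup>2" by (rule nn_d_le)
    finally have "(ip d (g h a) (z b))\<^sup>2 \<le> 6000 * (\<delta> * X)\<^sup>2" by (simp add: power2_eq_square algebra_simps)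
    also have "\<dots> \<le> 10000 * (\<delta> * X)\<^sup>2" by simp
    finally show "(ip d (g h a) (z b))\<^sup>2 \<le> (100 * (\<delta> * X))\<^sup>2" by (simp add: power_mult_distrib)
  qed (use dX in auto)
  moreover have "\<bar>ip d (g h a) (z b)\<bar> \<le> 100 * (\<delta> * X)" "\<bar>ip d (g h b) (z a)\<bar> \<le> 100 * (\<delta> * X)" using gz ab by auto
  moreover have "\<bar>ip d (z a) (z b)\<bar> \<le> \<delta> * X" using ip_z[OF ab(3)] \<beta>\<kappa> by linarith
  ultimately show ?thesis using dX by linarith
qed

lemma null_f:
  assumes h: "good h" and ab: "a < 3" "b < 3" "a \<noteq> b" and \<mu>: "\<And>j. \<mu> j = 0"
  shows "\<bar>f h a b\<bar> \<le> X / 200"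
proof -
  have "ip d \<mu> x = 0" "ip d x \<mu> = 0" for x by (simp_all add: ip_def \<mu>)
  then have "f h a b = ip d (g h a) (g h b) + ip d (g h a) (z b) + ip d (g h b) (z a) + ip d (z a) (z b)"
    unfolding f_expand by (simp add: M2_def)
  then have "\<bar>f h a b\<bar> \<le> 2300 * \<delta> * X" using noise_terms[OF h ab] by simp
  also have "\<dots> \<le> X / 200" using X_pos by (simp add: \<delta>)
  finally show ?thesis .
qed

lemma na_bounds: "a < 3 \<Longrightarrow> n / 4 \<le> na a" "a < 3 \<Longrightarrow> na a \<le> n"
  using card_A by (auto simp: na_def)

context
  fixes h assumes h: "good h" and alt: "\<alpha>\<^sup>2 \<le> M2"
begin

lemma X_le: "X \<le> (real n)\<^sup>2 * M2"
  unfolding X using alt by (intro mult_left_mono) auto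

lemma M2_pos: "0 < M2" using alt \<alpha> by (meson less_le_trans zero_less_power)

lemma mu_noise: assumes a: "a < 3" shows "\<bar>ip d (g h a) \<mu>\<bar> \<le> n * M2 / 1000"
proof (rule abs_le_of_square)
  have "(ip d (g h a) \<mu>)\<^sup>2 \<le> 2000 * real n * M2" using h a unfolding good_def by blast
  also have "\<dots> \<le> 2000 * (\<delta> * ((real n)\<^sup>2 * M2)) * M2"
  proof (intro mult_right_mono mult_left_mono)
    show "real n \<le> \<delta> * ((real n)\<^sup>2 * M2)" using n_le mult_left_mono[OF X_le less_imp_le[OF \<delta>_pos]] by linarith
  qed auto
  also have "\<dots> \<le> (n * M2 / 1000)\<^sup>2" by (simp add: \<delta> power2_eq_square field_simps)
  finally show "(ip d (g h a) \<mu>)\<^sup>2 \<le> (n * M2 / 1000)\<^sup>2" .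
qed (simp add: M2_def)

lemma f_error:
  assumes ab: "a < 3" "b < 3" "a \<noteq> b"
  shows "\<bar>f h a b - (na a * na b * M2 + na a * ip d \<mu> (z b) + na b * ip d \<mu> (z a))\<bar> \<le> (real n)\<^sup>2 * M2 / 200"
proof -
  have t: "\<bar>na a * ip d (g h b) \<mu>\<bar> \<le> (real n)\<^sup>2 * M2 / 1000" if "a < 3" "b < 3" for a b
  proof -
    have "\<bar>na a * ip d (g h b) \<mu>\<bar> = na a * \<bar>ip d (g h b) \<mu>\<bar>" by (simp add: abs_mult na_def)
    also have "\<dots> \<le> n * (n * M2 / 1000)" using na_bounds that mu_noise by (intro mult_mono) (auto simp: na_def)
    finally show ?thesis by (simp add: power2_eq_square)
  qed
  have "2300 * \<delta> * X \<le> X / 1000" using X_pos by (simp add: \<delta>)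
  then have "\<bar>ip d (g h a) (g h b) + ip d (g h a) (z b) + ip d (g h b) (z a) + ip d (z a) (z b)\<bar> \<le> (real n)\<^sup>2 * M2 / 1000"
    using noise_terms[OF h ab] X_le by linarith
  moreover have "0 \<le> (real n)\<^sup>2 * M2" by simp
  ultimately show ?thesis using t[of a b] t[of b a] ab unfolding f_expand by linarith
qed

text \<open>By Cauchy-Schwarz the projections of \<open>\<mu>\<close> on the corrupted sums are at
  most \<open>n * M2 / 100\<close>, too little to cancel \<open>na 0 * na 1 * M2\<close>, which is
  at least \<open>n^2 M2 / 16\<close>.\<close>

lemma large_mean_detected:
  assumes "\<zeta>2 \<le> (real n)\<^sup>2 * M2 / 10 ^ 4"
  shows "X / 200 < f h 0 1"
proof -
  have mz: "\<bar>na a * ip d \<mu> (z b)\<bar> \<le> (real n)\<^sup>2 * M2 / 100" if "a < 3" for a b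
  proof -
    have "\<bar>ip d \<mu> (z b)\<bar> \<le> n * M2 / 100"
    proof (rule abs_le_of_square)
      have "(ip d \<mu> (z b))\<^sup>2 \<le> M2 * nsq d (z b)" unfolding M2_def by (rule ip_Cauchy_Schwarz)
      also have "\<dots> \<le> M2 * ((real n)\<^sup>2 * M2 / 10 ^ 4)" using nsq_z[of b] assms by (intro mult_left_mono) auto
      finally show "(ip d \<mu> (z b))\<^sup>2 \<le> (n * M2 / 100)\<^sup>2" by (simp add: power2_eq_square field_simps)
    qed simp
    then have "na a * \<bar>ip d \<mu> (z b)\<bar> \<le> n * (n * M2 / 100)" using na_bounds that by (intro mult_mono) (auto simp: na_def)
    then show ?thesis by (simp add: abs_mult na_def power2_eq_square)
  qed
  have "(n / 4) * (n / 4) * M2 \<le> na 0 * na 1 * M2" using na_bounds by (intro mult_mono) (auto simp: na_def)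
  then have "(real n)\<^sup>2 * M2 / 16 \<le> na 0 * na 1 * M2" by (simp add: power2_eq_square)
  moreover have "0 < (real n)\<^sup>2 * M2" using M2_pos n by simp
  ultimately show ?thesis using f_error[of 0 1] mz[of 0 1] mz[of 1 0] X_le unfolding abs_le_iff by linarith
qed

end

end

section \<open>The sparse regime, in which corrupted rows can hide the mean from the pair
  statistics\<close>

locale sparse_regime = split_sizes +
  assumes \<kappa>n: "10 ^ 5 * \<kappa> \<le> n" and \<zeta>2_le: "\<zeta>2 \<le> real n * d"
    and r1: "real n * sqrt n * d \<le> \<delta> * V"
    and r2: "n * sqrt (16 * \<Lambda>\<^sup>2 * (\<kappa> * (real d)\<^sup>2 + \<kappa>\<^sup>2 * d)) \<le> \<delta> * V"
    and r3: "\<beta>\<^sup>2 * \<kappa> \<le> \<delta> * V" and r4: "\<kappa> * X \<le> \<delta> * V"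
begin

text \<open>The noise scale of the corrupted part: the first summand comes from Gaussian sums passed
  through \<open>K\<close>, the second from interactions among corrupted groups. Every term free of
  \<open>\<mu>\<close> is at most a geometric mean of these summands.\<close>

definition D :: real where "D = 2000 * n * sqrt Fro + 9 * \<beta>\<^sup>2 * \<kappa>"

lemma V_pos: "0 < V" using \<alpha> \<epsilon> n by (simp add: V)

lemma D_nonneg: "0 \<le> D" using \<kappa>_nonneg by (simp add: D_def)

lemma D_le: "D \<le> 2009 * \<delta> * V"
proof -
  have "Fro \<le> 16 * \<Lambda>\<^sup>2 * (\<kappa> * (real d)\<^sup>2 + \<kappa>\<^sup>2 * d)"
    unfolding Fro_def by (rule gram_frobenius_le[OF Bp n])
  then have "n * sqrt Fro \<le> n * sqrt (16 * \<Lambda>\<^sup>2 * (\<kappa> * (real d)\<^sup>2 + \<kappa>\<^sup>2 * d))"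
    by (intro mult_left_mono real_sqrt_le_mono) auto
  then show ?thesis using r2 r3 unfolding D_def by linarith
qed

lemma parts_le_D: "2000 * n * sqrt Fro \<le> D" "9 * \<beta>\<^sup>2 * \<kappa> \<le> D" "0 \<le> 2000 * n * sqrt Fro" "0 \<le> 9 * \<beta>\<^sup>2 * \<kappa>"
  using \<kappa>_nonneg by (auto simp: D_def)

lemma K_noise:
  assumes h: "good h" and a: "a < 3" and x: "x = \<mu> \<or> (\<exists>b. 0 < b \<and> b < 3 \<and> x = z b)"
  shows "(ip d (g h a) (K x))\<^sup>2 \<le> 2000 * n * sqrt Fro * (\<Sum>i\<in>Bp 0. (ip d (q i) x)\<^sup>2)"
proof -
  have "(ip d (g h a) (K x))\<^sup>2 \<le> 2000 * n * nsq d (K x)" using h a x unfolding good_def by auto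
  also have "\<dots> \<le> 2000 * n * (sqrt Fro * (\<Sum>i\<in>Bp 0. (ip d (q i) x)\<^sup>2))" by (intro mult_left_mono nsq_K_le) auto
  finally show ?thesis by (simp add: mult.assoc)
qed

text \<open>Both cross terms are kept proportional to \<open>sqrt P02\<close>, so that the main
  term, proportional to \<open>P02\<close>, can absorb them.\<close>

lemma mu_K_le:
  assumes h: "good h" and a: "0 < a" "a < 3"
  shows "\<bar>ip d (g h a) (K \<mu>)\<bar> \<le> sqrt D * sqrt P02" "\<bar>\<Sum>i\<in>Bp 0. ip d (q i) \<mu> * ip d (q i) (z a)\<bar> \<le> sqrt D * sqrt P02"
proof -
  show "\<bar>ip d (g h a) (K \<mu>)\<bar> \<le> sqrt D * sqrt P02"
  proof (rule abs_le_of_square)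
    have "(ip d (g h a) (K \<mu>))\<^sup>2 \<le> 2000 * n * sqrt Fro * P02" using K_noise[OF h a(2)] by (simp add: P02_def)
    also have "\<dots> \<le> D * P02" by (intro mult_right_mono parts_le_D) auto
    finally show "(ip d (g h a) (K \<mu>))\<^sup>2 \<le> (sqrt D * sqrt P02)\<^sup>2" using D_nonneg by (simp add: power_mult_distrib)
  qed (use D_nonneg in auto)
  show "\<bar>\<Sum>i\<in>Bp 0. ip d (q i) \<mu> * ip d (q i) (z a)\<bar> \<le> sqrt D * sqrt P02"
  proof (rule abs_le_of_square)
    have "(\<Sum>i\<in>Bp 0. ip d (q i) \<mu> * ip d (q i) (z a))\<^sup>2 \<le> P02 * (\<Sum>i\<in>Bp 0. (ip d (q i) (z a))\<^sup>2)"
      unfolding P02_def by (rule Cauchy_Schwarz_ineq_sum)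
    also have "\<dots> \<le> P02 * D" using sum_ip_z_le[of a] a parts_le_D by (intro mult_left_mono) auto
    finally show "(\<Sum>i\<in>Bp 0. ip d (q i) \<mu> * ip d (q i) (z a))\<^sup>2 \<le> (sqrt D * sqrt P02)\<^sup>2"
      using D_nonneg by (simp add: power_mult_distrib mult.commute)
  qed (use D_nonneg in auto)
qed

lemma bad_noise:
  assumes h: "good h"
  shows "\<bar>ip d (g h 2) (K (g h 1)) + ip d (g h 2) (K (z 1)) + ip d (g h 1) (K (z 2)) + (\<Sum>i\<in>Bp 0. ip d (q i) (z 1) * ip d (q i) (z 2))\<bar> \<le> 4 * D"
proof -
  have "\<bar>ip d (g h 2) (K (g h 1))\<bar> \<le> D"
  proof (rule abs_le_of_square)
    have "(ip d (g h 2) (K (g h 1)))\<^sup>2 \<le> 2000 * n * nsq d (K (g h 1))" using h unfolding good_def by auto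
    also have "\<dots> \<le> 2000 * n * (2000 * real n * Fro)" using h unfolding good_def by (intro mult_left_mono) auto
    also have "\<dots> = (2000 * n * sqrt Fro)\<^sup>2" by (simp add: power_mult_distrib) (simp add: power2_eq_square)
    also have "\<dots> \<le> D\<^sup>2" by (intro power_mono parts_le_D)
    finally show "(ip d (g h 2) (K (g h 1)))\<^sup>2 \<le> D\<^sup>2" .
  qed (rule D_nonneg)
  moreover have "\<bar>ip d (g h a) (K (z b))\<bar> \<le> D" if "a < 3" "0 < b" "b < 3" for a b
  proof (rule abs_le_of_square)
    have "(ip d (g h a) (K (z b)))\<^sup>2 \<le> 2000 * n * sqrt Fro * (\<Sum>i\<in>Bp 0. (ip d (q i) (z b))\<^sup>2)"
      using that by (intro K_noise[OF h]) auto
    also have "\<dots> \<le> D * D" using sum_ip_z_le[of b] that parts_le_D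
      by (intro mult_mono D_nonneg) (auto intro: sum_nonneg)
    finally show "(ip d (g h a) (K (z b)))\<^sup>2 \<le> D\<^sup>2" by (simp add: power2_eq_square)
  qed (rule D_nonneg)
  then have "\<bar>ip d (g h 2) (K (z 1))\<bar> \<le> D" "\<bar>ip d (g h 1) (K (z 2))\<bar> \<le> D" by auto
  moreover have "\<bar>\<Sum>i\<in>Bp 0. ip d (q i) (z 1) * ip d (q i) (z 2)\<bar> \<le> D"
  proof (rule abs_le_of_square)
    have "(\<Sum>i\<in>Bp 0. ip d (q i) (z 1) * ip d (q i) (z 2))\<^sup>2 \<le> (\<Sum>i\<in>Bp 0. (ip d (q i) (z 1))\<^sup>2) * (\<Sum>i\<in>Bp 0. (ip d (q i) (z 2))\<^sup>2)"
      by (rule Cauchy_Schwarz_ineq_sum)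
    also have "\<dots> \<le> D * D" using sum_ip_z_le[of 1] sum_ip_z_le[of 2] parts_le_D
      by (intro mult_mono D_nonneg) (auto intro: sum_nonneg)
    finally show "(\<Sum>i\<in>Bp 0. ip d (q i) (z 1) * ip d (q i) (z 2))\<^sup>2 \<le> D\<^sup>2" by (simp add: power2_eq_square)
  qed (rule D_nonneg)
  ultimately show ?thesis by linarith
qed

text \<open>\<open>E\<close> keeps the mean from dominating: the norm of a group sum is then that of
  Gaussian noise up to a constant.\<close>

lemma nsq_Y:
  assumes h: "good h" and E: "(real n)\<^sup>2 * M2 \<le> real n * d" and a: "a < 3"
  shows "nsq d (Y h a) \<le> 6100 * (real n * d)"
proof -
  have 1: "nsq d (\<lambda>j. na a * \<mu> j) \<le> real n * d"
  proof -
    have "nsq d (\<lambda>j. na a * \<mu> j) = (na a)\<^sup>2 * M2" by (simp add: ip_bilinear M2_def power2_eq_square)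
    also have "\<dots> \<le> (real n)\<^sup>2 * M2" using na_bounds[OF a] by (intro mult_right_mono power_mono) (auto simp: na_def)
    finally show ?thesis using E by simp
  qed
  have 2: "nsq d (g h a) \<le> 2000 * (real n * d)" using h a unfolding good_def by auto
  have 3: "nsq d (z a) \<le> real n * d" using nsq_z[of a] \<zeta>2_le by simp
  have "nsq d (Y h a) \<le> 3 * (nsq d (\<lambda>j. na a * \<mu> j) + nsq d (g h a) + nsq d (z a))"
    unfolding Y_def by (rule nsq_add3_le)
  also have "\<dots> \<le> 3 * (real n * d + 2000 * (real n * d) + real n * d)"
    by (intro mult_left_mono add_mono 1 2 3) simp
  also have "\<dots> \<le> 6100 * (real n * d)" by simp
  finally show ?thesis .
qed

text \<open>The constant is \<open>2000 * 2 * 6100\<close>, from \<open>good\<close>, from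
  \<open>sqrt n + 1 \<le> 2 * sqrt n\<close> and from \<open>nsq_Y\<close>.\<close>

lemma centered_le:
  assumes h: "good h" and E: "(real n)\<^sup>2 * M2 \<le> real n * d"
  shows "\<bar>(\<Sum>i\<in>A 0. ip d (h i) (Y h 1) * ip d (h i) (Y h 2)) - 2 * na 0 * f h 1 2\<bar> \<le> 24400000 * \<delta> * V"
proof -
  have s: "sqrt (nsq d (Y h 1) * nsq d (Y h 2)) \<le> 6100 * (real n * d)"
  proof (rule real_le_lsqrt)
    show "nsq d (Y h 1) * nsq d (Y h 2) \<le> (6100 * (real n * d))\<^sup>2"
      unfolding power2_eq_square using nsq_Y[OF h E] by (intro mult_mono) auto
  qed auto
  have "\<bar>(\<Sum>i\<in>A 0. ip d (h i) (Y h 1) * ip d (h i) (Y h 2)) - 2 * na 0 * f h 1 2\<bar> \<le> 2000 * (sqrt n + 1) * sqrt (nsq d (Y h 1) * nsq d (Y h 2))"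
    using h unfolding good_def by blast
  also have "\<dots> \<le> 2000 * (sqrt n + sqrt n) * (6100 * (real n * d))"
    using n s by (intro mult_mono) auto
  also have "\<dots> = 24400000 * (real n * sqrt n * d)" by simp
  also have "\<dots> \<le> 24400000 * (\<delta> * V)" using r1 by linarith
  finally show ?thesis by simp
qed

text \<open>The centring of \<open>Q\<close> is misplaced on corrupted rows, but after a passed pair
  test it is small, as there are at most \<open>\<kappa>\<close> of them.\<close>

lemma card_Bp_f:
  assumes "\<bar>f h 1 2\<bar> \<le> X / 200"
  shows "\<bar>2 * card (Bp 0) * f h 1 2\<bar> \<le> \<delta> * V"
proof -
  have "\<bar>2 * card (Bp 0) * f h 1 2\<bar> = 2 * card (Bp 0) * \<bar>f h 1 2\<bar>" by (simp add: abs_mult)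
  also have "\<dots> \<le> 2 * \<kappa> * (X / 200)" using assms card_V[OF Bp, of 0] by (intro mult_mono) auto
  also have "\<dots> \<le> \<kappa> * X" using \<kappa>_nonneg X_pos by simp
  finally show ?thesis using r4 by simp
qed

lemma null_Q:
  assumes h: "good h" and \<mu>: "\<And>j. \<mu> j = 0"
  shows "Q h \<le> V / 10 ^ 5"
proof -
  have z: "ip d \<mu> x = 0" "ip d x \<mu> = 0" for x by (simp_all add: ip_def \<mu>)
  have M2: "M2 = 0" and P: "P02 = 0" by (simp_all add: M2_def P02_def z)
  have f: "\<bar>f h 1 2\<bar> \<le> X / 200" by (rule null_f[OF h]) (auto simp: \<mu>)
  have "ip d (g h a) (K \<mu>) = 0" for a by (simp add: ip_K_commute z)
  then have "Q h = ((\<Sum>i\<in>A 0. ip d (h i) (Y h 1) * ip d (h i) (Y h 2)) - 2 * na 0 * f h 1 2) - 2 * card (Bp 0) * f h 1 2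
     + (ip d (g h 2) (K (g h 1)) + ip d (g h 2) (K (z 1)) + ip d (g h 1) (K (z 2)) + (\<Sum>i\<in>Bp 0. ip d (q i) (z 1) * ip d (q i) (z 2)))"
    unfolding Q_expand by (simp add: z P)
  moreover have "(real n)\<^sup>2 * M2 \<le> real n * d" by (simp add: M2)
  ultimately have "Q h \<le> 24400000 * \<delta> * V + \<delta> * V + 4 * D"
    using centered_le[OF h] card_Bp_f[OF f] bad_noise[OF h] unfolding abs_le_iff by linarith
  also have "\<dots> \<le> V / 10 ^ 5" using D_le V_pos by (simp add: \<delta>)
  finally show ?thesis .
qed

text \<open>The corruption must align with \<open>-\<mu>\<close> to pass the pair tests, and
  \<open>Q\<close> is quadratic in this alignment, so the evasion itself becomes visible. Half of
  the main term pays for the cross terms.\<close>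

lemma moderate_mean_detected:
  assumes h: "good h" and alt: "\<alpha>\<^sup>2 \<le> M2" and small: "(real n)\<^sup>2 * M2 / 10 ^ 4 < \<zeta>2"
    and f: "\<bar>f h 0 1\<bar> \<le> X / 200" "\<bar>f h 0 2\<bar> \<le> X / 200" "\<bar>f h 1 2\<bar> \<le> X / 200"
  shows "V / 10 ^ 5 < Q h"
proof -
  note M2p = M2_pos[OF h alt] and Xl = X_le[OF h alt]
  define E where "E = (real n)\<^sup>2 * M2"
  have E0: "0 < E" using M2p n by (simp add: E_def)
  \<comment> \<open>\<open>\<zeta>2\<close> is of order \<open>d * \<kappa>\<close> up to a term
    that \<open>\<beta>\<kappa>\<close> makes negligible, and \<open>\<kappa>n\<close> turns
    \<open>d * \<kappa>\<close> into a small part of \<open>n * d\<close>.\<close>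
  have End: "E \<le> real n * d"
  proof -
    have "E < 10 ^ 4 * \<zeta>2" using small by (simp add: E_def)
    also have "\<dots> = 20000 * (d * \<kappa>) + 10000 * (\<beta> * \<kappa>)" by (simp add: \<zeta>2_def algebra_simps)
    finally have "E < 20000 * (d * \<kappa>) + 10000 * (\<delta> * E)"
      using \<beta>\<kappa> mult_left_mono[OF Xl less_imp_le[OF \<delta>_pos]] unfolding E_def by linarith
    moreover have "d * (10 ^ 5 * \<kappa>) \<le> d * real n" using \<kappa>n by (intro mult_left_mono) auto
    ultimately show ?thesis using E0 by (simp add: \<delta> algebra_simps)
  qed
  define r where "r a = ip d \<mu> (z a) / na a" for a
  have na: "0 < na a" "n / 4 \<le> na a" "na a \<le> n" if "a < 3" for a using na_bounds[OF that] n by linarith+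
  have rz: "ip d \<mu> (z a) = na a * r a" if "a < 3" for a using na(1)[OF that] by (simp add: r_def)
  \<comment> \<open>Threshold and noise contribute \<open>E / 200\<close> each; dividing by
    \<open>na a * na b\<close>, at least \<open>(n / 4)^2\<close>, turns \<open>E / 100\<close> into
    16/100 of \<open>M2\<close>.\<close>
  have pair: "\<bar>M2 + r a + r b\<bar> \<le> 4/25 * M2" if ab: "a < 3" "b < 3" "a \<noteq> b" and fab: "\<bar>f h a b\<bar> \<le> X / 200" for a b
  proof -
    have "\<bar>f h a b - na a * na b * (M2 + r a + r b)\<bar> \<le> E / 200"
      using f_error[OF h alt ab] ab unfolding E_def by (simp add: rz algebra_simps)
    then have "\<bar>na a * na b * (M2 + r a + r b)\<bar> \<le> E / 100" using fab Xl unfolding E_def by linarith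
    then have "na a * na b * \<bar>M2 + r a + r b\<bar> \<le> E / 100"
      using na(1)[OF ab(1)] na(1)[OF ab(2)] by (simp add: abs_mult)
    moreover have "(n / 4) * (n / 4) * \<bar>M2 + r a + r b\<bar> \<le> na a * na b * \<bar>M2 + r a + r b\<bar>"
      using na[OF ab(1)] na[OF ab(2)] by (intro mult_right_mono mult_mono) auto
    ultimately have "(n / 4) * (n / 4) * \<bar>M2 + r a + r b\<bar> \<le> (n / 4) * (n / 4) * (4/25 * M2)"
      by (simp add: E_def power2_eq_square)
    then show ?thesis using n by (subst (asm) mult_le_cancel_left_pos) auto
  qed
  have r01: "\<bar>M2 + r 0 + r 1\<bar> \<le> 4/25 * M2" and r02: "\<bar>M2 + r 0 + r 2\<bar> \<le> 4/25 * M2" and r12: "\<bar>M2 + r 1 + r 2\<bar> \<le> 4/25 * M2"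
    using pair f by auto
  \<comment> \<open>Three pair sums determine each \<open>r a\<close>, for instance
    \<open>2 r 0 = (r 0 + r 1) + (r 0 + r 2) - (r 1 + r 2)\<close>; two groups would fix only one
    sum. The error is 3/2 of 4/25, that is 24/100, around \<open>- M2 / 2\<close>.\<close>
  have rb: "r 0 \<le> - 26/100 * M2" "- 74/100 * M2 \<le> r 1" "r 1 \<le> 0" "- 74/100 * M2 \<le> r 2" "r 2 \<le> 0"
    using r01 r02 r12 M2p unfolding abs_le_iff by linarith+
  \<comment> \<open>The corruption cancels only about half of the projection on
    \<open>\<mu>\<close>, so its sign survives, and the product of two such projections in
    \<open>Q\<close> can only help.\<close>
  have p: "0 \<le> ip d \<mu> (Y h a) \<and> ip d \<mu> (Y h a) \<le> 2 * (n * M2)" if a: "a < 3" and r: "- 74/100 * M2 \<le> r a" "r a \<le> 0" for a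
  proof -
    have e: "ip d \<mu> (Y h a) = na a * (M2 + r a) + ip d (g h a) \<mu>"
      unfolding Y_def ip_bilinear rz[OF a] M2_def ip_commute[of d \<mu> "g h a"] by (simp add: algebra_simps)
    have "(n / 4) * (26/100 * M2) \<le> na a * (M2 + r a)" using na[OF a] r M2p by (intro mult_mono) auto
    moreover have "na a * (M2 + r a) \<le> n * M2" using na[OF a] r M2p by (intro mult_mono) auto
    moreover have "0 < n * M2" using M2p n by simp
    ultimately show ?thesis using mu_noise[OF h alt a] unfolding e abs_le_iff by (simp add: field_simps)
  qed
  have p1: "0 \<le> ip d \<mu> (Y h 1)" "ip d \<mu> (Y h 1) \<le> 2 * (n * M2)" and p2: "0 \<le> ip d \<mu> (Y h 2)" "ip d \<mu> (Y h 2) \<le> 2 * (n * M2)"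
    using p[of 1] p[of 2] rb by auto
  \<comment> \<open>\<open>V\<close> with \<open>M2\<close> in place of \<open>\<alpha>^2\<close>:
    the signal for the actual mean.\<close>
  define VM where "VM = real n ^ 3 * M2\<^sup>2 / \<epsilon>"
  have VM: "V \<le> VM"
  proof -
    have "(\<alpha>\<^sup>2)\<^sup>2 \<le> M2\<^sup>2" using alt by (intro power_mono) auto
    then show ?thesis unfolding V VM_def using \<epsilon> by (intro divide_right_mono mult_left_mono) (auto simp: power_mult[symmetric])
  qed
  have cross: "\<bar>ip d \<mu> (Y h a) * ip d (g h 0) (Y h b)\<bar> \<le> 7000 * \<delta> * VM" if a: "a = 1 \<or> a = 2" and b: "b = 1 \<or> b = 2" for a b
  proof -
    have "\<bar>ip d (g h 0) (Y h b)\<bar> \<le> 3500 * (\<delta> * X)"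
    proof (rule abs_le_of_square)
      have "(ip d (g h 0) (Y h b))\<^sup>2 \<le> 2000 * n * nsq d (Y h b)" using h b unfolding good_def by auto
      also have "\<dots> \<le> 2000 * n * (6100 * (real n * d))"
        using nsq_Y[OF h, of b] End b unfolding E_def by (intro mult_left_mono) auto
      also have "\<dots> = 12200000 * ((real n)\<^sup>2 * d)" by (simp add: power2_eq_square)
      also have "\<dots> \<le> 12250000 * (\<delta> * X)\<^sup>2" using nn_d_le by (intro mult_mono) auto
      finally show "(ip d (g h 0) (Y h b))\<^sup>2 \<le> (3500 * (\<delta> * X))\<^sup>2" by (simp add: power_mult_distrib)
    qed (use \<delta>_pos X_pos in auto)
    then have "\<bar>ip d \<mu> (Y h a)\<bar> * \<bar>ip d (g h 0) (Y h b)\<bar> \<le> (2 * (n * M2)) * (3500 * (\<delta> * X))"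
      using p1 p2 a by (intro mult_mono) auto
    also have "\<dots> \<le> (2 * (n * M2)) * (3500 * (\<delta> * ((real n)\<^sup>2 * M2)))"
      using Xl \<delta>_pos by (intro mult_left_mono) auto
    also have "\<dots> = 7000 * \<delta> * (real n ^ 3 * M2\<^sup>2)" by (simp add: power2_eq_square power3_eq_cube)
    also have "\<dots> \<le> 7000 * \<delta> * VM" unfolding VM_def using \<epsilon> \<delta>_pos
      by (intro mult_left_mono) (auto simp: le_divide_eq mult_left_le)
    finally show ?thesis by (simp add: abs_mult)
  qed
  \<comment> \<open>Cauchy-Schwarz over at most \<open>\<kappa>\<close> rows: a prescribed sum of
    projections needs energy at least its square over \<open>\<kappa>\<close>. This is where the
    factor \<open>1 / \<epsilon>\<close> of \<open>V\<close> arises.\<close>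
  have P: "VM / 250 \<le> (real n)\<^sup>2 * P02"
  proof -
    have "(n / 4) * (26/100 * M2) \<le> na 0 * (- r 0)" using na[of 0] rb M2p by (intro mult_mono) auto
    then have "(n / 4) * (26/100 * M2) \<le> - ip d \<mu> (z 0)" using rz[of 0] by simp
    then have "((n / 4) * (26/100 * M2))\<^sup>2 \<le> (- ip d \<mu> (z 0))\<^sup>2" using M2p by (intro power_mono) auto
    also have "(- ip d \<mu> (z 0))\<^sup>2 = (\<Sum>i\<in>Bp 0. 1 * ip d (q i) \<mu>)\<^sup>2"
      by (simp add: z_def ip_comb_right ip_commute[of d \<mu>])
    also have "\<dots> \<le> (\<Sum>i\<in>Bp 0. 1\<^sup>2) * (\<Sum>i\<in>Bp 0. (ip d (q i) \<mu>)\<^sup>2)" by (rule Cauchy_Schwarz_ineq_sum)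
    also have "\<dots> \<le> \<kappa> * P02" unfolding P02_def[symmetric] using card_V[OF Bp, of 0] by (intro mult_right_mono) auto
    finally have "((n / 4) * (26/100 * M2))\<^sup>2 \<le> \<epsilon> * n * P02" unfolding \<kappa>_def .
    moreover have "((n / 4) * (26/100 * M2))\<^sup>2 = 169/40000 * ((real n)\<^sup>2 * M2\<^sup>2)" by (simp add: power2_eq_square)
    moreover have "0 \<le> (real n)\<^sup>2 * M2\<^sup>2" by simp
    ultimately have "(real n)\<^sup>2 * M2\<^sup>2 / 250 \<le> \<epsilon> * n * P02" by linarith
    then have "(real n)\<^sup>2 * M2\<^sup>2 / 250 * n \<le> \<epsilon> * n * P02 * n" by (rule mult_right_mono) simp
    then show ?thesis unfolding VM_def using \<epsilon> by (simp add: field_simps power2_eq_square power3_eq_cube)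
  qed
  define P where "P = sqrt P02"
  have P2: "P\<^sup>2 = P02" by (simp add: P_def)
  have P0: "0 \<le> P" by (simp add: P_def)
  have sD: "(sqrt D)\<^sup>2 = D" using D_nonneg by simp
  have c1: "\<bar>na a * (ip d (g h b) (K \<mu>) + (\<Sum>i\<in>Bp 0. ip d (q i) \<mu> * ip d (q i) (z b)))\<bar> \<le> 2 * (n * P * sqrt D)" if ab: "a < 3" "0 < b" "b < 3" for a b
  proof -
    have "\<bar>ip d (g h b) (K \<mu>) + (\<Sum>i\<in>Bp 0. ip d (q i) \<mu> * ip d (q i) (z b))\<bar> \<le> 2 * (sqrt D * P)"
      using mu_K_le[OF h ab(2,3)] unfolding P_def by linarith
    then have "na a * \<bar>ip d (g h b) (K \<mu>) + (\<Sum>i\<in>Bp 0. ip d (q i) \<mu> * ip d (q i) (z b))\<bar> \<le> n * (2 * (sqrt D * P))"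
      using na[OF ab(1)] by (intro mult_mono) auto
    then show ?thesis unfolding abs_mult abs_of_pos[OF na(1)[OF ab(1)]] by (simp add: mult_ac)
  qed
  \<comment> \<open>Weighted so that the cross terms, \<open>4 * (n * P * sqrt D)\<close> in all,
    take half of the main term \<open>n^2 P02 / 16\<close>.\<close>
  have amgm: "4 * (n * P * sqrt D) \<le> (real n)\<^sup>2 * P02 / 32 + 128 * D"
  proof -
    have "0 \<le> (n * P - 64 * sqrt D)\<^sup>2" by simp
    also have "\<dots> = (real n)\<^sup>2 * P02 - 128 * (n * P * sqrt D) + 4096 * D"
      by (simp add: power2_diff power_mult_distrib P2 sD)
    finally show ?thesis by simp
  qed
  have main: "(real n)\<^sup>2 * P02 / 16 \<le> na 1 * na 2 * P02"
  proof -
    have "(n / 4) * (n / 4) * P02 \<le> na 1 * na 2 * P02" using na[of 1] na[of 2] by (intro mult_right_mono mult_mono) auto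
    then show ?thesis by (simp add: power2_eq_square)
  qed
  have pp: "0 \<le> na 0 * (ip d \<mu> (Y h 1) * ip d \<mu> (Y h 2))" using p1 p2 na[of 0] by simp
  have dv: "\<delta> * V \<le> \<delta> * VM" using VM \<delta>_pos by simp
  \<comment> \<open>The remaining half of the main term is at least \<open>VM / 8000\<close>. The
    losses are 14000 from two cross terms, 24400000 from \<open>centered_le\<close>, 1 from
    \<open>card_Bp_f\<close>, and \<open>132 * D\<close> from \<open>amgm\<close> and
    \<open>bad_noise\<close>, with \<open>D\<close> at most
    \<open>2009 * \<delta> * V\<close>.\<close>
  have lower: "VM / 8000 - (14000 + 24400000 + 1 + 132 * 2009) * (\<delta> * VM) \<le> Q h"
  proof -
    have n3: "(1::nat) < 3" "(2::nat) < 3" "(0::nat) < 1" "(0::nat) < 2" by simp_all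
    have "\<bar>ip d \<mu> (Y h 1) * ip d (g h 0) (Y h 2)\<bar> \<le> 7000 * \<delta> * VM" "\<bar>ip d \<mu> (Y h 2) * ip d (g h 0) (Y h 1)\<bar> \<le> 7000 * \<delta> * VM"
      by (intro cross; blast)+
    note x = this[THEN abs_le_D2] centered_le[OF h End[unfolded E_def], THEN abs_le_D2] card_Bp_f[OF f(3), THEN abs_le_D1]
      c1[OF n3(1) n3(4) n3(2), THEN abs_le_D2] c1[OF n3(2) n3(3) n3(1), THEN abs_le_D2] bad_noise[OF h, THEN abs_le_D2]
    have "D \<le> 2009 * (\<delta> * V)" "\<delta> * V \<le> \<delta> * VM" using D_le dv by simp_all
    \<comment> \<open>The bookkeeping over fresh reals: \<open>e\<close> stands for
      \<open>\<delta> * VM\<close>, \<open>e'\<close> for \<open>\<delta> * V\<close>,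
      \<open>s\<close> for \<open>n * P * sqrt D\<close> and \<open>p\<close> for
      \<open>n^2 P02\<close>.\<close>
    moreover have "VM / 8000 - (14000 + 24400000 + 1 + 132 * 2009) * e \<le> t0 + t1 + t2 + t3 - t4 + (t5 + t6 + t7 + t8)"
      if "- t1 \<le> 7000 * e" "- t2 \<le> 7000 * e" "- t3 \<le> 24400000 * e'" "t4 \<le> e'" "- t6 \<le> 2 * s" "- t7 \<le> 2 * s" "- t8 \<le> 4 * D"
        "0 \<le> t0" "p / 16 \<le> t5" "4 * s \<le> p / 32 + 128 * D" "VM / 250 \<le> p" "D \<le> 2009 * e'" "e' \<le> e" for t0 t1 t2 t3 t4 t5 t6 t7 t8 e e' s p :: real
    proof -
      have "p / 32 - 132 * D \<le> t5 + t6 + t7 + t8" using that by linarith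
      moreover have "D \<le> 2009 * e" using that by linarith
      moreover have "- t3 \<le> 24400000 * e" "t4 \<le> e" using that by linarith+
      moreover have "VM / 8000 \<le> p / 32" using that by linarith
      ultimately show ?thesis using that(1,2,8) by simp
    qed
    ultimately show ?thesis using x pp main amgm P unfolding Q_expand mult.assoc[of _ \<delta>] by blast
  qed
  have "V / 10 ^ 5 \<le> VM / 10 ^ 5" using VM by simp
  also have "\<dots> < VM / 8000 - (14000 + 24400000 + 1 + 132 * 2009) * (\<delta> * VM)"
    using VM V_pos by (simp add: \<delta>)
  also note lower
  finally show ?thesis .
qed

end

section \<open>Noise of the uncorrupted samples\<close>

context prob_space begin

text \<open>It is the failure of \<open>P\<close> that is rare. Measurability is included so that
  failure probabilities can be added.\<close>

definition rare :: "real \<Rightarrow> ('a \<Rightarrow> bool) \<Rightarrow> bool" where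
  "rare c P \<longleftrightarrow> {\<omega>\<in>space M. \<not> P \<omega>} \<in> events \<and> prob {\<omega>\<in>space M. \<not> P \<omega>} \<le> c"

lemma rare_conj:
  assumes "rare c P" "rare c' P'"
  shows "rare (c + c') (\<lambda>\<omega>. P \<omega> \<and> P' \<omega>)"
proof -
  have e: "{\<omega>\<in>space M. \<not> (P \<omega> \<and> P' \<omega>)} = {\<omega>\<in>space M. \<not> P \<omega>} \<union> {\<omega>\<in>space M. \<not> P' \<omega>}" by auto
  show ?thesis unfolding rare_def e using assms measure_Un_le[of "{\<omega>\<in>space M. \<not> P \<omega>}" M "{\<omega>\<in>space M. \<not> P' \<omega>}"]
    by (auto simp: rare_def)
qed

lemma rare_all:
  assumes "\<And>a. a < k \<Longrightarrow> rare c (P a)"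
  shows "rare (real k * c) (\<lambda>\<omega>. \<forall>a<k. P a \<omega>)"
  using assms
proof (induction k)
  case 0 then show ?case by (simp add: rare_def)
next
  case (Suc k)
  then have "rare (real k * c + c) (\<lambda>\<omega>. (\<forall>a<k. P a \<omega>) \<and> P k \<omega>)" by (intro rare_conj) auto
  then show ?case by (simp add: less_Suc_eq all_conj_distrib algebra_simps)
qed

lemma rare_imp: "0 \<le> c \<Longrightarrow> (b \<Longrightarrow> rare c P) \<Longrightarrow> rare c (\<lambda>\<omega>. b \<longrightarrow> P \<omega>)"
  by (cases b) (auto simp: rare_def)

end

locale clean_noise = split_setting n d B \<Lambda> \<kappa> q A Bp \<mu> + field_sd \<sigma>
  for n d B \<Lambda> \<kappa> q A Bp \<mu> \<sigma> +
  assumes A: "\<And>a. A a \<subseteq> {..<n}" and A_disj: "\<And>a b. a \<noteq> b \<Longrightarrow> A a \<inter> A b = {}"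
    and \<sigma>2: "\<And>a i. i \<in> A a \<Longrightarrow> \<sigma> i = sqrt 2"
begin

abbreviation "F \<equiv> gauss_field {..<n} d (\<lambda>_. \<mu>) \<sigma>"
abbreviation "cent m \<equiv> (\<lambda>i j. m i j - \<mu> j)"

sublocale prob_space F by (rule prob_field)

lemma measurable_g: "j < d \<Longrightarrow> (\<lambda>m. g (cent m) a j) \<in> borel_measurable F"
  unfolding g_def by (intro measurable_comb borel_measurable_diff measurable_field_component) (use A in auto)

lemma measurable_Y: "j < d \<Longrightarrow> (\<lambda>m. Y (cent m) a j) \<in> borel_measurable F"
  unfolding Y_def by (intro borel_measurable_add measurable_g borel_measurable_const)

lemma measurable_K: "(\<And>j. j < d \<Longrightarrow> (\<lambda>m. x m j) \<in> borel_measurable F) \<Longrightarrow> j < d \<Longrightarrow> (\<lambda>m. K (x m) j) \<in> borel_measurable F"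
  unfolding K_def comb_def by (intro borel_measurable_sum borel_measurable_times measurable_ip borel_measurable_const) auto

lemma g_dep: "(\<And>i. i \<in> {..<n} - A a \<Longrightarrow> m i = m' i) \<Longrightarrow> a \<noteq> b \<Longrightarrow> g (cent m) b = g (cent m') b"
  unfolding g_def comb_def fun_eq_iff using A[of b] A_disj[of a b] by (intro allI sum.cong refl) auto

lemma Y_dep:
  assumes "\<And>i. i \<in> {..<n} - A a \<Longrightarrow> m i = m' i" "a \<noteq> b"
  shows "Y (cent m) b = Y (cent m') b"
proof -
  have "g (cent m) b = g (cent m') b" using assms by (rule g_dep)
  then show ?thesis unfolding Y_def fun_eq_iff by simp
qed

text \<open>\<open>vsum_ip_tail_conditional\<close> with \<open>l = 1000\<close>, variance 2 and at
  most \<open>n\<close> rows.\<close>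

lemma rare_sum:
  fixes y :: "'r \<Rightarrow> (nat \<Rightarrow> nat \<Rightarrow> real) \<Rightarrow> nat \<Rightarrow> real"
  assumes a: "a < 3" and R: "finite R"
    and dep: "\<And>r m m'. (\<And>i. i \<in> {..<n} - A a \<Longrightarrow> m i = m' i) \<Longrightarrow> y r m = y r m'"
    and ym: "\<And>r j. j < d \<Longrightarrow> (\<lambda>m. y r m j) \<in> borel_measurable F"
  shows "rare (1/1000) (\<lambda>m. (\<Sum>r\<in>R. (ip d (g (cent m) a) (y r m))\<^sup>2) \<le> 2000 * real n * (\<Sum>r\<in>R. nsq d (y r m)))"
proof -
  have gm: "(\<lambda>m. ip d (g (cent m) a) (y r m)) \<in> borel_measurable F" for r
    by (intro measurable_ip measurable_g ym)
  have nm: "(\<lambda>m. nsq d (y r m)) \<in> borel_measurable F" for r by (intro measurable_ip ym)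
  have meas: "{m\<in>space F. \<not> (\<Sum>r\<in>R. (ip d (g (cent m) a) (y r m))\<^sup>2) \<le> 2000 * real n * (\<Sum>r\<in>R. nsq d (y r m))} \<in> events"
    unfolding not_le by (intro borel_measurable_less borel_measurable_times borel_measurable_sum borel_measurable_power borel_measurable_const gm nm)
  have meas': "{m\<in>space F. 1000 * ((sqrt 2)\<^sup>2 * card (A a) * (\<Sum>r\<in>R. nsq d (y r m))) < (\<Sum>r\<in>R. (ip d (vsum (A a) (\<lambda>i j. m i j - \<mu> j)) (y r m))\<^sup>2)} \<in> events"
    unfolding g_def[symmetric] by (intro borel_measurable_less borel_measurable_times borel_measurable_sum borel_measurable_power borel_measurable_const gm nm)
  have "prob {m\<in>space F. \<not> (\<Sum>r\<in>R. (ip d (g (cent m) a) (y r m))\<^sup>2) \<le> 2000 * real n * (\<Sum>r\<in>R. nsq d (y r m))} \<le>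
    prob {m\<in>space F. 1000 * ((sqrt 2)\<^sup>2 * card (A a) * (\<Sum>r\<in>R. nsq d (y r m))) < (\<Sum>r\<in>R. (ip d (vsum (A a) (\<lambda>i j. m i j - \<mu> j)) (y r m))\<^sup>2)}"
  proof (rule finite_measure_mono[OF _ meas'])
    have "1000 * ((sqrt 2)\<^sup>2 * card (A a) * (\<Sum>r\<in>R. nsq d (y r m))) \<le> 2000 * real n * (\<Sum>r\<in>R. nsq d (y r m))" for m
      using card_A(2)[OF a] by (simp add: mult_right_mono sum_nonneg)
    then show "{m\<in>space F. \<not> (\<Sum>r\<in>R. (ip d (g (cent m) a) (y r m))\<^sup>2) \<le> 2000 * real n * (\<Sum>r\<in>R. nsq d (y r m))} \<subseteq>
       {m\<in>space F. 1000 * ((sqrt 2)\<^sup>2 * card (A a) * (\<Sum>r\<in>R. nsq d (y r m))) < (\<Sum>r\<in>R. (ip d (vsum (A a) (\<lambda>i j. m i j - \<mu> j)) (y r m))\<^sup>2)}"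
      unfolding g_def not_le by (blast intro: le_less_trans)
  qed
  also have "\<dots> \<le> 1 / 1000"
  proof (rule vsum_ip_tail_conditional)
    show "y r m = y r m'" if "\<And>i. i \<in> {..<n} - A a \<Longrightarrow> m i = m' i" for r m m' using that by (rule dep)
  qed (use A ym R \<sigma>2 in auto)
  finally show ?thesis unfolding rare_def using meas by blast
qed

lemma rare_one:
  assumes "a < 3" "\<And>m m'. (\<And>i. i \<in> {..<n} - A a \<Longrightarrow> m i = m' i) \<Longrightarrow> y m = y m'"
    and "\<And>j. j < d \<Longrightarrow> (\<lambda>m. y m j) \<in> borel_measurable F"
  shows "rare (1/1000) (\<lambda>m. (ip d (g (cent m) a) (y m))\<^sup>2 \<le> 2000 * real n * nsq d (y m))"
proof -
  have "rare (1/1000) (\<lambda>m. (\<Sum>r\<in>{()}. (ip d (g (cent m) a) (y m))\<^sup>2) \<le> 2000 * real n * (\<Sum>r\<in>{()}. nsq d (y m)))"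
    by (rule rare_sum) (use assms in \<open>(rule; assumption) | blast\<close>)+
  then show ?thesis by simp
qed

text \<open>Parseval: \<open>rare_sum\<close> for the unit vectors, whose squared norms add up to
  \<open>d\<close>.\<close>

lemma rare_nsq_g:
  assumes a: "a < 3"
  shows "rare (1/1000) (\<lambda>m. nsq d (g (cent m) a) \<le> 2000 * real n * real d)"
proof -
  let ?y = "\<lambda>r (_ :: nat \<Rightarrow> nat \<Rightarrow> real) j. if j = r then 1 else 0 :: real"
  have 1: "ip d x (?y r m) = x r" if "r < d" for x r and m :: "nat \<Rightarrow> nat \<Rightarrow> real"
  proof -
    have "ip d x (?y r m) = (\<Sum>j<d. if j = r then x j else 0)" unfolding ip_def by (intro sum.cong) auto
    then show ?thesis using that by simp
  qed
  have "rare (1/1000) (\<lambda>m. (\<Sum>r<d. (ip d (g (cent m) a) (?y r m))\<^sup>2) \<le> 2000 * real n * (\<Sum>r<d. nsq d (?y r m)))"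
    by (rule rare_sum[OF a]) auto
  moreover have "(\<Sum>r<d. (ip d (g (cent m) a) (?y r m))\<^sup>2) = nsq d (g (cent m) a)" for m
    unfolding nsq_eq_sum by (intro sum.cong) (auto simp: 1)
  moreover have "(\<Sum>r<d. nsq d (?y r m)) = real d" for m :: "nat \<Rightarrow> nat \<Rightarrow> real" by (simp add: 1)
  ultimately show ?thesis by simp
qed

text \<open>The coordinates of \<open>K x\<close> are inner products of \<open>x\<close> with the
  rows of the matrix of \<open>K\<close>, whose squared norms add up to \<open>Fro\<close>.\<close>

lemma rare_nsq_Kg: "rare (1/1000) (\<lambda>m. nsq d (K (g (cent m) 1)) \<le> 2000 * real n * Fro)"
proof -
  define y :: "nat \<Rightarrow> (nat \<Rightarrow> nat \<Rightarrow> real) \<Rightarrow> nat \<Rightarrow> real" where "y r = (\<lambda>_. comb (Bp 0) (\<lambda>i. q i r) q)" for r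
  have "rare (1/1000) (\<lambda>m. (\<Sum>r<d. (ip d (g (cent m) 1) (y r m))\<^sup>2) \<le> 2000 * real n * (\<Sum>r<d. nsq d (y r m)))"
    by (rule rare_sum) (auto simp: y_def)
  moreover have "ip d x (y r m) = K x r" for x r m
    unfolding y_def K_def ip_comb_right by (simp add: comb_def ip_commute[of d x] mult.commute)
  then have "(\<Sum>r<d. (ip d (g (cent m) 1) (y r m))\<^sup>2) = nsq d (K (g (cent m) 1))" for m
    unfolding nsq_eq_sum by simp
  moreover have "(\<Sum>r<d. nsq d (y r m)) = Fro" for m
  proof -
    have "(\<Sum>r<d. nsq d (y r m)) = (\<Sum>r<d. \<Sum>i\<in>Bp 0. \<Sum>k\<in>Bp 0. (q i r * q k r) * ip d (q k) (q i))"
      unfolding y_def ip_comb_right ip_comb_left by (simp add: sum_distrib_left mult.assoc)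
    also have "\<dots> = (\<Sum>i\<in>Bp 0. \<Sum>k\<in>Bp 0. \<Sum>r<d. (q i r * q k r) * ip d (q k) (q i))"
      by (subst sum.swap) (intro sum.cong refl sum.swap)
    also have "\<dots> = Fro"
      unfolding Fro_def by (intro sum.cong refl) (simp add: sum_distrib_right[symmetric] ip_def[symmetric] ip_commute power2_eq_square)
    finally show ?thesis .
  qed
  ultimately show ?thesis by simp
qed

lemma rare_centered:
  "rare (1/30) (\<lambda>m. \<bar>(\<Sum>i\<in>A 0. ip d (cent m i) (Y (cent m) 1) * ip d (cent m i) (Y (cent m) 2)) - 2 * na 0 * f (cent m) 1 2\<bar>
      \<le> 2000 * (sqrt n + 1) * sqrt (nsq d (Y (cent m) 1) * nsq d (Y (cent m) 2)))"
proof -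
  let ?y = "\<lambda>m. Y (cent m) 1" and ?y' = "\<lambda>m. Y (cent m) 2"
  let ?T = "\<lambda>m. (\<Sum>i\<in>A 0. ip d (\<lambda>j. m i j - \<mu> j) (?y m) * ip d (\<lambda>j. m i j - \<mu> j) (?y' m))"
  have comp: "(\<lambda>m. m i j) \<in> borel_measurable F" if "i \<in> A 0" "j < d" for i j
    using that A[of 0] by (intro measurable_field_component) auto
  have Tm: "?T \<in> borel_measurable F"
    by (intro borel_measurable_sum borel_measurable_times measurable_ip measurable_Y borel_measurable_diff borel_measurable_const comp)
  have fm: "(\<lambda>m. ip d (?y m) (?y' m)) \<in> borel_measurable F" "(\<lambda>m. nsq d (?y m) * nsq d (?y' m)) \<in> borel_measurable F"
    by (intro borel_measurable_times measurable_ip measurable_Y; simp)+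
  note intros = borel_measurable_less borel_measurable_diff borel_measurable_times borel_measurable_const borel_measurable_abs
    measurable_compose[OF _ borel_measurable_sqrt] Tm fm
  have meas: "{m\<in>space F. \<not> \<bar>?T m - 2 * na 0 * f (cent m) 1 2\<bar> \<le> 2000 * (sqrt n + 1) * sqrt (nsq d (?y m) * nsq d (?y' m))} \<in> events"
    unfolding not_le f_def by (intro intros)
  have meas': "{m\<in>space F. 1000 * (sqrt (card (A 0)) + 1) * (sqrt 2)\<^sup>2 * sqrt (nsq d (?y m) * nsq d (?y' m)) <
       \<bar>?T m - card (A 0) * ((sqrt 2)\<^sup>2 * ip d (?y m) (?y' m))\<bar>} \<in> events"
    by (intro intros)
  have "prob {m\<in>space F. \<not> \<bar>?T m - 2 * na 0 * f (cent m) 1 2\<bar> \<le> 2000 * (sqrt n + 1) * sqrt (nsq d (?y m) * nsq d (?y' m))} \<le>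
    prob {m\<in>space F. 1000 * (sqrt (card (A 0)) + 1) * (sqrt 2)\<^sup>2 * sqrt (nsq d (?y m) * nsq d (?y' m)) <
       \<bar>?T m - card (A 0) * ((sqrt 2)\<^sup>2 * ip d (?y m) (?y' m))\<bar>}"
  proof (rule finite_measure_mono[OF _ meas'])
    have le: "1000 * (sqrt (card (A 0)) + 1) * (sqrt 2)\<^sup>2 * sqrt (nsq d (?y m) * nsq d (?y' m)) \<le> 2000 * (sqrt n + 1) * sqrt (nsq d (?y m) * nsq d (?y' m))" for m
      using card_A(2)[of 0] by (intro mult_right_mono) auto
    have eq: "card (A 0) * ((sqrt 2)\<^sup>2 * ip d (?y m) (?y' m)) = 2 * na 0 * f (cent m) 1 2" for m by (simp add: na_def f_def)
    show "{m\<in>space F. \<not> \<bar>?T m - 2 * na 0 * f (cent m) 1 2\<bar> \<le> 2000 * (sqrt n + 1) * sqrt (nsq d (?y m) * nsq d (?y' m))} \<subseteq>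
      {m\<in>space F. 1000 * (sqrt (card (A 0)) + 1) * (sqrt 2)\<^sup>2 * sqrt (nsq d (?y m) * nsq d (?y' m)) <
       \<bar>?T m - card (A 0) * ((sqrt 2)\<^sup>2 * ip d (?y m) (?y' m))\<bar>}"
      unfolding not_le eq
    proof (intro subsetI CollectI conjI)
      fix m assume m: "m \<in> {m\<in>space F. 2000 * (sqrt n + 1) * sqrt (nsq d (?y m) * nsq d (?y' m)) < \<bar>?T m - 2 * na 0 * f (cent m) 1 2\<bar>}"
      from m[THEN CollectD] show "m \<in> space F" by (rule conjunct1)
      from m[THEN CollectD] have "2000 * (sqrt n + 1) * sqrt (nsq d (?y m) * nsq d (?y' m)) < \<bar>?T m - 2 * na 0 * f (cent m) 1 2\<bar>" by (rule conjunct2)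
      with le
      show "1000 * (sqrt (card (A 0)) + 1) * (sqrt 2)\<^sup>2 * sqrt (nsq d (?y m) * nsq d (?y' m)) < \<bar>?T m - 2 * na 0 * f (cent m) 1 2\<bar>"
        by (rule le_less_trans)
    qed
  qed
  also have "\<dots> \<le> 4 * exp (- ((2 * 1000 - 1) / 16))"
    by (rule sample_bilinear_tail_conditional) (use A \<sigma>2 in \<open>auto intro!: measurable_Y Y_dep\<close>)
  also have "\<dots> \<le> 1 / 30"
  proof -
    \<comment> \<open>The linear lower bound of the exponential suffices: 1 + 1999/16 exceeds
      120.\<close>
    have "1 + 1999/16 \<le> exp (1999/16 :: real)" by (rule exp_ge_add_one_self)
    then have "120 \<le> exp (1999/16 :: real)" by simp
    then show ?thesis by (simp add: exp_minus field_simps)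
  qed
  finally show ?thesis unfolding rare_def using meas by blast
qed

text \<open>Forty events of probability at most 1/1000 and one of at most 1/30.\<close>

lemma rare_good: "rare (1/10) (\<lambda>m. good (cent m))"
proof -
  have 1: "rare (real 3 * (1/1000)) (\<lambda>m. \<forall>a<3. (ip d (g (cent m) a) \<mu>)\<^sup>2 \<le> 2000 * real n * M2)"
    unfolding M2_def by (intro rare_all rare_one) auto
  have 2: "rare (real 3 * (real 3 * (1/1000))) (\<lambda>m. \<forall>a<3. \<forall>b<3. a \<noteq> b \<longrightarrow> (ip d (g (cent m) a) (z b))\<^sup>2 \<le> 2000 * real n * nsq d (z b))"
    by (intro rare_all rare_imp rare_one) auto
  have 3: "rare (real 3 * (1/1000)) (\<lambda>m. \<forall>a<3. nsq d (g (cent m) a) \<le> 2000 * real n * real d)"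
    by (intro rare_all rare_nsq_g)
  have 4: "rare (real 3 * (real 3 * (1/1000))) (\<lambda>m. \<forall>a<3. \<forall>b<3. a \<noteq> b \<longrightarrow> (ip d (g (cent m) a) (g (cent m) b))\<^sup>2 \<le> 2000 * real n * nsq d (g (cent m) b))"
    by (intro rare_all rare_imp rare_one measurable_g) (auto intro: g_dep)
  have 5: "rare (real 3 * (1/1000)) (\<lambda>m. \<forall>a<3. (ip d (g (cent m) a) (K \<mu>))\<^sup>2 \<le> 2000 * real n * nsq d (K \<mu>))"
    by (intro rare_all rare_one) auto
  have 6: "rare (real 3 * (real 3 * (1/1000))) (\<lambda>m. \<forall>a<3. \<forall>b<3. (ip d (g (cent m) a) (K (z b)))\<^sup>2 \<le> 2000 * real n * nsq d (K (z b)))"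
    by (intro rare_all rare_one) auto
  have 8: "rare (1/1000) (\<lambda>m. (ip d (g (cent m) 2) (K (g (cent m) 1)))\<^sup>2 \<le> 2000 * real n * nsq d (K (g (cent m) 1)))"
  proof (rule rare_one)
    fix m m' :: "nat \<Rightarrow> nat \<Rightarrow> real" assume "\<And>i. i \<in> {..<n} - A 2 \<Longrightarrow> m i = m' i"
    then have "g (cent m) 1 = g (cent m') 1" by (rule g_dep) auto
    then show "K (g (cent m) 1) = K (g (cent m') 1)" by simp
  qed (auto intro!: measurable_K measurable_g)
  have 9: "rare (1/1000) (\<lambda>m. (ip d (g (cent m) 0) (Y (cent m) a))\<^sup>2 \<le> 2000 * real n * nsq d (Y (cent m) a))" if "a = 1 \<or> a = 2" for a
    by (rule rare_one) (use that in \<open>auto intro!: measurable_Y Y_dep\<close>)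
  have e: "(\<forall>a\<in>{1,2}. P a) \<longleftrightarrow> P 1 \<and> P 2" for P :: "nat \<Rightarrow> bool" by auto
  have "rare (real 3 * (1/1000) + (real 3 * (real 3 * (1/1000)) + (real 3 * (1/1000) + (real 3 * (real 3 * (1/1000)) + (real 3 * (1/1000) +
     (real 3 * (real 3 * (1/1000)) + (1/1000 + (1/1000 + ((1/1000 + 1/1000) + 1/30))))))))) (\<lambda>m. good (cent m))"
    unfolding good_def e
    by (intro rare_conj 1 2 3 4 5 6 rare_nsq_Kg 8 9 rare_centered) auto
  then show ?thesis unfolding rare_def by simp
qed

end

section \<open>Testers based on two clones\<close>

lemma measurable_cong_setsD:
  "f \<in> M \<rightarrow>\<^sub>M N \<Longrightarrow> sets M' = sets M \<Longrightarrow> sets N' = sets N \<Longrightarrow> f \<in> M' \<rightarrow>\<^sub>M N'"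
  using measurable_cong_sets by blast

lemma sets_gaussian: "sets (gaussian d \<mu>) = sets (vec_space d)"
  unfolding gaussian_def vec_space_def by (intro sets_PiM_cong refl) simp

lemma prob_gaussian: "prob_space (gaussian d \<mu>)"
  unfolding gaussian_def by (intro prob_space_PiM prob_space_normal_density) simp

text \<open>On a corrupted row the random part of the first clone is only the added noise, of
  deviation 1; on an uncorrupted row it is a sum of two unit Gaussians.\<close>

definition clone_sd :: "nat set \<Rightarrow> nat \<Rightarrow> real" where
  "clone_sd S i = (if i \<in> S then 1 else sqrt 2)"

definition clone_mean :: "nat set \<Rightarrow> (nat \<Rightarrow> real) \<Rightarrow> nat \<Rightarrow> nat \<Rightarrow> real" where
  "clone_mean S \<mu> i j = (if i \<in> S then 0 else \<mu> j)"

interpretation clone: field_sd "clone_sd S" for S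
  by unfold_locales (simp add: clone_sd_def)

lemma measurable_vec_op:
  assumes "\<And>j. j < d \<Longrightarrow> (\<lambda>w. f w j) \<in> borel_measurable N"
  shows "(\<lambda>w. \<lambda>j\<in>{..<d}. f w j) \<in> N \<rightarrow>\<^sub>M vec_space d"
  unfolding vec_space_def using assms by (intro measurable_restrict) auto

lemma measurable_vec_fst: "j < d \<Longrightarrow> sets M = sets (vec_space d) \<Longrightarrow> (\<lambda>w. fst w j) \<in> borel_measurable (M \<Otimes>\<^sub>M N)"
  and measurable_vec_snd: "j < d \<Longrightarrow> sets N = sets (vec_space d) \<Longrightarrow> (\<lambda>w. snd w j) \<in> borel_measurable (M \<Otimes>\<^sub>M N)"
proof -
  have c: "(\<lambda>x. x j) \<in> borel_measurable (vec_space d)" if "j < d" for j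
    unfolding vec_space_def using that by (intro measurable_component_singleton) auto
  show "(\<lambda>w. fst w j) \<in> borel_measurable (M \<Otimes>\<^sub>M N)" if "j < d" "sets M = sets (vec_space d)"
    by (rule measurable_compose[OF measurable_fst measurable_cong_setsD[OF c[OF that(1)] that(2) refl]])
  show "(\<lambda>w. snd w j) \<in> borel_measurable (M \<Otimes>\<^sub>M N)" if "j < d" "sets N = sets (vec_space d)"
    by (rule measurable_compose[OF measurable_snd measurable_cong_setsD[OF c[OF that(1)] that(2) refl]])
qed

lemma nn_integral_gaussian_clone:
  fixes F :: "(nat \<Rightarrow> real) \<times> (nat \<Rightarrow> real) \<Rightarrow> ennreal"
  assumes F: "F \<in> borel_measurable (vec_space d \<Otimes>\<^sub>M vec_space d)"
  shows "(\<integral>\<^sup>+x. \<integral>\<^sup>+y. F (\<lambda>j\<in>{..<d}. x j + y j, \<lambda>j\<in>{..<d}. x j - y j) \<partial>gaussian d (\<lambda>_. 0) \<partial>gaussian d \<mu>) =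
    (\<integral>\<^sup>+u. \<integral>\<^sup>+v. F (u, v) \<partial>PiM {..<d} (\<lambda>j. normal_measure (\<mu> j) (sqrt 2)) \<partial>PiM {..<d} (\<lambda>j. normal_measure (\<mu> j) (sqrt 2)))"
proof -
  have sets: "sets (PiM {..<d} (\<lambda>j. normal_measure (\<mu> j) (sqrt 2))) = sets (vec_space d)"
    unfolding vec_space_def by (intro sets_PiM_cong refl) simp
  have F': "F \<in> borel_measurable (PiM {..<d} (\<lambda>j. normal_measure (\<mu> j) (sqrt 2)) \<Otimes>\<^sub>M PiM {..<d} (\<lambda>j. normal_measure (\<mu> j) (sqrt 2)))"
    by (rule measurable_cong_setsD[OF F sets_pair_measure_cong[OF sets sets] refl])
  let ?\<phi> = "\<lambda>(_::nat) (w :: real \<times> real). (fst w + snd w, fst w - snd w)"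
  have "(\<integral>\<^sup>+x. \<integral>\<^sup>+y. F (\<lambda>j\<in>{..<d}. fst (?\<phi> j (x j, y j)), \<lambda>j\<in>{..<d}. snd (?\<phi> j (x j, y j))) \<partial>PiM {..<d} (\<lambda>j. normal_measure 0 1) \<partial>PiM {..<d} (\<lambda>j. normal_measure (\<mu> j) 1)) =
    (\<integral>\<^sup>+u. \<integral>\<^sup>+v. F (u, v) \<partial>PiM {..<d} (\<lambda>j. normal_measure (\<mu> j) (sqrt 2)) \<partial>PiM {..<d} (\<lambda>j. normal_measure (\<mu> j) (sqrt 2)))"
  proof (rule nn_integral_PiM_pair_map)
    fix j and G :: "real \<times> real \<Rightarrow> ennreal"
    show "?\<phi> j \<in> normal_measure (\<mu> j) 1 \<Otimes>\<^sub>M normal_measure 0 1 \<rightarrow>\<^sub>M normal_measure (\<mu> j) (sqrt 2) \<Otimes>\<^sub>M normal_measure (\<mu> j) (sqrt 2)"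
    proof -
      have s: "sets (normal_measure a b \<Otimes>\<^sub>M normal_measure a' b') = sets (borel \<Otimes>\<^sub>M borel)" for a b a' b'
        by (intro sets_pair_measure_cong) simp_all
      have "?\<phi> j \<in> borel \<Otimes>\<^sub>M borel \<rightarrow>\<^sub>M borel \<Otimes>\<^sub>M borel" by measurable
      then show ?thesis by (rule measurable_cong_setsD[OF _ s s])
    qed
    assume G: "G \<in> borel_measurable (normal_measure (\<mu> j) (sqrt 2) \<Otimes>\<^sub>M normal_measure (\<mu> j) (sqrt 2))"
    have "sets (borel \<Otimes>\<^sub>M borel) = sets (normal_measure (\<mu> j) (sqrt 2) \<Otimes>\<^sub>M normal_measure (\<mu> j) (sqrt 2))"
      by (intro sets_pair_measure_cong) simp_all
    then have "G \<in> borel_measurable (borel \<Otimes>\<^sub>M borel)" by (rule measurable_cong_setsD[OF G _ refl])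
    from nn_integral_normal_rotation[OF this, of "\<mu> j"]
    show "(\<integral>\<^sup>+x. \<integral>\<^sup>+y. G (?\<phi> j (x, y)) \<partial>normal_measure 0 1 \<partial>normal_measure (\<mu> j) 1) = (\<integral>\<^sup>+u. \<integral>\<^sup>+v. G (u, v) \<partial>normal_measure (\<mu> j) (sqrt 2) \<partial>normal_measure (\<mu> j) (sqrt 2))"
      by simp
  qed (auto intro!: prob_space_normal_density F')
  then show ?thesis by (simp add: gaussian_def)
qed

text \<open>On a corrupted row no rotation takes place: sample and noise are swapped, so the first
  component is the noise needed for both clones and the second is the overwritten sample.\<close>

definition row_map :: "nat \<Rightarrow> nat set \<Rightarrow> nat \<Rightarrow> (nat \<Rightarrow> real) \<times> (nat \<Rightarrow> real) \<Rightarrow> (nat \<Rightarrow> real) \<times> (nat \<Rightarrow> real)" where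
  "row_map d S i w = (if i \<in> S then (snd w, fst w) else (\<lambda>j\<in>{..<d}. fst w j + snd w j, \<lambda>j\<in>{..<d}. fst w j - snd w j))"

lemma sets_clone_row: "sets (PiM {..<d} (\<lambda>j. normal_measure (a j) b)) = sets (vec_space d)"
  unfolding vec_space_def by (intro sets_PiM_cong refl) simp

lemma nn_integral_clone_field:
  fixes F :: "(nat \<Rightarrow> nat \<Rightarrow> real) \<times> (nat \<Rightarrow> nat \<Rightarrow> real) \<Rightarrow> ennreal"
  assumes F: "F \<in> borel_measurable (sample_space n d \<Otimes>\<^sub>M sample_space n d)"
  shows "(\<integral>\<^sup>+x. \<integral>\<^sup>+y. F (\<lambda>i\<in>{..<n}. fst (row_map d S i (x i, y i)), \<lambda>i\<in>{..<n}. snd (row_map d S i (x i, y i)))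
       \<partial>PiM {..<n} (\<lambda>_. gaussian d (\<lambda>_. 0)) \<partial>PiM {..<n} (\<lambda>_. gaussian d \<mu>)) =
    (\<integral>\<^sup>+u. \<integral>\<^sup>+m. F (u, m) \<partial>gauss_field {..<n} d (\<lambda>_. \<mu>) (clone_sd S) \<partial>gauss_field {..<n} d (clone_mean S \<mu>) (clone_sd S))"
  unfolding gauss_field_def
proof (rule nn_integral_PiM_pair_map)
  show "F \<in> borel_measurable (PiM {..<n} (\<lambda>i. PiM {..<d} (\<lambda>j. normal_measure (clone_mean S \<mu> i j) (clone_sd S i))) \<Otimes>\<^sub>M
      PiM {..<n} (\<lambda>i. PiM {..<d} (\<lambda>j. normal_measure (\<mu> j) (clone_sd S i))))"
  proof -
    have s: "sets (PiM {..<n} (\<lambda>i. PiM {..<d} (\<lambda>j. normal_measure (a i j) (b i)))) = sets (sample_space n d)" for a b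
      unfolding sample_space_def by (intro sets_PiM_cong refl sets_clone_row)
    show ?thesis by (rule measurable_cong_setsD[OF F sets_pair_measure_cong[OF s s] refl])
  qed
  fix i
  have sg: "sets (gaussian d \<mu> \<Otimes>\<^sub>M gaussian d (\<lambda>_. 0)) = sets (vec_space d \<Otimes>\<^sub>M vec_space d)"
    by (intro sets_pair_measure_cong sets_gaussian)
  have sc: "sets (PiM {..<d} (\<lambda>j. normal_measure (clone_mean S \<mu> i j) (clone_sd S i)) \<Otimes>\<^sub>M PiM {..<d} (\<lambda>j. normal_measure (\<mu> j) (clone_sd S i))) =
      sets (vec_space d \<Otimes>\<^sub>M vec_space d)"
    by (intro sets_pair_measure_cong sets_clone_row)
  have "row_map d S i \<in> vec_space d \<Otimes>\<^sub>M vec_space d \<rightarrow>\<^sub>M vec_space d \<Otimes>\<^sub>M vec_space d"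
  proof (cases "i \<in> S")
    case True
    then have "row_map d S i = (\<lambda>w. (snd w, fst w))" by (auto simp: row_map_def)
    then show ?thesis by simp
  next
    case False
    then have "row_map d S i = (\<lambda>w. (\<lambda>j\<in>{..<d}. fst w j + snd w j, \<lambda>j\<in>{..<d}. fst w j - snd w j))" by (auto simp: row_map_def)
    moreover have "(\<lambda>w. (\<lambda>j\<in>{..<d}. fst w j + snd w j, \<lambda>j\<in>{..<d}. fst w j - snd w j)) \<in> vec_space d \<Otimes>\<^sub>M vec_space d \<rightarrow>\<^sub>M vec_space d \<Otimes>\<^sub>M vec_space d"
      by (intro measurable_Pair measurable_vec_op borel_measurable_add borel_measurable_diff measurable_vec_fst measurable_vec_snd) simp_all
    ultimately show ?thesis by simp
  qed
  then show "row_map d S i \<in> gaussian d \<mu> \<Otimes>\<^sub>M gaussian d (\<lambda>_. 0) \<rightarrow>\<^sub>M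
      PiM {..<d} (\<lambda>j. normal_measure (clone_mean S \<mu> i j) (clone_sd S i)) \<Otimes>\<^sub>M PiM {..<d} (\<lambda>j. normal_measure (\<mu> j) (clone_sd S i))"
    by (rule measurable_cong_setsD[OF _ sg sc])
  fix G :: "(nat \<Rightarrow> real) \<times> (nat \<Rightarrow> real) \<Rightarrow> ennreal"
  assume "G \<in> borel_measurable (PiM {..<d} (\<lambda>j. normal_measure (clone_mean S \<mu> i j) (clone_sd S i)) \<Otimes>\<^sub>M PiM {..<d} (\<lambda>j. normal_measure (\<mu> j) (clone_sd S i)))"
  then have G: "G \<in> borel_measurable (vec_space d \<Otimes>\<^sub>M vec_space d)" by (rule measurable_cong_setsD[OF _ sc[symmetric] refl])
  show "(\<integral>\<^sup>+x. \<integral>\<^sup>+y. G (row_map d S i (x, y)) \<partial>gaussian d (\<lambda>_. 0) \<partial>gaussian d \<mu>) =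
    (\<integral>\<^sup>+u. \<integral>\<^sup>+v. G (u, v) \<partial>PiM {..<d} (\<lambda>j. normal_measure (\<mu> j) (clone_sd S i)) \<partial>PiM {..<d} (\<lambda>j. normal_measure (clone_mean S \<mu> i j) (clone_sd S i)))"
  proof (cases "i \<in> S")
    case True
    have "sets (gaussian d (\<lambda>_. 0) \<Otimes>\<^sub>M gaussian d \<mu>) = sets (vec_space d \<Otimes>\<^sub>M vec_space d)"
      by (intro sets_pair_measure_cong sets_gaussian)
    then have G': "G \<in> borel_measurable (gaussian d (\<lambda>_. 0) \<Otimes>\<^sub>M gaussian d \<mu>)" by (rule measurable_cong_setsD[OF G _ refl])
    have "(\<integral>\<^sup>+x. \<integral>\<^sup>+y. G (y, x) \<partial>gaussian d (\<lambda>_. 0) \<partial>gaussian d \<mu>) = (\<integral>\<^sup>+y. \<integral>\<^sup>+x. G (y, x) \<partial>gaussian d \<mu> \<partial>gaussian d (\<lambda>_. 0))"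
      by (rule pair_sigma_finite.Fubini'[symmetric])
       (use G' in \<open>auto intro!: pair_sigma_finite.intro prob_space_imp_sigma_finite prob_gaussian\<close>)
    then show ?thesis using True by (simp add: row_map_def clone_sd_def clone_mean_def gaussian_def[symmetric])
  next
    case False
    then show ?thesis using nn_integral_gaussian_clone[OF G, of \<mu>] by (simp add: row_map_def clone_sd_def clone_mean_def)
  qed
qed (auto intro!: prob_gaussian clone.prob_row)

text \<open>\<open>pcl\<close> and \<open>qcl\<close> rebuild the two clones from the independent
  pair \<open>u\<close>, \<open>m\<close>; on a corrupted row both are functions of the same noise
  \<open>u i\<close>.\<close>

definition pcl :: "nat set \<Rightarrow> (nat \<Rightarrow> nat \<Rightarrow> real) \<Rightarrow> (nat \<Rightarrow> nat \<Rightarrow> real) \<Rightarrow> nat \<Rightarrow> nat \<Rightarrow> real" where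
  "pcl S z u i j = (if i \<in> S then z i j + u i j else u i j)"

definition qcl :: "nat set \<Rightarrow> (nat \<Rightarrow> nat \<Rightarrow> real) \<Rightarrow> (nat \<Rightarrow> nat \<Rightarrow> real) \<Rightarrow> (nat \<Rightarrow> nat \<Rightarrow> real) \<Rightarrow> nat \<Rightarrow> nat \<Rightarrow> real" where
  "qcl S z u m i j = (if i \<in> S then z i j - u i j else m i j)"

text \<open>Sums of samples and noise are formed without restricting the index ranges;
  \<open>acc_local\<close> makes the values outside them irrelevant.\<close>

locale clone_test =
  fixes n d :: nat and acc :: "(nat \<Rightarrow> nat \<Rightarrow> real) \<Rightarrow> (nat \<Rightarrow> nat \<Rightarrow> real) \<Rightarrow> bool"
  assumes acc_local: "\<And>p q p' q'. (\<And>i j. i < n \<Longrightarrow> j < d \<Longrightarrow> p i j = p' i j) \<Longrightarrow> (\<And>i j. i < n \<Longrightarrow> j < d \<Longrightarrow> q i j = q' i j) \<Longrightarrow> acc p q = acc p' q'"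
    and acc_measurable: "\<And>(N :: ((nat \<Rightarrow> nat \<Rightarrow> real) \<times> (nat \<Rightarrow> nat \<Rightarrow> real)) measure) p q. (\<And>i j. i < n \<Longrightarrow> j < d \<Longrightarrow> (\<lambda>w. p w i j) \<in> borel_measurable N) \<Longrightarrow>
       (\<And>i j. i < n \<Longrightarrow> j < d \<Longrightarrow> (\<lambda>w. q w i j) \<in> borel_measurable N) \<Longrightarrow> {w\<in>space N. acc (p w) (q w)} \<in> sets N"
begin

definition verdict :: "(nat \<Rightarrow> nat \<Rightarrow> real) \<Rightarrow> (nat \<Rightarrow> nat \<Rightarrow> real) \<Rightarrow> verdict" where
  "verdict p q = (if acc p q then Null else Alternative)"

definition tester :: "(nat \<Rightarrow> nat \<Rightarrow> real) \<Rightarrow> verdict measure" where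
  "tester x = distr (PiM {..<n} (\<lambda>_. gaussian d (\<lambda>_. 0))) (count_space UNIV)
     (\<lambda>\<xi>. verdict (\<lambda>i j. x i j + \<xi> i j) (\<lambda>i j. x i j - \<xi> i j))"

lemma measurable_verdict:
  fixes N :: "((nat \<Rightarrow> nat \<Rightarrow> real) \<times> (nat \<Rightarrow> nat \<Rightarrow> real)) measure"
  assumes "\<And>i j. i < n \<Longrightarrow> j < d \<Longrightarrow> (\<lambda>w. p w i j) \<in> borel_measurable N" "\<And>i j. i < n \<Longrightarrow> j < d \<Longrightarrow> (\<lambda>w. q w i j) \<in> borel_measurable N"
  shows "(\<lambda>w. verdict (p w) (q w)) \<in> N \<rightarrow>\<^sub>M count_space UNIV"
  unfolding verdict_def by (intro measurable_If measurable_const acc_measurable assms) auto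

lemma sample_fst:
  assumes "i < n" "j < d" "sets M = sets (sample_space n d)"
  shows "(\<lambda>w. fst w i j) \<in> borel_measurable (M \<Otimes>\<^sub>M N)"
proof -
  have f: "fst \<in> M \<Otimes>\<^sub>M N \<rightarrow>\<^sub>M PiM {..<n} (\<lambda>_. vec_space d)"
    using measurable_compose[OF measurable_fst measurable_ident_sets[OF assms(3)]] by (simp only: sample_space_def)
  have i: "i \<in> {..<n}" using assms(1) by simp
  show ?thesis by (rule measurable_vec_component[OF i assms(2) f])
qed

lemma sample_snd:
  assumes "i < n" "j < d" "sets N = sets (sample_space n d)"
  shows "(\<lambda>w. snd w i j) \<in> borel_measurable (M \<Otimes>\<^sub>M N)"
proof -
  have f: "snd \<in> M \<Otimes>\<^sub>M N \<rightarrow>\<^sub>M PiM {..<n} (\<lambda>_. vec_space d)"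
    using measurable_compose[OF measurable_snd measurable_ident_sets[OF assms(3)]] by (simp only: sample_space_def)
  have i: "i \<in> {..<n}" using assms(1) by simp
  show ?thesis by (rule measurable_vec_component[OF i assms(2) f])
qed

lemma sets_noise: "sets (PiM {..<n} (\<lambda>_. gaussian d \<mu>)) = sets (sample_space n d)"
  unfolding sample_space_def by (intro sets_PiM_cong refl sets_gaussian)

lemma prob_noise: "prob_space (PiM {..<n} (\<lambda>_. gaussian d \<mu>))"
  by (intro prob_space_PiM prob_gaussian)

lemma measurable_tester: "tester \<in> sample_space n d \<rightarrow>\<^sub>M prob_algebra (count_space UNIV)"
  unfolding tester_def
proof (rule measurable_distr_prob_space2)
  show "(\<lambda>x. PiM {..<n} (\<lambda>_. gaussian d (\<lambda>_. 0))) \<in> sample_space n d \<rightarrow>\<^sub>M prob_algebra (sample_space n d)"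
    by (rule measurable_const) (simp add: space_prob_algebra sets_noise prob_noise)
  have "(\<lambda>w. verdict (\<lambda>i j. fst w i j + snd w i j) (\<lambda>i j. fst w i j - snd w i j)) \<in> sample_space n d \<Otimes>\<^sub>M sample_space n d \<rightarrow>\<^sub>M count_space UNIV"
    by (intro measurable_verdict borel_measurable_add borel_measurable_diff sample_fst sample_snd refl)
  then show "(\<lambda>(x, y). verdict (\<lambda>i j. x i j + y i j) (\<lambda>i j. x i j - y i j)) \<in> sample_space n d \<Otimes>\<^sub>M sample_space n d \<rightarrow>\<^sub>M count_space UNIV"
    by (simp add: case_prod_unfold)
qed

lemma measurable_contaminate:
  assumes z: "z \<in> space (sample_space n d)"
  shows "contaminate n S z \<in> PiM {..<n} (\<lambda>_. gaussian d \<mu>) \<rightarrow>\<^sub>M sample_space n d"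
  unfolding contaminate_def[abs_def] sample_space_def
proof (rule measurable_restrict)
  fix i assume i: "i \<in> {..<n}"
  show "(\<lambda>x. if i \<in> S then z i else x i) \<in> PiM {..<n} (\<lambda>_. gaussian d \<mu>) \<rightarrow>\<^sub>M vec_space d"
  proof (cases "i \<in> S")
    case True
    have "z i \<in> space (vec_space d)" using z i by (auto simp: sample_space_def space_PiM PiE_iff)
    then show ?thesis unfolding if_P[OF True] by (rule measurable_const)
  next
    case False
    have "(\<lambda>x. x i) \<in> PiM {..<n} (\<lambda>_. gaussian d \<mu>) \<rightarrow>\<^sub>M gaussian d \<mu>" using i by (rule measurable_component_singleton)
    then show ?thesis unfolding if_not_P[OF False] by (rule measurable_cong_setsD[OF _ refl sets_gaussian[symmetric]])
  qed
qed

text \<open>Expresses the verdict through the two independent fields, so that conditioning on the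
  first clones becomes an iterated integral.\<close>

lemma tester_law:
  assumes z: "z \<in> space (sample_space n d)" and S: "S \<subseteq> {..<n}"
  shows "emeasure (bind (contaminated_samples n d (gaussian d \<mu>) S z) tester) {v} =
    (\<integral>\<^sup>+u. \<integral>\<^sup>+m. indicator {v} (verdict (pcl S z u) (qcl S z u m))
       \<partial>gauss_field {..<n} d (\<lambda>_. \<mu>) (clone_sd S) \<partial>gauss_field {..<n} d (clone_mean S \<mu>) (clone_sd S))"
proof -
  let ?P = "PiM {..<n} (\<lambda>_. gaussian d \<mu>)" and ?N = "PiM {..<n} (\<lambda>_. gaussian d (\<lambda>_. 0))"
  let ?C = "contaminated_samples n d (gaussian d \<mu>) S z"
  interpret P: prob_space ?P by (rule prob_noise)
  interpret C: prob_space ?C unfolding contaminated_samples_def by (intro P.prob_space_distr measurable_contaminate z)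
  have tC: "tester \<in> ?C \<rightarrow>\<^sub>M subprob_algebra (count_space UNIV)"
    using measurable_prob_algebraD[OF measurable_tester] by (simp add: contaminated_samples_def cong: measurable_cong_sets)
  have "emeasure (bind ?C tester) {v} = (\<integral>\<^sup>+x. emeasure (tester x) {v} \<partial>?C)"
    by (rule emeasure_bind[OF C.not_empty tC]) simp
  also have "\<dots> = (\<integral>\<^sup>+x. emeasure (tester (contaminate n S z x)) {v} \<partial>?P)"
    unfolding contaminated_samples_def
    by (rule nn_integral_distr[OF measurable_contaminate[OF z]])
     (use measurable_emeasure_kernel[OF measurable_prob_algebraD[OF measurable_tester], of "{v}"] in simp)
  also have "\<dots> = (\<integral>\<^sup>+x. \<integral>\<^sup>+y. indicator {v} (verdict (pcl S z (\<lambda>i\<in>{..<n}. fst (row_map d S i (x i, y i))))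
      (qcl S z (\<lambda>i\<in>{..<n}. fst (row_map d S i (x i, y i))) (\<lambda>i\<in>{..<n}. snd (row_map d S i (x i, y i))))) \<partial>?N \<partial>?P)"
  proof (rule nn_integral_cong)
    fix x assume x: "x \<in> space ?P"
    let ?x = "contaminate n S z x"
    have xs: "?x \<in> space (sample_space n d)" using measurable_space[OF measurable_contaminate[OF z] x] .
    have pm: "(\<lambda>\<xi>. (?x, \<xi>)) \<in> ?N \<rightarrow>\<^sub>M sample_space n d \<Otimes>\<^sub>M ?N" using xs by simp
    have vm: "(\<lambda>w. verdict (\<lambda>i j. fst w i j + snd w i j) (\<lambda>i j. fst w i j - snd w i j)) \<in> sample_space n d \<Otimes>\<^sub>M ?N \<rightarrow>\<^sub>M count_space UNIV"
      by (intro measurable_verdict borel_measurable_add borel_measurable_diff sample_fst sample_snd refl sets_noise)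
    have tv: "(\<lambda>\<xi>. verdict (\<lambda>i j. ?x i j + \<xi> i j) (\<lambda>i j. ?x i j - \<xi> i j)) \<in> ?N \<rightarrow>\<^sub>M count_space UNIV"
      using measurable_compose[OF pm vm] by simp
    have "emeasure (tester ?x) {v} = (\<integral>\<^sup>+r. indicator {v} r \<partial>tester ?x)"
      by (subst nn_integral_indicator) (auto simp: tester_def)
    also have "\<dots> = (\<integral>\<^sup>+\<xi>. indicator {v} (verdict (\<lambda>i j. ?x i j + \<xi> i j) (\<lambda>i j. ?x i j - \<xi> i j)) \<partial>?N)"
      unfolding tester_def by (rule nn_integral_distr[OF tv]) simp
    also have "\<dots> = (\<integral>\<^sup>+y. indicator {v} (verdict (pcl S z (\<lambda>i\<in>{..<n}. fst (row_map d S i (x i, y i))))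
      (qcl S z (\<lambda>i\<in>{..<n}. fst (row_map d S i (x i, y i))) (\<lambda>i\<in>{..<n}. snd (row_map d S i (x i, y i))))) \<partial>?N)"
      unfolding verdict_def
      by (intro nn_integral_cong arg_cong[where f="indicator {v}"] if_cong acc_local)
       (auto simp: pcl_def qcl_def row_map_def contaminate_def)
    finally show "emeasure (tester ?x) {v} = \<dots>" .
  qed
  also have "\<dots> = (\<integral>\<^sup>+u. \<integral>\<^sup>+m. indicator {v} (verdict (pcl S z u) (qcl S z u m))
       \<partial>gauss_field {..<n} d (\<lambda>_. \<mu>) (clone_sd S) \<partial>gauss_field {..<n} d (clone_mean S \<mu>) (clone_sd S))"
  proof -
    have "(\<lambda>w. verdict (pcl S z (fst w)) (qcl S z (fst w) (snd w))) \<in> sample_space n d \<Otimes>\<^sub>M sample_space n d \<rightarrow>\<^sub>M count_space UNIV"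
    proof (rule measurable_verdict)
      fix i j assume ij: "i < n" "j < d"
      note f = sample_fst[OF ij refl, where N="sample_space n d"] and s = sample_snd[OF ij refl, where M="sample_space n d"]
      show "(\<lambda>w. pcl S z (fst w) i j) \<in> borel_measurable (sample_space n d \<Otimes>\<^sub>M sample_space n d)"
        unfolding pcl_def using f by (cases "i \<in> S") auto
      show "(\<lambda>w. qcl S z (fst w) (snd w) i j) \<in> borel_measurable (sample_space n d \<Otimes>\<^sub>M sample_space n d)"
        unfolding qcl_def using f s by (cases "i \<in> S") auto
    qed
    then have "(\<lambda>w. indicator {v} (verdict (pcl S z (fst w)) (qcl S z (fst w) (snd w))) :: ennreal) \<in> borel_measurable (sample_space n d \<Otimes>\<^sub>M sample_space n d)"
      by (rule measurable_compose) simp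
    from nn_integral_clone_field[OF this, where S=S and \<mu>=\<mu>] show ?thesis by simp
  qed
  finally show ?thesis .
qed

text \<open>Given \<open>u\<close>, the test set selected from the first clones is fixed, and the second clones \<open>m\<close> of the
  uncorrupted rows are independent of it.\<close>

lemma tester_success:
  assumes z: "z \<in> space (sample_space n d)" and S: "S \<subseteq> {..<n}"
    and E: "{u\<in>space (gauss_field {..<n} d (clone_mean S \<mu>) (clone_sd S)). \<not> E u} \<in> sets (gauss_field {..<n} d (clone_mean S \<mu>) (clone_sd S))"
      "measure (gauss_field {..<n} d (clone_mean S \<mu>) (clone_sd S)) {u\<in>space (gauss_field {..<n} d (clone_mean S \<mu>) (clone_sd S)). \<not> E u} \<le> a"
    and P: "\<And>u. u \<in> space (gauss_field {..<n} d (clone_mean S \<mu>) (clone_sd S)) \<Longrightarrow> E u \<Longrightarrow>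
       \<exists>P. {m\<in>space (gauss_field {..<n} d (\<lambda>_. \<mu>) (clone_sd S)). \<not> P m} \<in> sets (gauss_field {..<n} d (\<lambda>_. \<mu>) (clone_sd S)) \<and>
       measure (gauss_field {..<n} d (\<lambda>_. \<mu>) (clone_sd S)) {m\<in>space (gauss_field {..<n} d (\<lambda>_. \<mu>) (clone_sd S)). \<not> P m} \<le> b \<and>
       (\<forall>m. P m \<longrightarrow> verdict (pcl S z u) (qcl S z u m) = v)"
    and ab: "a + b \<le> 1/3" "0 \<le> a" "0 \<le> b"
  shows "2/3 \<le> measure (bind (contaminated_samples n d (gaussian d \<mu>) S z) tester) {v}"
proof -
  let ?U = "gauss_field {..<n} d (clone_mean S \<mu>) (clone_sd S)" and ?M = "gauss_field {..<n} d (\<lambda>_. \<mu>) (clone_sd S)"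
  interpret U: prob_space ?U by (rule clone.prob_field)
  interpret M: prob_space ?M by (rule clone.prob_field)
  have EE: "{u\<in>space ?U. E u} \<in> U.events"
    using sets.compl_sets[OF E(1)] by (rule back_subst[where P="\<lambda>X. X \<in> U.events"]) auto
  have PE: "1 - a \<le> U.prob {u\<in>space ?U. E u}"
    using U.prob_neg[of E] EE E(2) by simp
  \<comment> \<open>The conditional success probability \<open>1 - b\<close> is integrated over the
    event \<open>E\<close>, of probability at least \<open>1 - a\<close>.\<close>
  have "ennreal (2/3) \<le> ennreal ((1 - b) * (1 - a))"
  proof (rule ennreal_leI)
    have "0 \<le> a * b" using ab by simp
    moreover have "(1 - b) * (1 - a) = 1 - a - b + a * b" by (simp add: algebra_simps)
    ultimately show "2/3 \<le> (1 - b) * (1 - a)" using ab by linarith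
  qed
  also have "\<dots> \<le> ennreal (1 - b) * emeasure ?U {u\<in>space ?U. E u}"
    using ab PE by (subst ennreal_mult) (auto simp: U.emeasure_eq_measure intro!: mult_left_mono ennreal_leI)
  also have "\<dots> = (\<integral>\<^sup>+u. ennreal (1 - b) * indicator {u\<in>space ?U. E u} u \<partial>?U)"
    using EE by (simp add: nn_integral_cmult_indicator)
  also have "\<dots> \<le> (\<integral>\<^sup>+u. \<integral>\<^sup>+m. indicator {v} (verdict (pcl S z u) (qcl S z u m)) \<partial>?M \<partial>?U)"
  proof (rule nn_integral_mono)
    fix u assume u: "u \<in> space ?U"
    show "ennreal (1 - b) * indicator {u\<in>space ?U. E u} u \<le> (\<integral>\<^sup>+m. indicator {v} (verdict (pcl S z u) (qcl S z u m)) \<partial>?M)"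
    proof (cases "E u")
      case True
      obtain P where Pm: "{m\<in>space ?M. \<not> P m} \<in> M.events" and Pb: "M.prob {m\<in>space ?M. \<not> P m} \<le> b"
        and Pv: "\<And>m. P m \<Longrightarrow> verdict (pcl S z u) (qcl S z u m) = v" using P[OF u True] by blast
      have PP: "{m\<in>space ?M. P m} \<in> M.events"
        using sets.compl_sets[OF Pm] by (rule back_subst[where P="\<lambda>X. X \<in> M.events"]) auto
      then have "1 - b \<le> M.prob {m\<in>space ?M. P m}"
        using M.prob_neg[of P] Pb by simp
      then have "ennreal (1 - b) \<le> emeasure ?M {m\<in>space ?M. P m}" by (simp add: M.emeasure_eq_measure ennreal_leI)
      also have "\<dots> = (\<integral>\<^sup>+m. indicator {m\<in>space ?M. P m} m \<partial>?M)" using PP by simp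
      also have "\<dots> \<le> (\<integral>\<^sup>+m. indicator {v} (verdict (pcl S z u) (qcl S z u m)) \<partial>?M)"
        by (intro nn_integral_mono) (auto split: split_indicator dest: Pv)
      finally show ?thesis using True u by simp
    qed simp
  qed
  also have "\<dots> = emeasure (bind (contaminated_samples n d (gaussian d \<mu>) S z) tester) {v}"
    by (rule tester_law[OF z S, symmetric])
  finally have *: "ennreal (2/3) \<le> emeasure (bind (contaminated_samples n d (gaussian d \<mu>) S z) tester) {v}" .
  show ?thesis
  proof (cases "emeasure (bind (contaminated_samples n d (gaussian d \<mu>) S z) tester) {v} = \<infinity>")
    \<comment> \<open>At an infinite value \<open>measure\<close> would be 0 by convention, so
      infinity is excluded through the bound 1.\<close>
    case True
    have "emeasure (bind (contaminated_samples n d (gaussian d \<mu>) S z) tester) {v} \<le> (\<integral>\<^sup>+u. \<integral>\<^sup>+m. 1 \<partial>?M \<partial>?U)"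
      unfolding tester_law[OF z S] by (intro nn_integral_mono) (auto split: split_indicator)
    also have "\<dots> = 1" by (simp add: M.emeasure_space_1 U.emeasure_space_1)
    finally have False using True by (simp add: top_unique)
    then show ?thesis ..
  next
    case False
    then have "emeasure (bind (contaminated_samples n d (gaussian d \<mu>) S z) tester) {v} = ennreal (measure (bind (contaminated_samples n d (gaussian d \<mu>) S z) tester) {v})"
      by (intro emeasure_eq_ennreal_measure) simp
    with * show ?thesis by (simp only: ennreal_le_iff[OF measure_nonneg])
  qed
qed

end

section \<open>The tester\<close>

lemma comb_cong: "(\<And>i. i \<in> J \<Longrightarrow> w i = w' i) \<Longrightarrow> (\<And>i. i \<in> J \<Longrightarrow> X i j = X' i j) \<Longrightarrow> comb J w X j = comb J w' X' j"
  unfolding comb_def by (intro sum.cong) auto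

lemma rip_cong:
  assumes "\<And>i j. i \<in> J \<Longrightarrow> i < n \<Longrightarrow> j < d \<Longrightarrow> X i j = X' i j"
  shows "rip n d J l X = rip n d J l X'"
proof -
  have "nsq d (wcomb n w X) = nsq d (wcomb n w X')" if "support n w \<subseteq> J" for w
    unfolding wcomb_support using that assms by (intro ip_cong comb_cong) (auto simp: support_def)
  then show ?thesis unfolding rip_def by auto
qed

lemma rip_subset: "rip n d J l X \<Longrightarrow> J' \<subseteq> J \<Longrightarrow> rip n d J' l X"
  unfolding rip_def by blast

definition valids :: "nat \<Rightarrow> nat \<Rightarrow> real \<Rightarrow> real \<Rightarrow> (nat \<Rightarrow> nat \<Rightarrow> real) \<Rightarrow> nat set set" where
  "valids n d l \<kappa> p = {T. T \<subseteq> {..<n} \<and> real (card T) \<le> \<kappa> \<and> rip n d ({..<n} - T) l p}"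

text \<open>The intersection keeps every group inside the sample also for \<open>a \<ge> 3\<close>,
  as the locales quantify over all \<open>a\<close>.\<close>

definition third :: "nat \<Rightarrow> nat \<Rightarrow> nat set" where
  "third n a = {a * (n div 3)..<(a + 1) * (n div 3)} \<inter> {..<n}"

definition stat_f :: "nat \<Rightarrow> nat \<Rightarrow> nat set \<Rightarrow> (nat \<Rightarrow> nat \<Rightarrow> real) \<Rightarrow> nat \<Rightarrow> nat \<Rightarrow> real" where
  "stat_f n d T q a b = ip d (vsum (third n a - T) q) (vsum (third n b - T) q)"

definition stat_Q :: "nat \<Rightarrow> nat \<Rightarrow> nat set \<Rightarrow> (nat \<Rightarrow> nat \<Rightarrow> real) \<Rightarrow> real" where
  "stat_Q n d T q = (\<Sum>i\<in>third n 0 - T. ip d (q i) (vsum (third n 1 - T) q) * ip d (q i) (vsum (third n 2 - T) q) - 2 * stat_f n d T q 1 2)"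

text \<open>The cubic statistic is tested on one side only, since hiding the mean can only increase
  it. The flag \<open>fl\<close> marks the sparse regime.\<close>

definition passes :: "nat \<Rightarrow> nat \<Rightarrow> real \<Rightarrow> real \<Rightarrow> bool \<Rightarrow> nat set \<Rightarrow> (nat \<Rightarrow> nat \<Rightarrow> real) \<Rightarrow> bool" where
  "passes n d \<tau>1 \<tau>2 fl T q \<longleftrightarrow> \<bar>stat_f n d T q 0 1\<bar> \<le> \<tau>1 \<and> \<bar>stat_f n d T q 0 2\<bar> \<le> \<tau>1 \<and> \<bar>stat_f n d T q 1 2\<bar> \<le> \<tau>1 \<and>
     (fl \<longrightarrow> stat_Q n d T q \<le> \<tau>2)"

text \<open>The choice of \<open>T\<close> is arbitrary but a function of \<open>p\<close> alone,
  which preserves the independence of the second clones. Having no valid set is itself evidence for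
  the alternative.\<close>

definition accepts :: "nat \<Rightarrow> nat \<Rightarrow> real \<Rightarrow> real \<Rightarrow> real \<Rightarrow> real \<Rightarrow> bool \<Rightarrow> (nat \<Rightarrow> nat \<Rightarrow> real) \<Rightarrow> (nat \<Rightarrow> nat \<Rightarrow> real) \<Rightarrow> bool" where
  "accepts n d l \<kappa> \<tau>1 \<tau>2 fl p q \<longleftrightarrow> valids n d l \<kappa> p \<noteq> {} \<and> passes n d \<tau>1 \<tau>2 fl (SOME T. T \<in> valids n d l \<kappa> p) q"

lemma third_subset: "third n a \<subseteq> {..<n}" by (auto simp: third_def)

lemma third_disj: "a \<noteq> b \<Longrightarrow> third n a \<inter> third n b = {}"
proof (induction a b rule: linorder_wlog)
  case (le a b)
  then have "(a + 1) * (n div 3) \<le> b * (n div 3)" by (intro mult_right_mono) auto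
  then show ?case by (auto simp: third_def)
next
  case (sym a b) then show ?case by auto
qed

lemma third_disjD: "x \<in> third n a \<Longrightarrow> x \<in> third n b \<Longrightarrow> a = b"
  using third_disj[of a b n] by blast

lemma card_third: "a < 3 \<Longrightarrow> card (third n a) = n div 3"
proof -
  assume "a < 3"
  then have "(a + 1) * (n div 3) \<le> 3 * (n div 3)" by (intro mult_right_mono) auto
  also have "\<dots> \<le> n" by simp
  finally have "third n a = {a * (n div 3)..<(a + 1) * (n div 3)}" by (auto simp: third_def)
  then show ?thesis by simp
qed

lemma vsum_third_cong:
  assumes "\<And>i j. i < n \<Longrightarrow> j < d \<Longrightarrow> q i j = q' i j" "j < d"
  shows "vsum (third n a - T) q j = vsum (third n a - T) q' j"
  using assms third_subset[of n a] by (intro comb_cong) auto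

lemma clone_test_accepts: "clone_test n d (accepts n d l \<kappa> \<tau>1 \<tau>2 fl)"
proof
  fix p q p' q' :: "nat \<Rightarrow> nat \<Rightarrow> real"
  assume p: "\<And>i j. i < n \<Longrightarrow> j < d \<Longrightarrow> p i j = p' i j" and q: "\<And>i j. i < n \<Longrightarrow> j < d \<Longrightarrow> q i j = q' i j"
  have 1: "valids n d l \<kappa> p = valids n d l \<kappa> p'"
    unfolding valids_def using rip_cong[of _ n d p p'] p by blast
  have f: "stat_f n d T q a b = stat_f n d T q' a b" for T a b
    unfolding stat_f_def using q by (intro ip_cong vsum_third_cong)
  have Q: "stat_Q n d T q = stat_Q n d T q'" for T
    unfolding stat_Q_def f using q third_subset[of n 0]
    by (intro sum.cong refl arg_cong2[where f="(-)"] arg_cong2[where f=times] ip_cong vsum_third_cong) auto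
  show "accepts n d l \<kappa> \<tau>1 \<tau>2 fl p q = accepts n d l \<kappa> \<tau>1 \<tau>2 fl p' q'"
    unfolding accepts_def passes_def 1 f Q ..
next
  fix N :: "((nat \<Rightarrow> nat \<Rightarrow> real) \<times> (nat \<Rightarrow> nat \<Rightarrow> real)) measure"
    and p q :: "(nat \<Rightarrow> nat \<Rightarrow> real) \<times> (nat \<Rightarrow> nat \<Rightarrow> real) \<Rightarrow> nat \<Rightarrow> nat \<Rightarrow> real"
  assume p: "\<And>i j. i < n \<Longrightarrow> j < d \<Longrightarrow> (\<lambda>w. p w i j) \<in> borel_measurable N" and q: "\<And>i j. i < n \<Longrightarrow> j < d \<Longrightarrow> (\<lambda>w. q w i j) \<in> borel_measurable N"
  have ripm: "{w\<in>space N. rip n d J l (p w)} \<in> sets N" for J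
    unfolding rip_def
    by (intro sets.sets_Collect_finite_All finite_weights sets.sets_Collect_imp sets.sets_Collect_const borel_measurable_le
        borel_measurable_abs borel_measurable_diff borel_measurable_const measurable_ip measurable_comb p) auto
  have vm: "{w\<in>space N. T \<in> valids n d l \<kappa> (p w)} \<in> sets N" for T
    unfolding valids_def mem_Collect_eq by (intro sets.sets_Collect_conj sets.sets_Collect_const ripm)
  have sum: "(\<lambda>w. vsum (third n a - T) (q w) j) \<in> borel_measurable N" if "j < d" for a T j
    using that third_subset[of n a] by (intro measurable_comb q) auto
  have fm: "(\<lambda>w. stat_f n d T (q w) a b) \<in> borel_measurable N" for T a b
    unfolding stat_f_def by (intro measurable_ip sum)
  have Qm: "(\<lambda>w. stat_Q n d T (q w)) \<in> borel_measurable N" for T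
    unfolding stat_Q_def using third_subset[of n 0]
    by (intro borel_measurable_sum borel_measurable_diff borel_measurable_times borel_measurable_const fm measurable_ip sum q) auto
  have tm: "{w\<in>space N. passes n d \<tau>1 \<tau>2 fl T (q w)} \<in> sets N" for T
    unfolding passes_def
    by (intro sets.sets_Collect_conj sets.sets_Collect_imp sets.sets_Collect_const borel_measurable_le borel_measurable_abs borel_measurable_const fm Qm)
  \<comment> \<open>The chosen set depends only on the family of valid sets, which has finitely many
    possible values \<open>W\<close>; listing them makes the event a finite union of measurable
    ones.\<close>
  have eq: "accepts n d l \<kappa> \<tau>1 \<tau>2 fl p' q' \<longleftrightarrow> (\<exists>W\<in>Pow (Pow {..<n}) - {{}}. (\<forall>T\<in>Pow {..<n}. (T \<in> W) = (T \<in> valids n d l \<kappa> p')) \<and> passes n d \<tau>1 \<tau>2 fl (SOME T. T \<in> W) q')" for p' q'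
  proof -
    have sub: "valids n d l \<kappa> p' \<subseteq> Pow {..<n}" by (auto simp: valids_def)
    have "(\<forall>T\<in>Pow {..<n}. (T \<in> W) = (T \<in> valids n d l \<kappa> p')) \<longleftrightarrow> W = valids n d l \<kappa> p'" if "W \<subseteq> Pow {..<n}" for W
      using that sub by blast
    then show ?thesis unfolding accepts_def using sub by auto
  qed
  show "{w\<in>space N. accepts n d l \<kappa> \<tau>1 \<tau>2 fl (p w) (q w)} \<in> sets N"
    unfolding eq
  proof (intro sets.sets_Collect_finite_Ex sets.sets_Collect_conj sets.sets_Collect_finite_All tm)
    fix W T
    have "{w\<in>space N. (T \<in> W) = (T \<in> valids n d l \<kappa> (p w))} = (if T \<in> W then {w\<in>space N. T \<in> valids n d l \<kappa> (p w)} else space N - {w\<in>space N. T \<in> valids n d l \<kappa> (p w)})"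
      by auto
    then show "{w\<in>space N. (T \<in> W) = (T \<in> valids n d l \<kappa> (p w))} \<in> sets N" using vm by auto
  qed auto
qed

section \<open>Union bounds over integer weights for the first clones\<close>

context prob_space begin

lemma rare_weights:
  fixes c :: real
  assumes B: "\<And>w. {\<omega>\<in>space M. B w \<omega>} \<in> events"
    and p: "\<And>w. support n w \<noteq> {} \<Longrightarrow> P w \<Longrightarrow> prob {\<omega>\<in>space M. B w \<omega>} \<le> 2 * exp (- c * card (support n w))"
    and c: "16 * (real n)\<^sup>2 * exp (- c) \<le> 1/50"
  shows "rare (1/50) (\<lambda>\<omega>. \<forall>w\<in>weights n. support n w \<noteq> {} \<longrightarrow> P w \<longrightarrow> \<not> B w \<omega>)"
proof -
  have e: "{\<omega>\<in>space M. \<not> (\<forall>w\<in>weights n. support n w \<noteq> {} \<longrightarrow> P w \<longrightarrow> \<not> B w \<omega>)} = (\<Union>w\<in>{w\<in>weights n. support n w \<noteq> {} \<and> P w}. {\<omega>\<in>space M. B w \<omega>})"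
    by auto
  have "prob (\<Union>w\<in>{w\<in>weights n. support n w \<noteq> {} \<and> P w}. {\<omega>\<in>space M. B w \<omega>}) \<le> 16 * (real n)\<^sup>2 * exp (- c)"
    using c by (intro weights_union_bound B p) auto
  then show ?thesis unfolding rare_def e using B c by (auto intro!: sets.finite_UN)
qed

end

text \<open>The tail bounds are used with \<open>t = l / 2\<close> and \<open>u\<close> the support
  size, so each nonzero weight gains the exponent \<open>(l - 1) / 16\<close>; \<open>union\<close>
  says that this beats the number of weights.\<close>

locale clones =
  fixes n d :: nat and S :: "nat set" and \<mu> :: "nat \<Rightarrow> real" and l :: real
  assumes l: "2 \<le> l" and S: "S \<subseteq> {..<n}" and union: "16 * (real n)\<^sup>2 * exp (- ((l - 1) / 16)) \<le> 1/50"
begin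

abbreviation "U \<equiv> gauss_field {..<n} d (clone_mean S \<mu>) (clone_sd S)"

sublocale prob_space U by (rule clone.prob_field)

lemma measurable_wcomb: "j < d \<Longrightarrow> (\<lambda>u. wcomb n w u j) \<in> borel_measurable U"
  by (intro measurable_comb measurable_field_component) auto

definition noise_ok :: "(nat \<Rightarrow> nat \<Rightarrow> real) \<Rightarrow> bool" where
  "noise_ok u \<longleftrightarrow> (\<forall>w\<in>weights n. support n w \<noteq> {} \<longrightarrow> support n w \<subseteq> S \<longrightarrow>
     \<not> l / 2 * dev d (card (support n w)) * sqsum n w < \<bar>nsq d (wcomb n w u) - real d * sqsum n w\<bar>)"

definition cross_ok :: "(nat \<Rightarrow> nat \<Rightarrow> real) \<Rightarrow> (nat \<Rightarrow> nat \<Rightarrow> real) \<Rightarrow> bool" where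
  "cross_ok z u \<longleftrightarrow> (\<forall>w\<in>weights n. support n w \<noteq> {} \<longrightarrow> support n w \<subseteq> S \<longrightarrow>
     \<not> 2 * l * card (support n w) * (sqsum n w * nsq d (wcomb n w z)) < (ip d (wcomb n w z) (wcomb n w u))\<^sup>2)"

lemma card_support: "support n w \<noteq> {} \<Longrightarrow> 1 \<le> real (card (support n w))"
  by (simp add: Suc_le_eq card_gt_0_iff)

lemma norm_tail:
  assumes w: "support n w \<noteq> {}" and s: "\<And>i. i \<in> support n w \<Longrightarrow> clone_sd S i = s" "0 < s"
    and m: "\<And>i j. i \<in> support n w \<Longrightarrow> clone_mean S \<mu> i j = 0"
  shows "prob {u\<in>space U. l / 2 * dev d (card (support n w)) * (s\<^sup>2 * sqsum n w) < \<bar>nsq d (wcomb n w u) - real d * (s\<^sup>2 * sqsum n w)\<bar>} \<le> 2 * exp (- ((l - 1) / 16) * card (support n w))"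
proof -
  have e: "comb (support n w) (\<lambda>i. real_of_int (w i)) (\<lambda>i j. u i j - clone_mean S \<mu> i j) = wcomb n w u" for u
    unfolding wcomb_support fun_eq_iff using m by (intro allI comb_cong) auto
  have "prob {u\<in>space U. l / 2 * (sqrt (real d * real (card (support n w))) + real (card (support n w))) * (s\<^sup>2 * (\<Sum>i\<in>support n w. (real_of_int (w i))\<^sup>2)) \<le>
      \<bar>nsq d (comb (support n w) (\<lambda>i. real_of_int (w i)) (\<lambda>i j. u i j - clone_mean S \<mu> i j)) - real d * (s\<^sup>2 * (\<Sum>i\<in>support n w. (real_of_int (w i))\<^sup>2))\<bar>} \<le> 2 * exp (- ((2 * (l / 2) - 1) * real (card (support n w)) / 16))"
    by (rule clone.comb_norm_tail) (use w s l card_support[OF w] sqsum_pos[OF w, unfolded sqsum_support] in \<open>auto simp: support_def\<close>)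
  then have 1: "prob {u\<in>space U. l / 2 * dev d (card (support n w)) * (s\<^sup>2 * sqsum n w) \<le> \<bar>nsq d (wcomb n w u) - real d * (s\<^sup>2 * sqsum n w)\<bar>} \<le> 2 * exp (- ((l - 1) / 16) * card (support n w))"
    unfolding e dev_def sqsum_support by simp
  have "prob {u\<in>space U. l / 2 * dev d (card (support n w)) * (s\<^sup>2 * sqsum n w) < \<bar>nsq d (wcomb n w u) - real d * (s\<^sup>2 * sqsum n w)\<bar>} \<le>
    prob {u\<in>space U. l / 2 * dev d (card (support n w)) * (s\<^sup>2 * sqsum n w) \<le> \<bar>nsq d (wcomb n w u) - real d * (s\<^sup>2 * sqsum n w)\<bar>}"
    by (intro finite_measure_mono borel_measurable_le borel_measurable_const borel_measurable_abs borel_measurable_diff measurable_ip measurable_wcomb) auto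
  with 1 show ?thesis by simp
qed

lemma rare_noise: "rare (1/50) noise_ok"
  unfolding noise_ok_def
proof (rule rare_weights[OF _ _ union])
  fix w
  show "{u\<in>space U. l / 2 * dev d (card (support n w)) * sqsum n w < \<bar>nsq d (wcomb n w u) - real d * sqsum n w\<bar>} \<in> events"
    by (intro borel_measurable_less borel_measurable_const borel_measurable_abs borel_measurable_diff measurable_ip measurable_wcomb)
  assume "support n w \<noteq> {}" "support n w \<subseteq> S"
  then show "prob {u\<in>space U. l / 2 * dev d (card (support n w)) * sqsum n w < \<bar>nsq d (wcomb n w u) - real d * sqsum n w\<bar>} \<le> 2 * exp (- ((l - 1) / 16) * card (support n w))"
    using norm_tail[of w 1] by (auto simp: clone_sd_def clone_mean_def subset_iff)
qed

lemma rare_cross: "rare (1/50) (cross_ok z)"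
  unfolding cross_ok_def
proof (rule rare_weights[OF _ _ union])
  fix w
  show "{u\<in>space U. 2 * l * card (support n w) * (sqsum n w * nsq d (wcomb n w z)) < (ip d (wcomb n w z) (wcomb n w u))\<^sup>2} \<in> events"
    by (intro borel_measurable_less borel_measurable_const borel_measurable_power measurable_ip measurable_wcomb)
  assume w: "support n w \<noteq> {}" "support n w \<subseteq> S"
  have e: "comb (support n w) (\<lambda>i. real_of_int (w i)) (\<lambda>i j. u i j - clone_mean S \<mu> i j) = wcomb n w u" for u
    unfolding wcomb_support fun_eq_iff using w by (intro allI comb_cong) (auto simp: clone_mean_def)
  have "prob {u\<in>space U. 4 * (l / 2) * real (card (support n w)) * (1\<^sup>2 * (\<Sum>i\<in>support n w. (real_of_int (w i))\<^sup>2) * nsq d (wcomb n w z)) <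
      (ip d (wcomb n w z) (comb (support n w) (\<lambda>i. real_of_int (w i)) (\<lambda>i j. u i j - clone_mean S \<mu> i j)))\<^sup>2} \<le> 2 * exp (- ((2 * (l / 2) - 1) * real (card (support n w)) / 16))"
    by (rule clone.weighted_ip_tail) (use w l card_support[OF w(1)] in \<open>auto simp: support_def clone_sd_def\<close>)
  then show "prob {u\<in>space U. 2 * l * card (support n w) * (sqsum n w * nsq d (wcomb n w z)) < (ip d (wcomb n w z) (wcomb n w u))\<^sup>2} \<le> 2 * exp (- ((l - 1) / 16) * card (support n w))"
    unfolding e sqsum_support by simp
qed

text \<open>Restricted to the null hypothesis: a nonzero mean can inflate the combinations of
  uncorrupted rows beyond the tolerance.\<close>

lemma rare_clean_rip:
  assumes \<mu>: "\<And>j. \<mu> j = 0"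
  shows "rare (1/50) (rip n d ({..<n} - S) l)"
proof -
  have "rare (1/50) (\<lambda>u. \<forall>w\<in>weights n. support n w \<noteq> {} \<longrightarrow> support n w \<subseteq> {..<n} - S \<longrightarrow>
     \<not> l * dev d (card (support n w)) * sqsum n w < \<bar>nsq d (wcomb n w u) - 2 * real d * sqsum n w\<bar>)"
  proof (rule rare_weights[OF _ _ union])
    fix w
    show "{u\<in>space U. l * dev d (card (support n w)) * sqsum n w < \<bar>nsq d (wcomb n w u) - 2 * real d * sqsum n w\<bar>} \<in> events"
      by (intro borel_measurable_less borel_measurable_const borel_measurable_abs borel_measurable_diff measurable_ip measurable_wcomb)
    assume "support n w \<noteq> {}" "support n w \<subseteq> {..<n} - S"
    then have "prob {u\<in>space U. l / 2 * dev d (card (support n w)) * ((sqrt 2)\<^sup>2 * sqsum n w) < \<bar>nsq d (wcomb n w u) - real d * ((sqrt 2)\<^sup>2 * sqsum n w)\<bar>} \<le> 2 * exp (- ((l - 1) / 16) * card (support n w))"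
      using \<mu> by (intro norm_tail) (auto simp: clone_sd_def clone_mean_def subset_iff)
    then show "prob {u\<in>space U. l * dev d (card (support n w)) * sqsum n w < \<bar>nsq d (wcomb n w u) - 2 * real d * sqsum n w\<bar>} \<le> 2 * exp (- ((l - 1) / 16) * card (support n w))"
      by (simp add: mult_ac)
  qed
  moreover have "(\<forall>w\<in>weights n. support n w \<noteq> {} \<longrightarrow> support n w \<subseteq> {..<n} - S \<longrightarrow>
     \<not> l * dev d (card (support n w)) * sqsum n w < \<bar>nsq d (wcomb n w u) - 2 * real d * sqsum n w\<bar>) = rip n d ({..<n} - S) l u" for u
  proof -
    have "\<bar>nsq d (wcomb n w u) - 2 * real d * sqsum n w\<bar> \<le> l * dev d (card (support n w)) * sqsum n w" if "support n w = {}" for w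
      using that unfolding sqsum_support wcomb_support by (simp add: ip_def comb_def)
    then show ?thesis unfolding rip_def by (auto simp: not_less)
  qed
  ultimately show ?thesis by simp
qed

end

section \<open>Correctness of the tester under numerical conditions on its parameters\<close>

locale tester_params =
  fixes n d :: nat and \<alpha> \<epsilon> l \<delta> X V :: real and fl :: bool
  assumes n: "100 \<le> n" and d: "1 \<le> d" and \<alpha>: "0 < \<alpha>" and \<epsilon>: "0 < \<epsilon>" "\<epsilon> \<le> 1/100" and l: "2 \<le> l"
    and union: "16 * (real n)\<^sup>2 * exp (- ((l - 1) / 16)) \<le> 1/50"
    and X: "X = (real n)\<^sup>2 * \<alpha>\<^sup>2" and V: "V = real n ^ 3 * \<alpha> ^ 4 / \<epsilon>" and \<delta>: "\<delta> = 1 / 10 ^ 15"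
    and n_sqrt_d: "n * sqrt d \<le> \<delta> * X"
    and dev_small: "17 * l * dev d (\<epsilon> * n) * (\<epsilon> * n) \<le> \<delta> * X"
    and dense: "\<not> fl \<Longrightarrow> (2 * d + 17 * l * dev d (\<epsilon> * n)) * (\<epsilon> * n) \<le> X / 10 ^ 4"
    and sparse: "fl \<Longrightarrow> 10 ^ 5 * (\<epsilon> * n) \<le> n" "fl \<Longrightarrow> (2 * d + 17 * l * dev d (\<epsilon> * n)) * (\<epsilon> * n) \<le> real n * d"
      "fl \<Longrightarrow> real n * sqrt n * d \<le> \<delta> * V"
      "fl \<Longrightarrow> n * sqrt (16 * (17 * l)\<^sup>2 * ((\<epsilon> * n) * (real d)\<^sup>2 + (\<epsilon> * n)\<^sup>2 * d)) \<le> \<delta> * V"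
      "fl \<Longrightarrow> (17 * l * dev d (\<epsilon> * n))\<^sup>2 * (\<epsilon> * n) \<le> \<delta> * V" "fl \<Longrightarrow> (\<epsilon> * n) * X \<le> \<delta> * V"
begin

text \<open>Both thresholds lie between the noise, a moderate multiple of \<open>\<delta>\<close>,
  and the signals: about \<open>X / 16\<close> for an unhidden mean, \<open>V / 8000\<close> for a
  hidden one.\<close>

abbreviation acc :: "(nat \<Rightarrow> nat \<Rightarrow> real) \<Rightarrow> (nat \<Rightarrow> nat \<Rightarrow> real) \<Rightarrow> bool" where
  "acc \<equiv> accepts n d l (\<epsilon> * n) (X / 200) (V / 10 ^ 5) fl"

sublocale clone_test n d acc by (rule clone_test_accepts)

context
  fixes S T :: "nat set" and z u :: "nat \<Rightarrow> nat \<Rightarrow> real" and \<mu> :: "nat \<Rightarrow> real"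
  assumes S: "S \<subseteq> {..<n}" "card S \<le> \<epsilon> * n"
    and T: "T \<in> valids n d l (\<epsilon> * n) (pcl S z u)"
    and noise: "clones.noise_ok n d S l u" and cross: "clones.cross_ok n d S l z u"
begin

text \<open>With \<open>u\<close> frozen and its two noise events granted, \<open>T\<close> is a
  fixed set and only the second clones remain random. The factor 17 is that of
  \<open>rip_other_clone\<close>.\<close>

lemma clean: "clean_noise n d (S - T) (17 * l) (\<epsilon> * n) (\<lambda>i j. z i j - u i j) (\<lambda>a. third n a - T - S) (\<lambda>a. (third n a - T) \<inter> S) (clone_sd S)"
proof
  interpret C: clones n d S \<mu> l by unfold_locales (use l S union in auto)
  have "rip n d (S - T) l (\<lambda>i j. z i j + u i j)"
  proof -
    have "rip n d ({..<n} - T) l (pcl S z u)" using T by (simp add: valids_def)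
    then have "rip n d (S - T) l (pcl S z u)" using S by (rule_tac rip_subset) auto
    then show ?thesis by (subst rip_cong[where X'="pcl S z u"]) (auto simp: pcl_def)
  qed
  then show "rip n d (S - T) (17 * l) (\<lambda>i j. z i j - u i j)"
    by (rule rip_other_clone[OF _ l])
     (use noise cross in \<open>auto simp: C.noise_ok_def C.cross_ok_def not_less\<close>)
  show "real (card (S - T)) \<le> \<epsilon> * n"
    using card_mono[of S "S - T"] S finite_subset[OF S(1)] by fastforce
  show "\<epsilon> * n \<le> n" using \<epsilon> by (simp add: mult_left_le_one_le)
  fix a :: nat assume a: "a < 3"
  have fin: "finite S" "finite T" using S T finite_subset by (auto simp: valids_def)
  have "card (third n a) \<le> card (third n a - T - S) + card T + card S"
  proof -
    have "card (third n a) \<le> card ((third n a - T - S) \<union> T \<union> S)"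
      using fin third_subset[of n a] finite_subset by (intro card_mono) auto
    also have "\<dots> \<le> card (third n a - T - S) + card T + card S"
      using card_Un_le[of "(third n a - T - S) \<union> T" S] card_Un_le[of "third n a - T - S" T] by simp
    finally show ?thesis .
  qed
  then have "real (n div 3) \<le> card (third n a - T - S) + \<epsilon> * n + \<epsilon> * n"
    using S T card_third[OF a, of n] unfolding valids_def by (simp flip: of_nat_add)
  moreover have "n \<le> 3 * (n div 3) + 2" by (simp add: algebra_simps)
  then have "real n \<le> 3 * real (n div 3) + 2" by linarith
  moreover have "\<epsilon> * n \<le> n / 100" using \<epsilon> mult_right_mono[of \<epsilon> "1/100" "real n"] by simp
  \<comment> \<open>A third of the rows loses at most 2/3 of a row by integer division and
    \<open>n / 50\<close> by discarding and corruption.\<close>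
  ultimately show "n / 4 \<le> card (third n a - T - S)" using n by linarith
  show "card (third n a - T - S) \<le> n"
    using card_mono[of "{..<n}" "third n a - T - S"] third_subset[of n a] by auto
qed (use n d l S third_subset third_disjD in \<open>auto simp: clone_sd_def\<close>)

interpretation C: clean_noise n d "S - T" "17 * l" "\<epsilon> * n" "\<lambda>i j. z i j - u i j" "\<lambda>a. third n a - T - S" "\<lambda>a. (third n a - T) \<inter> S" \<mu> "clone_sd S"
  by (rule clean)

lemma split_third: "finite (third n a - T - S)" "finite ((third n a - T) \<inter> S)" "(third n a - T - S) \<inter> ((third n a - T) \<inter> S) = {}"
  "third n a - T = (third n a - T - S) \<union> ((third n a - T) \<inter> S)"
  using finite_subset[OF third_subset[of n a]] by auto

lemma sum_third: "(\<Sum>i\<in>third n a - T. F i) = (\<Sum>i\<in>third n a - T - S. F i) + (\<Sum>i\<in>(third n a - T) \<inter> S. F i)" for F :: "nat \<Rightarrow> real"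
  by (subst split_third(4)) (rule sum.union_disjoint[OF split_third(1-3)])

lemma vsum_eq: "vsum (third n a - T) (qcl S z u m) = C.Y (C.cent m) a"
proof
  fix j
  have "(\<Sum>i\<in>third n a - T - S. 1 * qcl S z u m i j) = (\<Sum>i\<in>third n a - T - S. \<mu> j + (m i j - \<mu> j))"
    by (intro sum.cong) (auto simp: qcl_def)
  also have "\<dots> = C.na a * \<mu> j + C.g (C.cent m) a j"
    by (simp add: C.na_def C.g_def comb_def sum.distrib sum_subtractf)
  moreover have "(\<Sum>i\<in>(third n a - T) \<inter> S. 1 * qcl S z u m i j) = C.z a j"
    unfolding C.z_def comb_def by (intro sum.cong) (auto simp: qcl_def)
  ultimately show "vsum (third n a - T) (qcl S z u m) j = C.Y (C.cent m) a j"
    unfolding C.Y_def comb_def sum_third by simp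
qed

lemma stat_f_eq: "stat_f n d T (qcl S z u m) a b = C.f (C.cent m) a b"
  unfolding stat_f_def vsum_eq C.f_def ..

lemma stat_Q_eq: "stat_Q n d T (qcl S z u m) = C.Q (C.cent m)"
proof -
  have 1: "(\<Sum>i\<in>third n 0 - T - S. ip d (qcl S z u m i) (C.Y (C.cent m) 1) * ip d (qcl S z u m i) (C.Y (C.cent m) 2)) =
     (\<Sum>i\<in>third n 0 - T - S. ip d (\<lambda>j. \<mu> j + (m i j - \<mu> j)) (C.Y (C.cent m) 1) * ip d (\<lambda>j. \<mu> j + (m i j - \<mu> j)) (C.Y (C.cent m) 2))"
    by (intro sum.cong arg_cong2[where f=times] ip_cong) (auto simp: qcl_def)
  have 2: "(\<Sum>i\<in>(third n 0 - T) \<inter> S. ip d (qcl S z u m i) (C.Y (C.cent m) 1) * ip d (qcl S z u m i) (C.Y (C.cent m) 2)) =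
     (\<Sum>i\<in>(third n 0 - T) \<inter> S. ip d (\<lambda>j. z i j - u i j) (C.Y (C.cent m) 1) * ip d (\<lambda>j. z i j - u i j) (C.Y (C.cent m) 2))"
    by (intro sum.cong arg_cong2[where f=times] ip_cong) (auto simp: qcl_def)
  note 3 = sum_third[where a=0 and F="\<lambda>i. ip d (qcl S z u m i) (C.Y (C.cent m) 1) * ip d (qcl S z u m i) (C.Y (C.cent m) 2)", unfolded 1 2]
  have c: "real (card (third n 0 - T)) = C.na 0 + card ((third n 0 - T) \<inter> S)"
    using sum_third[where a=0 and F="\<lambda>_. 1"] by (simp add: C.na_def)
  show ?thesis
    unfolding stat_Q_def vsum_eq stat_f_eq C.Q_def
    by (simp only: sum_subtractf sum_constant c 3 mult_ac)
qed

lemma sizes: "split_sizes n d (S - T) (17 * l) (\<epsilon> * n) (\<lambda>i j. z i j - u i j) (\<lambda>a. third n a - T - S) (\<lambda>a. (third n a - T) \<inter> S) \<alpha> \<epsilon> \<delta> X V"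
  by unfold_locales (use \<epsilon> \<alpha> X V \<delta> n_sqrt_d dev_small in \<open>auto simp: C.\<beta>_def\<close>)

lemma regime: "fl \<Longrightarrow> sparse_regime n d (S - T) (17 * l) (\<epsilon> * n) (\<lambda>i j. z i j - u i j) (\<lambda>a. third n a - T - S) (\<lambda>a. (third n a - T) \<inter> S) \<alpha> \<epsilon> \<delta> X V"
  by (intro sparse_regime.intro sizes sparse_regime_axioms.intro)
    (use sparse in \<open>auto simp: C.\<beta>_def C.\<zeta>2_def\<close>)

lemma good_null:
  assumes "C.good (C.cent m)" "\<And>j. \<mu> j = 0"
  shows "passes n d (X / 200) (V / 10 ^ 5) fl T (qcl S z u m)"
  unfolding passes_def stat_f_eq stat_Q_eq
  using split_sizes.null_f[OF sizes assms(1)] sparse_regime.null_Q[OF regime assms(1)] assms(2) by auto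

text \<open>If the pair tests pass, \<open>large_mean_detected\<close> leaves only means small
  against \<open>\<zeta>2\<close>. Outside the sparse regime \<open>dense\<close> rules these out,
  and inside it \<open>Q\<close> is too large.\<close>

lemma good_alternative:
  assumes "C.good (C.cent m)" "\<alpha>\<^sup>2 \<le> nsq d \<mu>"
  shows "\<not> passes n d (X / 200) (V / 10 ^ 5) fl T (qcl S z u m)"
proof
  assume pass: "passes n d (X / 200) (V / 10 ^ 5) fl T (qcl S z u m)"
  have alt: "\<alpha>\<^sup>2 \<le> C.M2" using assms(2) by (simp add: C.M2_def)
  have f01: "\<bar>C.f (C.cent m) 0 1\<bar> \<le> X / 200" using pass unfolding passes_def stat_f_eq by blast
  have large: "\<not> C.\<zeta>2 \<le> (real n)\<^sup>2 * C.M2 / 10 ^ 4"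
    using split_sizes.large_mean_detected[OF sizes assms(1) alt] f01 by linarith
  have fl
  proof (rule ccontr)
    assume "\<not> fl"
    then have "C.\<zeta>2 \<le> X / 10 ^ 4" using dense by (simp add: C.\<zeta>2_def C.\<beta>_def)
    also have "X \<le> (real n)\<^sup>2 * C.M2" unfolding X using alt by (intro mult_left_mono) auto
    finally show False using large by simp
  qed
  from sparse_regime.moderate_mean_detected[OF regime[OF this] assms(1) alt] pass large \<open>fl\<close>
  show False unfolding passes_def stat_f_eq stat_Q_eq by auto
qed

end

text \<open>The failure budget is 1/50 for each of three events of the first clones and 1/10 for the
  second clones.\<close>

lemma null_case:
  assumes S: "S \<subseteq> {..<n}" "card S \<le> \<epsilon> * n" and z: "z \<in> space (sample_space n d)"
  shows "2/3 \<le> measure (bind (contaminated_samples n d (gaussian d (\<lambda>_. 0)) S z) tester) {Null}"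
proof -
  interpret C: clones n d S "\<lambda>_. 0" l by unfold_locales (use l S union in auto)
  define E where "E u \<longleftrightarrow> C.noise_ok u \<and> C.cross_ok z u \<and> rip n d ({..<n} - S) l u" for u
  have "C.rare (1/50 + (1/50 + 1/50)) E"
    unfolding E_def[abs_def] by (intro C.rare_conj C.rare_noise C.rare_cross C.rare_clean_rip) simp
  then have E: "{u\<in>space C.U. \<not> E u} \<in> C.events" "C.prob {u\<in>space C.U. \<not> E u} \<le> 3/50" by (auto simp: C.rare_def)
  show ?thesis
  proof (rule tester_success[OF z S(1) E, where b="1/10"])
    fix u assume u: "E u"
    define T where "T = (SOME T. T \<in> valids n d l (\<epsilon> * n) (pcl S z u))"
    have "rip n d ({..<n} - S) l (pcl S z u)"
      using u by (subst rip_cong[where X'=u]) (auto simp: E_def pcl_def)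
    \<comment> \<open>Discarding exactly the corrupted rows is admissible, so some valid set exists,
      though the chosen one may differ.\<close>
    then have "S \<in> valids n d l (\<epsilon> * n) (pcl S z u)" using S by (auto simp: valids_def)
    then have T: "T \<in> valids n d l (\<epsilon> * n) (pcl S z u)" unfolding T_def by (rule someI)
    note c = S T conjunct1[OF u[unfolded E_def]] conjunct1[OF conjunct2[OF u[unfolded E_def]]]
    interpret N: clean_noise n d "S - T" "17 * l" "\<epsilon> * n" "\<lambda>i j. z i j - u i j" "\<lambda>a. third n a - T - S" "\<lambda>a. (third n a - T) \<inter> S" "\<lambda>_. 0" "clone_sd S"
      by (rule clean[OF c])
    have "verdict (pcl S z u) (qcl S z u m) = Null" if "N.good (N.cent m)" for m
      using good_null[OF c that] T unfolding verdict_def accepts_def T_def by auto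
    then show "\<exists>P. {m\<in>space N.F. \<not> P m} \<in> sets N.F \<and> measure N.F {m\<in>space N.F. \<not> P m} \<le> 1/10 \<and> (\<forall>m. P m \<longrightarrow> verdict (pcl S z u) (qcl S z u m) = Null)"
      using N.rare_good unfolding N.rare_def by (intro exI[of _ "\<lambda>m. N.good (N.cent m)"]) blast
  qed auto
qed

text \<open>Near-isometry of the uncorrupted rows cannot be expected here. If no valid set exists,
  the verdict is right already; otherwise a valid set constrains the surviving corrupted rows as
  under the null.\<close>

lemma alternative_case:
  assumes S: "S \<subseteq> {..<n}" "card S \<le> \<epsilon> * n" and z: "z \<in> space (sample_space n d)" and \<mu>: "\<alpha> \<le> L2_set \<mu> {..<d}"
  shows "2/3 \<le> measure (bind (contaminated_samples n d (gaussian d \<mu>) S z) tester) {Alternative}"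
proof -
  interpret C: clones n d S \<mu> l by unfold_locales (use l S union in auto)
  have alt: "\<alpha>\<^sup>2 \<le> nsq d \<mu>"
  proof -
    have "\<alpha>\<^sup>2 \<le> (L2_set \<mu> {..<d})\<^sup>2" using \<mu> \<alpha> by (intro power_mono) auto
    then show ?thesis by (simp add: L2_set_def nsq_eq_sum sum_nonneg)
  qed
  define E where "E u \<longleftrightarrow> C.noise_ok u \<and> C.cross_ok z u" for u
  have "C.rare (1/50 + 1/50) E"
    unfolding E_def[abs_def] by (intro C.rare_conj C.rare_noise C.rare_cross)
  then have E: "{u\<in>space C.U. \<not> E u} \<in> C.events" "C.prob {u\<in>space C.U. \<not> E u} \<le> 2/50" by (auto simp: C.rare_def)
  show ?thesis
  proof (rule tester_success[OF z S(1) E, where b="1/10"])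
    fix u assume u: "E u"
    show "\<exists>P. {m\<in>space (gauss_field {..<n} d (\<lambda>_. \<mu>) (clone_sd S)). \<not> P m} \<in> sets (gauss_field {..<n} d (\<lambda>_. \<mu>) (clone_sd S)) \<and>
       measure (gauss_field {..<n} d (\<lambda>_. \<mu>) (clone_sd S)) {m\<in>space (gauss_field {..<n} d (\<lambda>_. \<mu>) (clone_sd S)). \<not> P m} \<le> 1/10 \<and>
       (\<forall>m. P m \<longrightarrow> verdict (pcl S z u) (qcl S z u m) = Alternative)"
    proof (cases "valids n d l (\<epsilon> * n) (pcl S z u) = {}")
      case True
      then have "verdict (pcl S z u) (qcl S z u m) = Alternative" for m unfolding verdict_def accepts_def by simp
      then show ?thesis by (intro exI[of _ "\<lambda>_. True"]) simp
    next
      case False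
      define T where "T = (SOME T. T \<in> valids n d l (\<epsilon> * n) (pcl S z u))"
      have T: "T \<in> valids n d l (\<epsilon> * n) (pcl S z u)" using False unfolding T_def by (rule some_in_eq[THEN iffD2])
      note c = S T conjunct1[OF u[unfolded E_def]] conjunct2[OF u[unfolded E_def]]
      interpret N: clean_noise n d "S - T" "17 * l" "\<epsilon> * n" "\<lambda>i j. z i j - u i j" "\<lambda>a. third n a - T - S" "\<lambda>a. (third n a - T) \<inter> S" \<mu> "clone_sd S"
        by (rule clean[OF c])
      have "verdict (pcl S z u) (qcl S z u m) = Alternative" if "N.good (N.cent m)" for m
        using good_alternative[OF c that alt] unfolding verdict_def accepts_def T_def by auto
      then show ?thesis using N.rare_good unfolding N.rare_def by (intro exI[of _ "\<lambda>m. N.good (N.cent m)"]) blast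
    qed
  qed auto
qed

lemma robust_tester: "oblivious_robust_mean_tester n d \<alpha> \<epsilon> tester"
  unfolding oblivious_robust_mean_tester_def adversary_def
  using measurable_tester null_case alternative_case by auto

end

section \<open>Sample sizes\<close>

lemma sample_bound_ge:
  assumes "0 < \<alpha>" "0 < \<epsilon>"
  shows "sqrt (real d) / \<alpha>\<^sup>2 \<le> sample_bound d \<alpha> \<epsilon>" "real d * \<epsilon> ^ 3 / \<alpha> ^ 4 \<le> sample_bound d \<alpha> \<epsilon>"
    "min (real d powr (2/3) * \<epsilon> powr (2/3) / \<alpha> powr (8/3)) (real d * \<epsilon> / \<alpha>\<^sup>2) \<le> sample_bound d \<alpha> \<epsilon>"
proof -
  have "0 \<le> sqrt (real d) / \<alpha>\<^sup>2" "0 \<le> real d * \<epsilon> ^ 3 / \<alpha> ^ 4"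
    "0 \<le> min (real d powr (2/3) * \<epsilon> powr (2/3) / \<alpha> powr (8/3)) (real d * \<epsilon> / \<alpha>\<^sup>2)"
    using assms by auto
  then show "sqrt (real d) / \<alpha>\<^sup>2 \<le> sample_bound d \<alpha> \<epsilon>" "real d * \<epsilon> ^ 3 / \<alpha> ^ 4 \<le> sample_bound d \<alpha> \<epsilon>"
    "min (real d powr (2/3) * \<epsilon> powr (2/3) / \<alpha> powr (8/3)) (real d * \<epsilon> / \<alpha>\<^sup>2) \<le> sample_bound d \<alpha> \<epsilon>"
    unfolding sample_bound_def by linarith+
qed

text \<open>Cubing clears the fractional exponents, so the comparison can be made with integer
  powers.\<close>

lemma sparse_bound_cube:
  assumes "0 < \<alpha>" "0 < \<epsilon>" "1 \<le> d"
  shows "(real d powr (2/3) * \<epsilon> powr (2/3) / \<alpha> powr (8/3)) ^ 3 = (real d * \<epsilon> / \<alpha> ^ 4)\<^sup>2"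
proof -
  have "(x powr (2/3)) ^ 3 = x\<^sup>2" "(x powr (8/3)) ^ 3 = x ^ 8" if "0 < x" for x :: real
    using that by (simp_all add: powr_power)
  then have "(real d powr (2/3) * \<epsilon> powr (2/3) / \<alpha> powr (8/3)) ^ 3 = (real d)\<^sup>2 * \<epsilon>\<^sup>2 / \<alpha> ^ 8"
    using assms by (simp add: power_mult_distrib power_divide)
  then show ?thesis by (simp add: power_mult_distrib power_divide flip: power_mult)
qed

text \<open>Trades the polylogarithmic surplus \<open>K\<close> for a factor \<open>a\<close> and
  the constant \<open>\<delta>\<close>.\<close>

lemma le_scaled:
  fixes K a y V :: real
  assumes "K * y \<le> V" "a * 10 ^ 15 \<le> K" "0 \<le> y"
  shows "a * y \<le> 1 / 10 ^ 15 * V"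
proof -
  have "a * 10 ^ 15 * y \<le> K * y" using assms by (intro mult_right_mono)
  then show ?thesis using assms(1) by (simp add: field_simps)
qed

text \<open>The factor \<open>L\<^sup>2\<close> brings the union bound to
  \<open>exp (- 3 L)\<close>, which is \<open>(n d)^(-3)\<close>. The exponent 20 is dictated by
  \<open>dev_small\<close>: only the square root \<open>L ^ 10\<close> of the surplus survives
  there, \<open>L\<^sup>2\<close> of it pays for the deviation factor and \<open>L ^ 8\<close>, at
  least \<open>10 ^ 32\<close>, for the constants. The flag compares \<open>n\<close> with the
  second argument of the minimum.\<close>

lemma tester_params_polylog:
  fixes n d :: nat and \<alpha> \<epsilon> L :: real
  assumes d: "1 \<le> d" and \<alpha>: "0 < \<alpha>" "\<alpha> \<le> 1" and \<epsilon>: "0 < \<epsilon>" and L: "L = ln (real n * real d)" "10 ^ 4 \<le> L"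
    and ratio: "\<epsilon> * L ^ 20 \<le> \<alpha>" and n: "L ^ 20 * sample_bound d \<alpha> \<epsilon> \<le> n"
  shows "tester_params n d \<alpha> \<epsilon> (L\<^sup>2) (1 / 10 ^ 15) ((real n)\<^sup>2 * \<alpha>\<^sup>2) (real n ^ 3 * \<alpha> ^ 4 / \<epsilon>) (n * \<alpha>\<^sup>2 < L ^ 20 * (d * \<epsilon>))"
proof -
  define \<kappa> where "\<kappa> = \<epsilon> * n"
  define X where "X = (real n)\<^sup>2 * \<alpha>\<^sup>2"
  define V where "V = real n ^ 3 * \<alpha> ^ 4 / \<epsilon>"
  define K where "K = L ^ 20"
  have L1: "1 \<le> L" using L(2) by simp
  have L0: "0 < L" using L1 by simp
  have L4: "10 ^ 16 \<le> L ^ 4" using power_mono[OF L(2), of 4] by simp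
  have L8: "10 ^ 32 \<le> L ^ 8" using power_mono[OF L(2), of 8] by simp
  have K16: "L ^ 16 * L ^ 4 = K" unfolding K_def by (simp flip: power_add)
  have L16: "1 \<le> L ^ 16" using L1 by (rule one_le_power)
  have K: "10 ^ 16 \<le> K"
    using mult_mono[OF L16 L4] L0 K16 by simp
  have Lpow: "L ^ a \<le> L ^ b" if "a \<le> b" for a b using that L1 by (rule power_increasing)
  have npos: "0 < n"
  proof (rule ccontr)
    assume "\<not> 0 < n" then have "L = 0" using L by simp then show False using L0 by simp
  qed
  have nd: "exp L = real n * real d" using L npos d by simp
  have SBg: "K * x \<le> n" if "x \<le> sample_bound d \<alpha> \<epsilon>" for x
  proof -
    have "K * x \<le> K * sample_bound d \<alpha> \<epsilon>" using that K by (intro mult_left_mono) auto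
    then show ?thesis using n by (simp add: K_def)
  qed
  have SB: "K * (sqrt d / \<alpha>\<^sup>2) \<le> n" "K * (real d * \<epsilon> ^ 3 / \<alpha> ^ 4) \<le> n"
    "K * min (real d powr (2/3) * \<epsilon> powr (2/3) / \<alpha> powr (8/3)) (real d * \<epsilon> / \<alpha>\<^sup>2) \<le> n"
    by (intro SBg sample_bound_ge \<alpha> \<epsilon>)+
  have H1: "K * sqrt d \<le> n * \<alpha>\<^sup>2" using SB(1) \<alpha> by (simp add: field_simps)
  have H2: "K * (d * \<epsilon> ^ 3) \<le> n * \<alpha> ^ 4" using SB(2) \<alpha> by (simp add: field_simps)
  have a2: "\<alpha>\<^sup>2 \<le> 1" using \<alpha> by (simp add: power_le_one)
  have nK: "K \<le> n"
  proof -
    have "K * 1 \<le> K * sqrt d" using d K by (intro mult_left_mono) auto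
    also have "\<dots> \<le> n * \<alpha>\<^sup>2" by (rule H1)
    also have "\<dots> \<le> real n * 1" using a2 by (intro mult_left_mono) auto
    finally show ?thesis by simp
  qed
  have eK: "\<epsilon> * K \<le> \<alpha>" using ratio by (simp add: K_def)
  have eK1: "\<epsilon> * K \<le> 1" using eK \<alpha> by simp
  have e1: "\<epsilon> \<le> 1 / 10 ^ 16"
  proof -
    have "\<epsilon> * 10 ^ 16 \<le> \<epsilon> * K" using K \<epsilon> by (intro mult_left_mono) auto
    then show ?thesis using eK1 by simp
  qed
  have e2: "\<epsilon>\<^sup>2 * (K * K) \<le> \<alpha>\<^sup>2"
  proof -
    have "(\<epsilon> * K)\<^sup>2 \<le> \<alpha>\<^sup>2" using eK \<epsilon> K by (intro power_mono) auto
    then show ?thesis by (simp add: power2_eq_square mult_ac)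
  qed
  have e2K: "\<epsilon>\<^sup>2 * K \<le> \<alpha>\<^sup>2"
  proof -
    have "\<epsilon>\<^sup>2 * (K * 1) \<le> \<epsilon>\<^sup>2 * (K * K)" using K by (intro mult_left_mono) auto
    then show ?thesis using e2 by simp
  qed
  have X0: "0 < X" and V0: "0 < V" using npos \<alpha> \<epsilon> by (auto simp: X_def V_def)
  have \<kappa>0: "0 \<le> \<kappa>" using \<epsilon> by (simp add: \<kappa>_def)
  have \<kappa>2: "\<kappa>\<^sup>2 * K \<le> X"
  proof -
    have "(real n)\<^sup>2 * (\<epsilon>\<^sup>2 * K) \<le> (real n)\<^sup>2 * \<alpha>\<^sup>2" using e2K by (intro mult_left_mono) auto
    then show ?thesis by (simp add: \<kappa>_def X_def power_mult_distrib mult_ac)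
  qed
  \<comment> \<open>Squaring turns the claim into the bound \<open>H2\<close> from the term
    \<open>d \<epsilon>^3 / \<alpha>^4\<close>; hence only half the exponent of \<open>K\<close> is
    available.\<close>
  have dk: "sqrt (d * \<kappa>) * \<kappa> * L ^ 10 \<le> X"
  proof (rule power2_le_imp_le)
    have "(sqrt (d * \<kappa>) * \<kappa> * L ^ 10)\<^sup>2 = (d * \<kappa>) * \<kappa>\<^sup>2 * K"
      using \<kappa>0 by (simp add: power_mult_distrib K_def flip: power_mult)
    also have "\<dots> = real n ^ 3 * (K * (d * \<epsilon> ^ 3))" by (simp add: \<kappa>_def power2_eq_square power3_eq_cube)
    also have "\<dots> \<le> real n ^ 3 * (n * \<alpha> ^ 4)" using H2 by (intro mult_left_mono) auto
    also have "\<dots> = X\<^sup>2" by (simp add: X_def power2_eq_square power3_eq_cube power4_eq_xxxx)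
    finally show "(sqrt (d * \<kappa>) * \<kappa> * L ^ 10)\<^sup>2 \<le> X\<^sup>2" .
  qed (use X0 in simp)
  have dev_small: "17 * L\<^sup>2 * dev d \<kappa> * \<kappa> \<le> 1 / 10 ^ 15 * X"
  proof -
    have L10: "L ^ 8 * (L\<^sup>2 * y) = y * L ^ 10" for y
      unfolding mult.assoc[symmetric] power_add[symmetric] by (simp add: mult.commute)
    have "L ^ 8 * (L\<^sup>2 * (sqrt (d * \<kappa>) * \<kappa>)) \<le> X" using dk unfolding L10 .
    moreover have "L ^ 8 * (L\<^sup>2 * \<kappa>\<^sup>2) \<le> X"
    proof -
      have "\<kappa>\<^sup>2 * L ^ 10 \<le> \<kappa>\<^sup>2 * K" unfolding K_def by (intro mult_left_mono Lpow) auto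
      then show ?thesis using \<kappa>2 unfolding L10 by linarith
    qed
    ultimately have "L ^ 8 * (L\<^sup>2 * dev d \<kappa> * \<kappa>) \<le> 2 * X" by (simp add: dev_def algebra_simps power2_eq_square)
    moreover have "10 ^ 32 * (L\<^sup>2 * dev d \<kappa> * \<kappa>) \<le> L ^ 8 * (L\<^sup>2 * dev d \<kappa> * \<kappa>)"
      using L8 \<kappa>0 by (intro mult_right_mono) auto
    ultimately show ?thesis using X0 by simp
  qed
  have sparse: "10 ^ 5 * \<kappa> \<le> n \<and> (2 * d + 17 * L\<^sup>2 * dev d \<kappa>) * \<kappa> \<le> real n * d \<and> real n * sqrt n * d \<le> 1 / 10 ^ 15 * V \<and>
     n * sqrt (16 * (17 * L\<^sup>2)\<^sup>2 * (\<kappa> * (real d)\<^sup>2 + \<kappa>\<^sup>2 * d)) \<le> 1 / 10 ^ 15 * V \<and>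
     (17 * L\<^sup>2 * dev d \<kappa>)\<^sup>2 * \<kappa> \<le> 1 / 10 ^ 15 * V \<and> \<kappa> * X \<le> 1 / 10 ^ 15 * V" if fl: "n * \<alpha>\<^sup>2 < K * (d * \<epsilon>)"
  proof -
    \<comment> \<open>A small sample with \<epsilon> far below \<alpha> has fewer corrupted rows
      than dimensions, so \<open>dev d \<kappa>\<close> is of order
      \<open>sqrt (d * \<kappa>)\<close>.\<close>
    have \<kappa>d: "\<kappa> \<le> d"
    proof -
      have "\<kappa> * \<alpha>\<^sup>2 \<le> \<epsilon> * (K * (d * \<epsilon>))" using fl \<epsilon> by (simp add: \<kappa>_def mult_ac)
      also have "\<dots> = d * (\<epsilon>\<^sup>2 * K)" by (simp add: power2_eq_square)
      also have "\<dots> \<le> d * \<alpha>\<^sup>2" using e2K by (intro mult_left_mono) auto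
      finally show ?thesis using \<alpha> by simp
    qed
    have \<kappa>n: "10 ^ 16 * \<kappa> \<le> n"
    proof -
      have "real n * (10 ^ 16 * \<epsilon>) \<le> real n * 1" using e1 by (intro mult_left_mono) auto
      then show ?thesis by (simp add: \<kappa>_def mult_ac)
    qed
    have sd: "sqrt (d * \<kappa>) \<le> d" using \<kappa>d \<kappa>0 by (intro real_le_lsqrt) (auto simp: power2_eq_square intro: mult_left_mono)
    have devd: "dev d \<kappa> \<le> 2 * d" using sd \<kappa>d by (simp add: dev_def)
    have s2: "(2 * d + 17 * L\<^sup>2 * dev d \<kappa>) * \<kappa> \<le> real n * d"
    proof -
      have "17 * L\<^sup>2 * dev d \<kappa> \<le> 17 * L\<^sup>2 * (2 * d)" using devd by (intro mult_left_mono) auto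
      moreover have "2 * real d * 1 \<le> 2 * real d * L\<^sup>2" using L1 by (intro mult_left_mono) (auto simp: one_le_power)
      ultimately have "(2 * d + 17 * L\<^sup>2 * dev d \<kappa>) \<le> 36 * L\<^sup>2 * d" by (simp add: mult_ac)
      then have "(2 * d + 17 * L\<^sup>2 * dev d \<kappa>) * \<kappa> \<le> 36 * L\<^sup>2 * d * \<kappa>" using \<kappa>0 by (intro mult_right_mono)
      also have "\<dots> = (real n * d) * (36 * L\<^sup>2 * \<epsilon>)" by (simp add: \<kappa>_def)
      also have "\<dots> \<le> (real n * d) * 1"
      proof (rule mult_left_mono)
        have "36 * L\<^sup>2 \<le> L ^ 18 * L\<^sup>2" using L8 Lpow[of 8 18] by (intro mult_right_mono) auto
        also have "\<dots> = K" by (simp add: K_def flip: power_add)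
        finally have "\<epsilon> * (36 * L\<^sup>2) \<le> \<epsilon> * K" using \<epsilon> by (intro mult_left_mono) auto
        then show "36 * L\<^sup>2 * \<epsilon> \<le> 1" using eK1 by (simp add: mult_ac)
      qed simp
      finally show ?thesis by simp
    qed
    have H3: "K * (d * \<epsilon>) \<le> n * sqrt n * \<alpha> ^ 4"
    proof -
      let ?A = "real d powr (2/3) * \<epsilon> powr (2/3) / \<alpha> powr (8/3)" and ?B = "real d * \<epsilon> / \<alpha>\<^sup>2"
      \<comment> \<open>The flag says that \<open>n\<close> misses the second argument of the
        minimum, so the hypothesis on \<open>n\<close> is about the first.\<close>
      have "n < K * ?B" using fl \<alpha> by (simp add: field_simps)
      then have "K * min ?A ?B < K * ?B" using SB(3) by linarith
      then have "min ?A ?B = ?A" using K by (auto simp: min_def split: if_splits)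
      then have A: "K * ?A \<le> n" using SB(3) by simp
      have "(K * ?A) ^ 3 \<le> real n ^ 3" using A K \<alpha> \<epsilon> by (intro power_mono) auto
      then have cube: "K ^ 3 * (real d * \<epsilon> / \<alpha> ^ 4)\<^sup>2 \<le> real n ^ 3"
        unfolding power_mult_distrib[of K ?A] sparse_bound_cube[OF \<alpha>(1) \<epsilon> d] .
      have "(K * (real d * \<epsilon> / \<alpha> ^ 4))\<^sup>2 \<le> (n * sqrt n)\<^sup>2"
      proof -
        have "K\<^sup>2 \<le> K ^ 3" using K by (intro power_increasing) auto
        then have "K\<^sup>2 * (real d * \<epsilon> / \<alpha> ^ 4)\<^sup>2 \<le> K ^ 3 * (real d * \<epsilon> / \<alpha> ^ 4)\<^sup>2" by (intro mult_right_mono) auto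
        moreover have "(n * sqrt n)\<^sup>2 = real n ^ 3" by (simp add: power_mult_distrib power3_eq_cube power2_eq_square)
        ultimately show ?thesis using cube unfolding power_mult_distrib[of K] by linarith
      qed
      then have "K * (real d * \<epsilon> / \<alpha> ^ 4) \<le> n * sqrt n" by (rule power2_le_imp_le) auto
      then show ?thesis using \<alpha> by (simp add: field_simps)
    qed
    have VK: "K * (n * sqrt n * d) \<le> V"
    proof -
      have "(real n * sqrt n) * (K * (d * \<epsilon>)) \<le> (n * sqrt n) * (n * sqrt n * \<alpha> ^ 4)" by (intro mult_left_mono H3) auto
      also have "\<dots> = real n * real n * (sqrt n * sqrt n) * \<alpha> ^ 4" by (simp only: mult_ac)
      also have "\<dots> = V * \<epsilon>" using \<epsilon> by (simp add: V_def power3_eq_cube)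
      finally have "\<epsilon> * (K * (n * sqrt n * d)) \<le> \<epsilon> * V" by (simp add: mult_ac)
      then show ?thesis using \<epsilon> by simp
    qed
    have r1: "real n * sqrt n * d \<le> 1 / 10 ^ 15 * V"
      using le_scaled[OF VK, of 1] K by simp
    have r2: "n * sqrt (16 * (17 * L\<^sup>2)\<^sup>2 * (\<kappa> * (real d)\<^sup>2 + \<kappa>\<^sup>2 * d)) \<le> 1 / 10 ^ 15 * V"
    proof -
      have "\<kappa> * (real d)\<^sup>2 + \<kappa>\<^sup>2 * d \<le> 2 * (n * (real d)\<^sup>2)"
      proof -
        have "\<kappa>\<^sup>2 * d = \<kappa> * d * \<kappa>" by (simp add: power2_eq_square)
        also have "\<dots> \<le> \<kappa> * d * d" using \<kappa>d \<kappa>0 by (intro mult_left_mono) auto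
        finally have "\<kappa>\<^sup>2 * d \<le> \<kappa> * (real d)\<^sup>2" by (simp add: power2_eq_square)
        moreover have "\<kappa> * (real d)\<^sup>2 \<le> n * (real d)\<^sup>2" using \<kappa>n \<kappa>0 by (intro mult_right_mono) auto
        ultimately show ?thesis by linarith
      qed
      then have "16 * (17 * L\<^sup>2)\<^sup>2 * (\<kappa> * (real d)\<^sup>2 + \<kappa>\<^sup>2 * d) \<le> 16 * (17 * L\<^sup>2)\<^sup>2 * (2 * (n * (real d)\<^sup>2))" by (intro mult_left_mono) auto
      also have "\<dots> = 9248 * ((L\<^sup>2)\<^sup>2 * (n * (real d)\<^sup>2))" by (simp add: power_mult_distrib)
      also have "\<dots> \<le> 10000 * ((L\<^sup>2)\<^sup>2 * (n * (real d)\<^sup>2))" by (intro mult_right_mono) auto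
      also have "\<dots> = (100 * L\<^sup>2 * (sqrt n * d))\<^sup>2" by (simp add: power_mult_distrib)
      finally have "sqrt (16 * (17 * L\<^sup>2)\<^sup>2 * (\<kappa> * (real d)\<^sup>2 + \<kappa>\<^sup>2 * d)) \<le> 100 * L\<^sup>2 * (sqrt n * d)" by (intro real_le_lsqrt) auto
      then have "n * sqrt (16 * (17 * L\<^sup>2)\<^sup>2 * (\<kappa> * (real d)\<^sup>2 + \<kappa>\<^sup>2 * d)) \<le> n * (100 * L\<^sup>2 * (sqrt n * d))" by (intro mult_left_mono) auto
      also have "\<dots> = 100 * (L\<^sup>2 * (n * sqrt n * d))" by (simp only: mult_ac)
      also have "\<dots> \<le> 1 / 10 ^ 15 * V"
      proof -
        have "10 ^ 32 * L\<^sup>2 \<le> L ^ 18 * L\<^sup>2" using L8 Lpow[of 8 18] by (intro mult_right_mono) auto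
        also have "\<dots> = K" by (simp add: K_def flip: power_add)
        finally have "100 * L\<^sup>2 * 10 ^ 15 \<le> K" by (rule order_trans[rotated]) simp
        from le_scaled[OF VK this] show ?thesis by (simp add: mult.assoc)
      qed
      finally show ?thesis .
    qed
    have VK2: "K * (d * \<kappa>\<^sup>2) \<le> V"
    proof -
      have "(real n)\<^sup>2 * (K * (d * \<epsilon> ^ 3)) \<le> (real n)\<^sup>2 * (n * \<alpha> ^ 4)" by (intro mult_left_mono H2) auto
      moreover have "(real n)\<^sup>2 * (K * (d * \<epsilon> ^ 3)) = \<epsilon> * (K * (d * \<kappa>\<^sup>2))"
        by (simp add: \<kappa>_def power2_eq_square power3_eq_cube)
      moreover have "(real n)\<^sup>2 * (n * \<alpha> ^ 4) = \<epsilon> * V" using \<epsilon> by (simp add: V_def power2_eq_square power3_eq_cube)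
      ultimately show ?thesis using \<epsilon> by simp
    qed
    have r3: "(17 * L\<^sup>2 * dev d \<kappa>)\<^sup>2 * \<kappa> \<le> 1 / 10 ^ 15 * V"
    proof -
      have "(dev d \<kappa>)\<^sup>2 \<le> 4 * (d * \<kappa>)"
      proof -
        have "\<kappa> \<le> sqrt (d * \<kappa>)" using \<kappa>d \<kappa>0 by (intro real_le_rsqrt) (auto simp: power2_eq_square intro: mult_right_mono)
        then have "dev d \<kappa> \<le> 2 * sqrt (d * \<kappa>)" by (simp add: dev_def)
        then have "(dev d \<kappa>)\<^sup>2 \<le> (2 * sqrt (d * \<kappa>))\<^sup>2" using \<kappa>0 by (intro power_mono) auto
        then show ?thesis using \<kappa>0 by (simp add: power_mult_distrib)
      qed
      then have "(17 * L\<^sup>2)\<^sup>2 * (dev d \<kappa>)\<^sup>2 * \<kappa> \<le> (17 * L\<^sup>2)\<^sup>2 * (4 * (d * \<kappa>)) * \<kappa>"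
        using \<kappa>0 by (intro mult_right_mono mult_left_mono) auto
      also have "\<dots> = 1156 * (L ^ 4 * (d * \<kappa>\<^sup>2))" by (simp add: power_mult_distrib power2_eq_square power4_eq_xxxx)
      also have "\<dots> \<le> 1 / 10 ^ 15 * V"
      proof -
        have "10 ^ 32 * L ^ 4 \<le> L ^ 16 * L ^ 4" using L8 Lpow[of 8 16] by (intro mult_right_mono) auto
        then have "1156 * L ^ 4 * 10 ^ 15 \<le> K" unfolding K16 by (rule order_trans[rotated]) simp
        from le_scaled[OF VK2 this] show ?thesis by (simp add: mult.assoc)
      qed
      finally show ?thesis by (simp add: power_mult_distrib)
    qed
    have r4: "\<kappa> * X \<le> 1 / 10 ^ 15 * V"
    proof -
      have "real n ^ 3 * \<alpha>\<^sup>2 * (\<epsilon>\<^sup>2 * K) \<le> real n ^ 3 * \<alpha>\<^sup>2 * \<alpha>\<^sup>2" using e2K by (intro mult_left_mono) auto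
      also have "\<dots> = \<epsilon> * V" using \<epsilon> by (simp add: V_def power2_eq_square power4_eq_xxxx)
      also have "real n ^ 3 * \<alpha>\<^sup>2 * (\<epsilon>\<^sup>2 * K) = \<epsilon> * (K * (\<kappa> * X))"
        by (simp add: \<kappa>_def X_def power2_eq_square power3_eq_cube)
      finally have KV: "K * (\<kappa> * X) \<le> V" using \<epsilon> by simp
      have "1 * (\<kappa> * X) \<le> 1 / 10 ^ 15 * V" using K \<kappa>0 X0 by (intro le_scaled[OF KV]) auto
      then show ?thesis by simp
    qed
    show ?thesis using \<kappa>n \<kappa>0 s2 r1 r2 r3 r4 by simp
  qed
  show ?thesis
  proof
    have "(100::real) \<le> n" using nK K by simp
    then show "100 \<le> n" by linarith
    show "1 \<le> d" "0 < \<alpha>" "0 < \<epsilon>" by fact+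
    show "\<epsilon> \<le> 1 / 100" using e1 by simp
    show "2 \<le> L\<^sup>2" using power_mono[OF L(2), of 2] by simp
    show "16 * (real n)\<^sup>2 * exp (- ((L\<^sup>2 - 1) / 16)) \<le> 1 / 50"
    proof -
      \<comment> \<open>Since \<open>L \<ge> 10 ^ 4\<close>, the quadratic exponent exceeds
        \<open>3 * L\<close>, which is enough against the \<open>n\<^sup>2\<close> of the union
        bound.\<close>
      have "L * 10000 \<le> L * L" using L(2) L0 by (intro mult_left_mono) auto
      then have "48 * L + 1 \<le> L * L" using L1 by linarith
      then have "3 * L \<le> (L\<^sup>2 - 1) / 16" by (simp add: power2_eq_square)
      then have "exp (- ((L\<^sup>2 - 1) / 16)) \<le> exp (- (3 * L))" by simp
      also have "\<dots> = 1 / (real n * real d) ^ 3"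
      proof -
        have "exp (3 * L) = exp L ^ 3" using exp_of_nat_mult[of 3 L] by simp
        then show ?thesis by (simp add: exp_minus nd inverse_eq_divide)
      qed
      also have "\<dots> \<le> 1 / real n ^ 3"
        using npos d by (intro divide_left_mono power_mono) (auto simp: mult_le_cancel_left1)
      finally have "16 * (real n)\<^sup>2 * exp (- ((L\<^sup>2 - 1) / 16)) \<le> 16 * (real n)\<^sup>2 * (1 / real n ^ 3)"
        by (intro mult_left_mono) auto
      also have "\<dots> = 16 / n" using npos by (simp add: power2_eq_square power3_eq_cube)
      also have "\<dots> \<le> 1 / 50" using nK K npos by (simp add: field_simps)
      finally show ?thesis .
    qed
    show "n * sqrt d \<le> 1 / 10 ^ 15 * ((real n)\<^sup>2 * \<alpha>\<^sup>2)"
    proof -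
      have "n * (K * sqrt d) \<le> n * (n * \<alpha>\<^sup>2)" by (intro mult_left_mono H1) auto
      then have "K * (n * sqrt d) \<le> (real n)\<^sup>2 * \<alpha>\<^sup>2" by (simp add: power2_eq_square mult_ac)
      then have "1 * (n * sqrt d) \<le> 1 / 10 ^ 15 * ((real n)\<^sup>2 * \<alpha>\<^sup>2)" using K by (intro le_scaled) auto
      then show ?thesis by simp
    qed
    show "17 * L\<^sup>2 * dev d (\<epsilon> * n) * (\<epsilon> * n) \<le> 1 / 10 ^ 15 * ((real n)\<^sup>2 * \<alpha>\<^sup>2)"
      using dev_small unfolding \<kappa>_def X_def .
    show "(2 * d + 17 * L\<^sup>2 * dev d (\<epsilon> * n)) * (\<epsilon> * n) \<le> (real n)\<^sup>2 * \<alpha>\<^sup>2 / 10 ^ 4" if "\<not> n * \<alpha>\<^sup>2 < L ^ 20 * (d * \<epsilon>)"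
    proof -
      have "n * (K * (d * \<epsilon>)) \<le> n * (n * \<alpha>\<^sup>2)" using that unfolding K_def by (intro mult_left_mono) auto
      then have "K * (d * \<kappa>) \<le> X" by (simp add: \<kappa>_def X_def power2_eq_square mult_ac)
      then have "1 * (d * \<kappa>) \<le> 1 / 10 ^ 15 * X" using K \<kappa>0 by (intro le_scaled) auto
      then have "2 * (d * \<kappa>) + 17 * L\<^sup>2 * dev d \<kappa> * \<kappa> \<le> X / 10 ^ 4"
        using dev_small X0 by simp
      then have "(2 * d + 17 * L\<^sup>2 * dev d \<kappa>) * \<kappa> \<le> X / 10 ^ 4" by (simp add: distrib_right)
      then show ?thesis unfolding \<kappa>_def X_def .
    qed
  qed (use sparse in \<open>auto simp: K_def \<kappa>_def X_def V_def\<close>)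
qed

text \<open>In dimension 0 every mean has norm 0, below \<alpha>, so the alternative is empty and
  constant acceptance succeeds. The case stands apart because \<open>ln 0 = 0\<close> deprives the
  logarithmic conditions of content.\<close>

lemma trivial_tester:
  assumes "0 < \<alpha>"
  shows "\<exists>T. oblivious_robust_mean_tester n 0 \<alpha> \<epsilon> T"
proof -
  interpret clone_test n 0 "\<lambda>_ _. True" by unfold_locales auto
  have "2/3 \<le> measure (bind (contaminated_samples n 0 (gaussian 0 (\<lambda>_. 0)) S z) tester) {Null}"
    if "S \<subseteq> {..<n}" "z \<in> space (sample_space n 0)" for S z
    by (rule tester_success[OF that(2,1), where E="\<lambda>_. True" and a=0 and b=0])
     (auto simp: verdict_def intro!: exI[of _ "\<lambda>_. True"])
  then show ?thesis
    unfolding oblivious_robust_mean_tester_def adversary_def using measurable_tester assms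
    by (intro exI[of _ tester]) auto
qed

text \<open>Both exponents are the 20 of \<open>tester_params_polylog\<close>. As
  \<open>sample_bound\<close> is at least 1 for \<open>d \<ge> 1\<close>, the constant
  \<open>exp (10 ^ 4)\<close> forces \<open>n\<close> to be that large and hence
  \<open>L \<ge> 10 ^ 4\<close>, which absorbs all numerical constants.\<close>

theorem theorem4p1:
  shows "\<exists>(C::real) (k::nat) (m::nat). C > 0 \<and>
    (\<forall>(n::nat) (d::nat) (\<alpha>::real) (\<epsilon>::real).
       \<alpha> > 0 \<longrightarrow> \<epsilon> > 0 \<longrightarrow>
       1 \<ge> \<alpha> \<longrightarrow> \<alpha> \<ge> \<epsilon> * ln (real n * real d) ^ m \<longrightarrow>
       real n \<ge> polylog_factor C k n d \<alpha> \<epsilon> * sample_bound d \<alpha> \<epsilon> \<longrightarrow>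
       (\<exists>T. oblivious_robust_mean_tester n d \<alpha> \<epsilon> T))"
proof (intro exI[of _ "exp (10 ^ 4)"] exI[of _ 20] conjI allI impI)
  fix n d :: nat and \<alpha> \<epsilon> :: real
  assume \<alpha>: "\<alpha> > 0" "1 \<ge> \<alpha>" and \<epsilon>: "\<epsilon> > 0" and ratio: "\<alpha> \<ge> \<epsilon> * ln (real n * real d) ^ 20"
    and n: "real n \<ge> polylog_factor (exp (10 ^ 4)) 20 n d \<alpha> \<epsilon> * sample_bound d \<alpha> \<epsilon>"
  show "\<exists>T. oblivious_robust_mean_tester n d \<alpha> \<epsilon> T"
  proof (cases "d = 0")
    case True
    then show ?thesis using trivial_tester[OF \<alpha>(1)] by simp
  next
    case False
    then have d: "1 \<le> d" by simp
    define L where "L = ln (real n * real d)"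
    define M where "M = max 1 (ln (real n * real d / (\<alpha> * \<epsilon>)))"
    have M: "1 \<le> M" by (simp add: M_def)
    have "1 * 1 \<le> sqrt d * (1 / \<alpha>\<^sup>2)" using d \<alpha> by (intro mult_mono) (auto simp: power_le_one le_divide_eq)
    then have SB: "1 \<le> sample_bound d \<alpha> \<epsilon>" using sample_bound_ge(1)[OF \<alpha>(1) \<epsilon>, of d] by simp
    have n': "exp (10 ^ 4) * M ^ 20 * sample_bound d \<alpha> \<epsilon> \<le> n" using n by (simp add: polylog_factor_def M_def)
    have "exp (10 ^ 4) * 1 * 1 \<le> exp (10 ^ 4) * M ^ 20 * sample_bound d \<alpha> \<epsilon>"
      using M SB by (intro mult_mono) (auto simp: one_le_power)
    then have nC: "exp (10 ^ 4) \<le> real n" using n' by linarith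
    then have npos: "0 < n" using exp_gt_zero[of "10 ^ 4 :: real"] by (metis of_nat_0_less_iff less_le_trans)
    have "real n * 1 \<le> real n * real d" using d by (intro mult_left_mono) auto
    then have "exp (10 ^ 4) \<le> real n * real d" using nC by linarith
    then have L: "10 ^ 4 \<le> L" unfolding L_def using npos d by (subst ln_ge_iff) auto
    \<comment> \<open>The ratio condition gives \<open>\<epsilon> \<le> 1\<close> because
      \<open>L \<ge> 1\<close>; dividing by \<open>\<alpha> * \<epsilon>\<close> then only enlarges
      the argument of the logarithm.\<close>
    have LM: "L \<le> M"
    proof -
      have "\<epsilon> * 1 \<le> \<epsilon> * L ^ 20" using L \<epsilon> by (intro mult_left_mono one_le_power) auto
      then have "\<epsilon> \<le> 1" using ratio \<alpha> unfolding L_def by linarith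
      then have "\<alpha> * \<epsilon> \<le> 1" using \<alpha> \<epsilon> by (simp add: mult_le_one)
      then have "real n * real d \<le> real n * real d / (\<alpha> * \<epsilon>)" using \<alpha> \<epsilon> by (simp add: le_divide_eq mult_left_le)
      then show ?thesis unfolding L_def M_def using npos d by (intro max.coboundedI2) (simp add: ln_mono)
    qed
    have "L ^ 20 * sample_bound d \<alpha> \<epsilon> \<le> n"
    proof -
      have "1 * L ^ 20 \<le> exp (10 ^ 4) * M ^ 20" using L LM by (intro mult_mono power_mono) auto
      then have "L ^ 20 * sample_bound d \<alpha> \<epsilon> \<le> exp (10 ^ 4) * M ^ 20 * sample_bound d \<alpha> \<epsilon>" using SB by (intro mult_right_mono) auto
      then show ?thesis using n' by linarith
    qed
    from tester_params_polylog[OF d \<alpha> \<epsilon> L_def L _ this] ratio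
    have "tester_params n d \<alpha> \<epsilon> (L\<^sup>2) (1 / 10 ^ 15) ((real n)\<^sup>2 * \<alpha>\<^sup>2) (real n ^ 3 * \<alpha> ^ 4 / \<epsilon>) (n * \<alpha>\<^sup>2 < L ^ 20 * (d * \<epsilon>))"
      by (simp add: L_def)
    then show ?thesis using tester_params.robust_tester by blast
  qed
qed simp

end
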